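(* For $\pi(N)(1+o(1))$ primes $p\le N$ (as $N\to\infty$), every integer $\lambda$ can be written as $$F_{n_1}+\cdots+F_{n_{16}}\equiv\lambda\pmod p,$$ where $1\le n_1,\ldots,n_{16}\le N^{1/2+o(1)}$.
   Context: $\{F_n\}$ is the Fibonacci sequence: $F_1=F_2=1$, $F_{n+2}=F_{n+1}+F_n$ for $n\ge1$. $\pi(N)$ denotes the number of primes $p\le N$; $o(1)$ denotes quantities tending to $0$ as $N\to\infty$. *)

theory Defs
  imports Complex_Main "HOL-Number_Theory.Number_Theory"
begin

text \<open>Fibonacci numbers: the library's fib satisfies fib 1 = fib 2 = 1, matching F_1 = F_2 = 1.\<close>

end

theory Submission
  imports Defs "HOL-Analysis.Analysis" "HOL-Real_Asymp.Real_Asymp"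
begin

text \<open>
  For even \<open>n\<close> and \<open>m \<ge> n\<close> we have \<open>L_n F_m = F_{m+n} + F_{m-n}\<close>, so it suffices to write every
  residue as a sum of eight products \<open>L_n F_m\<close>. By an argument of Glibichuk, eight products \<open>a b\<close> with
  \<open>a \<in> A\<close>, \<open>b \<in> B\<close> suffice if \<open>B\<close> and \<open>-B\<close> are disjoint and the product of the cardinalities of
  \<open>A\<close> and \<open>B\<close> exceeds \<open>p\<close>. With indices that are multiples of four and of size about \<open>sqrt N\<close> this
  applies as soon as \<open>p\<close> divides no \<open>F_d\<close> with \<open>0 < d \<le> C sqrt N\<close>, where \<open>C\<close> is a constant.

  The primes dividing some \<open>F_d\<close> with \<open>d \<le> \<epsilon> sqrt N\<close> are few because the product of these \<open>F_d\<close>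
  is at most \<open>exp (\<epsilon>^2 N)\<close>. If the least such \<open>d\<close> lies between \<open>\<epsilon> sqrt N\<close> and \<open>C sqrt N\<close>, then
  \<open>d\<close> divides \<open>p - 1\<close> or \<open>p + 1\<close>, and an idea of Erdos shows that this is rare: let \<open>Q\<close> be a
  finite set of primes and \<open>L\<close> the sum of their reciprocals. For most primes \<open>p\<close> the number
  \<open>p \<mp> 1\<close> has at most \<open>4 L / 3\<close> prime factors in \<open>Q\<close>, whereas a product \<open>d m\<close> typically has
  \<open>2 L\<close> of them. Both statements follow from the Brun--Titchmarsh inequality, which is obtained
  from Selberg's sieve.
\<close>

subsection \<open>Sums of products modulo a prime\<close>

text \<open>The exponent 1/2 leaves no room. The sumset argument needs more than \<open>p\<close>
  pairs of distinct residues, and beyond a constant multiple of the rank of apparition of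
  \<open>p\<close> (its least index \<open>d\<close> with \<open>p\<close> dividing
  \<open>F_d\<close>) a longer index range yields no new ones. So the rank must exceed a fixed
  multiple of sqrt p, whatever the slack \<open>o(1)\<close> in the size of the indices. Counting
  primes of rank at most y by the size of the product of the \<open>F_d\<close> gives a bound of
  order y^2 / ln N, which for y = C sqrt N is only a constant multiple of pi(N). This is why ranks
  between \<epsilon> sqrt N and C sqrt N need a separate argument. In that window the ratio of the
  endpoints is bounded, so constant factors in the sieve bounds are harmless and any saving that can
  be made arbitrarily small is enough. The saving is exp (- L / 30), with \<open>Q\<close> chosen
  after \<epsilon> but before \<open>N\<close>; as \<open>Q\<close> is fixed, the moduli
  \<open>d \<Prod>Q\<close> stay below N^(3/5). The cutoff 4 L / 3 makes both exponential moments,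
  with bases 3/2 and 1/2, decay.\<close>

lemma card_squared_le_card_image_mult_collisions:
  assumes "finite X"
  shows "(card X)\<^sup>2 \<le> card (f ` X) * card {(x, y) \<in> X \<times> X. f x = f y}"
proof -
  \<comment> \<open>The sum of the fibre sizes is \<open>card X\<close>, the sum of their squares
    counts the collisions, and Cauchy-Schwarz compares the two.\<close>
  define r where "r d = card {x \<in> X. f x = d}" for d
  have cX: "card X = (\<Sum>d\<in>f ` X. r d)"
    unfolding r_def using assms
    by (subst card_UN_disjoint [symmetric]) (auto intro!: arg_cong [where f = card])
  have "{(x, y) \<in> X \<times> X. f x = f y} = (\<Union>d\<in>f ` X. {x \<in> X. f x = d} \<times> {x \<in> X. f x = d})"
    by auto
  also have "card \<dots> = (\<Sum>d\<in>f ` X. card ({x \<in> X. f x = d} \<times> {x \<in> X. f x = d}))"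
    using assms by (intro card_UN_disjoint) auto
  also have "\<dots> = (\<Sum>d\<in>f ` X. (r d)\<^sup>2)"
    by (simp add: r_def card_cartesian_product power2_eq_square)
  finally have cE: "card {(x, y) \<in> X \<times> X. f x = f y} = (\<Sum>d\<in>f ` X. (r d)\<^sup>2)" .
  have "(\<Sum>d\<in>f ` X. real (r d))\<^sup>2 \<le> (\<Sum>d\<in>f ` X. (real (r d))\<^sup>2) * real (card (f ` X))"
    by (rule sum_squared_le_sum_of_squares)
  then have "real ((\<Sum>d\<in>f ` X. r d)\<^sup>2) \<le> real ((\<Sum>d\<in>f ` X. (r d)\<^sup>2) * card (f ` X))"
    by simp
  then show ?thesis
    unfolding cX cE by (simp only: of_nat_le_iff mult.commute)
qed

text \<open>
  Two pairs collide for only one dilation \<open>c\<close>, so some \<open>c\<close> has few collisions; and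
  \<open>a + c b\<close> has as many collisions as \<open>a - c b\<close>.
\<close>

lemma exists_dilate_with_large_sumset:
  fixes a b :: "nat \<Rightarrow> int" and p k :: nat
  assumes p: "prime p" and k: "p < k\<^sup>2"
    and inja: "\<And>i j. i < k \<Longrightarrow> j < k \<Longrightarrow> int p dvd a i - a j \<Longrightarrow> i = j"
    and injb: "\<And>i j. i < k \<Longrightarrow> j < k \<Longrightarrow> int p dvd b i - b j \<Longrightarrow> i = j"
  obtains c where
    "p < 2 * card ((\<lambda>(i, j). (a i + c * b j) mod int p) ` ({..<k} \<times> {..<k}))"
    "p < 2 * card ((\<lambda>(i, j). (a i - c * b j) mod int p) ` ({..<k} \<times> {..<k}))"
proof -
  define X where "X = {..<k} \<times> {..<k}"
  define f where "f c = (\<lambda>(i, j). (a i + c * b j) mod int p)" for c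
  define E where "E c = {(x, y) \<in> X \<times> X. f c x = f c y}" for c
  have [simp]: "finite X" "card X = k\<^sup>2" by (auto simp: X_def power2_eq_square)
  have finE: "finite (E c)" for c
    by (rule finite_subset [of _ "X \<times> X"]) (auto simp: E_def)
  have pp: "prime (int p)" "p > 0" using p prime_gt_0_nat by auto
  have k4: "k ^ 4 = k\<^sup>2 * k\<^sup>2" by (simp flip: power_add)
  have one: "card {c \<in> {0..<int p}. f c x = f c y} \<le> (if x = y then p else 1)"
    if xy: "x \<in> X" "y \<in> X" for x y
  proof (cases "x = y")
    case True
    then show ?thesis
      using card_mono [of "{0..<int p}" "{c \<in> {0..<int p}. f c x = f c y}"] by fastforce
  next
    case False
    obtain i j i' j' where [simp]: "x = (i, j)" "y = (i', j')" by (metis surj_pair)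
    have lt: "i < k" "j < k" "i' < k" "j' < k" using xy by (auto simp: X_def)
    have *: "c = d" if c: "c \<in> {0..<int p}" "f c x = f c y" and d: "d \<in> {0..<int p}" "f d x = f d y" for c d
    proof -
      have 1: "int p dvd (a i + c * b j) - (a i' + c * b j')"
        using c by (simp add: f_def mod_eq_dvd_iff)
      have 2: "int p dvd (a i + d * b j) - (a i' + d * b j')"
        using d by (simp add: f_def mod_eq_dvd_iff)
      have "int p dvd (c - d) * (b j - b j')"
        using dvd_diff [OF 1 2] by (simp add: algebra_simps)
      then have "int p dvd c - d \<or> int p dvd b j - b j'"
        using pp(1) prime_dvd_mult_iff by blast
      then show "c = d"
      proof
        assume "int p dvd c - d"
        then have "c mod int p = d mod int p" by (simp add: mod_eq_dvd_iff)
        then show ?thesis using c d by simp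
      next
        assume "int p dvd b j - b j'"
        then have "j = j'" using injb lt by auto
        then have "int p dvd a i - a i'" using 1 by simp
        then have "i = i'" using inja lt by auto
        with \<open>j = j'\<close> False show ?thesis by simp
      qed
    qed
    have "card {c \<in> {0..<int p}. f c x = f c y} \<le> Suc 0"
    proof (subst card_le_Suc0_iff_eq)
      show "finite {c \<in> {0..<int p}. f c x = f c y}"
        by (rule finite_subset [of _ "{0..<int p}"]) blast+
      show "\<forall>c\<in>{c \<in> {0..<int p}. f c x = f c y}. \<forall>d\<in>{c \<in> {0..<int p}. f c x = f c y}. c = d"
        using * by blast
    qed
    then show ?thesis unfolding if_not_P [OF False] One_nat_def .
  qed
  \<comment> \<open>Double counting of triples: each of the k^2 diagonal pairs collides for all
    \<open>p\<close> values of \<open>c\<close>, every other pair for at most one.\<close>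
  have "(\<Sum>c\<in>{0..<int p}. card (E c)) = card (SIGMA c:{0..<int p}. E c)"
    using finE by (subst card_SigmaI) auto
  also have "\<dots> = card (SIGMA z:X \<times> X. {c \<in> {0..<int p}. f c (fst z) = f c (snd z)})"
    by (rule bij_betw_same_card [of prod.swap], rule bij_betw_byWitness [of _ prod.swap]) (auto simp: E_def)
  also have "\<dots> = (\<Sum>z\<in>X \<times> X. card {c \<in> {0..<int p}. f c (fst z) = f c (snd z)})"
  proof (rule card_SigmaI)
    show "\<forall>z\<in>X \<times> X. finite {c \<in> {0..<int p}. f c (fst z) = f c (snd z)}"
      by (intro ballI, rule finite_subset [of _ "{0..<int p}"]) blast+
  qed simp
  also have "\<dots> \<le> (\<Sum>z\<in>X \<times> X. if fst z = snd z then p else 1)"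
    by (intro sum_mono one) auto
  also have "\<dots> \<le> (\<Sum>z\<in>X \<times> X. (if fst z = snd z then p else 0) + 1)"
    by (intro sum_mono) auto
  also have "\<dots> = (\<Sum>z\<in>X \<times> X. if fst z = snd z then p else 0) + k ^ 4"
    unfolding sum.distrib card_eq_sum [symmetric] card_cartesian_product \<open>card X = k\<^sup>2\<close> k4 ..
  also have "(\<Sum>z\<in>X \<times> X. if fst z = snd z then p else 0) = (\<Sum>x\<in>X. \<Sum>y\<in>X. if x = y then p else 0)"
    by (subst sum.cartesian_product) (auto intro!: sum.cong)
  also have "\<dots> = k\<^sup>2 * p" by (simp add: sum.delta')
  finally have sumE: "(\<Sum>c\<in>{0..<int p}. card (E c)) \<le> k\<^sup>2 * p + k ^ 4" .
  obtain c where c: "p * card (E c) \<le> k\<^sup>2 * p + k ^ 4"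
  proof (rule ccontr)
    assume "\<not> thesis"
    with that have *: "k\<^sup>2 * p + k ^ 4 < p * card (E c)" for c by (meson not_less)
    have "p * (k\<^sup>2 * p + k ^ 4) = (\<Sum>c\<in>{0..<int p}. k\<^sup>2 * p + k ^ 4)" by simp
    also have "\<dots> < (\<Sum>c\<in>{0..<int p}. p * card (E c))"
      using * pp by (intro sum_strict_mono) auto
    also have "\<dots> = p * (\<Sum>c\<in>{0..<int p}. card (E c))" by (simp add: sum_distrib_left)
    also have "\<dots> \<le> p * (k\<^sup>2 * p + k ^ 4)" using sumE by simp
    finally show False by simp
  qed
  \<comment> \<open>Exchanging \<open>j\<close> and \<open>j'\<close> moves the two terms containing
    \<open>c\<close> to opposite sides of the equation, which reverses the sign of
    \<open>c\<close>.\<close>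
  have "card (E (-c)) = card (E c)"
  proof (rule bij_betw_same_card)
    show "bij_betw (\<lambda>((i, j), (i', j')). ((i, j'), (i', j))) (E (-c)) (E c)"
      by (rule bij_betw_byWitness [of _ "\<lambda>((i, j), (i', j')). ((i, j'), (i', j))"])
         (auto simp: E_def f_def X_def mod_eq_dvd_iff algebra_simps)
  qed
  \<comment> \<open>If the image had at most p / 2 elements, Cauchy-Schwarz would give 2 k^4 \<le>
    k^2 p + k^4, that is k^2 \<le> p.\<close>
  moreover have large: "p < 2 * card (f e ` X)" if "card (E e) = card (E c)" for e
  proof (rule ccontr)
    assume "\<not> ?thesis"
    then have le: "2 * card (f e ` X) \<le> p" by simp
    have "(k\<^sup>2)\<^sup>2 \<le> card (f e ` X) * card (E c)"
      using card_squared_le_card_image_mult_collisions [of X "f e"] that by (simp add: E_def)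
    then have "2 * p * (k\<^sup>2)\<^sup>2 \<le> (2 * card (f e ` X)) * (p * card (E c))"
      by (simp add: algebra_simps)
    also have "\<dots> \<le> p * (k\<^sup>2 * p + k ^ 4)" using le c by (rule mult_le_mono)
    finally have "p * (2 * (k\<^sup>2)\<^sup>2) \<le> p * (k\<^sup>2 * p + k ^ 4)" by (simp add: algebra_simps)
    then have "2 * (k\<^sup>2)\<^sup>2 \<le> k\<^sup>2 * p + k ^ 4" using pp by simp
    then have "k\<^sup>2 * k\<^sup>2 \<le> k\<^sup>2 * p" by (simp add: k4 power2_eq_square)
    moreover have "k\<^sup>2 > 0" using k by linarith
    ultimately have "k\<^sup>2 \<le> p" by (meson nat_mult_le_cancel1)
    then show False using k by linarith
  qed
  ultimately have "p < 2 * card (f c ` X)" "p < 2 * card (f (-c) ` X)" by blast+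
  then show ?thesis using that [of c] by (simp add: f_def X_def)
qed

text \<open>Pigeonhole: \<open>S\<close> and the reflected set \<open>l - T\<close> together have
  more than \<open>p\<close> elements.\<close>

lemma large_subsets_of_residues_meet:
  fixes S T :: "int set"
  assumes "S \<subseteq> {0..<int p}" "T \<subseteq> {0..<int p}" "p < 2 * card S" "p < 2 * card T"
  obtains s t where "s \<in> S" "t \<in> T" "[s + t = l] (mod int p)"
proof -
  have "p > 0" using assms by (cases "p = 0") auto
  define g where "g t = (l - t) mod int p" for t
  have inj: "inj_on g T"
  proof (rule inj_onI)
    fix x y assume xy: "x \<in> T" "y \<in> T" "g x = g y"
    then have "int p dvd (l - x) - (l - y)" by (simp add: g_def mod_eq_dvd_iff)
    then have "int p dvd y - x" by simp
    then have "y mod int p = x mod int p" by (simp add: mod_eq_dvd_iff)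
    then show "x = y" using xy assms(2) by (auto simp: subset_iff)
  qed
  have fin: "finite S" "finite T" using assms by (meson finite_atLeastLessThan_int finite_subset)+
  have "S \<inter> g ` T \<noteq> {}"
  proof
    assume "S \<inter> g ` T = {}"
    then have "card (S \<union> g ` T) = card S + card T"
      using fin inj by (simp add: card_Un_disjoint card_image)
    moreover have "card (S \<union> g ` T) \<le> card {0..<int p}"
      using assms \<open>p > 0\<close> by (intro card_mono) (auto simp: g_def)
    ultimately show False using assms by simp
  qed
  then obtain t where t: "t \<in> T" "g t \<in> S" by auto
  have "[g t + t = l] (mod int p)"
    by (simp add: g_def unique_euclidean_semiring_class.cong_def mod_simps)
  then show ?thesis using t that by blast
qed

text \<open>Eight is two times four: \<open>l\<close> is a sum of two elements of a set of more than
  p / 2 residues, each of which is a sum of four products. The hypothesis \<open>anti\<close>, which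
  includes \<open>i = j\<close>, makes the denominator \<beta> invertible.\<close>

lemma every_residue_is_sum_of_8_products:
  fixes a b :: "nat \<Rightarrow> int" and p k :: nat
  assumes p: "prime p" and k: "p < k\<^sup>2"
    and inja: "\<And>i j. i < k \<Longrightarrow> j < k \<Longrightarrow> int p dvd a i - a j \<Longrightarrow> i = j"
    and injb: "\<And>i j. i < k \<Longrightarrow> j < k \<Longrightarrow> int p dvd b i - b j \<Longrightarrow> i = j"
    and anti: "\<And>i j. i < k \<Longrightarrow> j < k \<Longrightarrow> \<not> int p dvd b i + b j"
  obtains u v :: "nat \<Rightarrow> nat" where "\<And>i. i < 8 \<Longrightarrow> u i < k" "\<And>i. i < 8 \<Longrightarrow> v i < k"
    "[(\<Sum>i<8. a (u i) * b (v i)) = l] (mod int p)"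
proof -
  let ?X = "{..<k} \<times> {..<k}"
  have pp: "prime (int p)" "p > 0" using p prime_gt_0_nat by auto
  obtain c where c: "p < 2 * card ((\<lambda>(i, j). (a i + c * b j) mod int p) ` ?X)"
    "p < 2 * card ((\<lambda>(i, j). (a i - c * b j) mod int p) ` ?X)"
    using exists_dilate_with_large_sumset [OF p k inja injb] by blast
  have sub: "(\<lambda>(i, j). F i j mod int p) ` ?X \<subseteq> {0..<int p}" for F
    using pp by auto
  obtain s t where "s \<in> (\<lambda>(i, j). (a i - c * b j) mod int p) ` ?X"
      "t \<in> (\<lambda>(i, j). (a i - c * b j) mod int p) ` ?X" and st: "[s + t = 0] (mod int p)"
    by (rule large_subsets_of_residues_meet [OF sub sub c(2) c(2)])
  then obtain i1 j1 i2 j2 where ij: "i1 < k" "j1 < k" "i2 < k" "j2 < k"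
      and s: "s = (a i1 - c * b j1) mod int p" and t: "t = (a i2 - c * b j2) mod int p"
    by auto
  \<comment> \<open>A set of more than \<open>p / 2\<close> residues meets its negative, so \<open>c\<close> is a ratio \<open>\<alpha> / \<beta>\<close> of
    sums of two terms; hence \<open>\<beta> (a + c b)\<close> is a sum of four products without minus signs.\<close>
  define \<alpha> where "\<alpha> = a i1 + a i2"
  define \<beta> where "\<beta> = b j1 + b j2"
  have ab: "int p dvd \<alpha> - c * \<beta>"
  proof -
    have "((a i1 - c * b j1) + (a i2 - c * b j2)) mod int p = 0"
      using st unfolding s t by (simp add: unique_euclidean_semiring_class.cong_def mod_add_eq)
    then show ?thesis by (simp add: \<alpha>_def \<beta>_def algebra_simps mod_eq_0_iff_dvd)
  qed
  have \<beta>: "\<not> int p dvd \<beta>" using anti ij by (simp add: \<beta>_def)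
  define G where "G = (\<lambda>(i, j). (\<beta> * a i + \<alpha> * b j) mod int p)"
  have GX: "card (G ` ?X) = card ((\<lambda>(i, j). (a i + c * b j) mod int p) ` ?X)"
  proof -
    have *: "G z = (\<beta> * ((\<lambda>(i, j). (a i + c * b j) mod int p) z)) mod int p" for z
    proof -
      obtain i j where [simp]: "z = (i, j)" by (cases z)
      have "int p dvd (\<alpha> - c * \<beta>) * b j" using ab by (rule dvd_mult2)
      then have "int p dvd (\<beta> * a i + \<alpha> * b j) - \<beta> * (a i + c * b j)"
        by (simp add: algebra_simps)
      then have "(\<beta> * a i + \<alpha> * b j) mod int p = (\<beta> * (a i + c * b j)) mod int p"
        by (simp add: mod_eq_dvd_iff)
      then show ?thesis by (simp add: G_def mod_simps)
    qed
    have "G ` ?X = (\<lambda>x. \<beta> * x mod int p) ` ((\<lambda>(i, j). (a i + c * b j) mod int p) ` ?X)"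
      unfolding image_image by (intro image_cong refl *)
    also have "card \<dots> = card ((\<lambda>(i, j). (a i + c * b j) mod int p) ` ?X)"
    proof (rule card_image, rule inj_onI)
      fix x y assume x: "x \<in> (\<lambda>(i, j). (a i + c * b j) mod int p) ` ?X"
        and y: "y \<in> (\<lambda>(i, j). (a i + c * b j) mod int p) ` ?X"
        and eq: "\<beta> * x mod int p = \<beta> * y mod int p"
      have "int p dvd \<beta> * (x - y)" using eq by (simp add: mod_eq_dvd_iff algebra_simps)
      then have "int p dvd x - y" using \<beta> pp prime_dvd_mult_iff by blast
      then have "x mod int p = y mod int p" by (simp add: mod_eq_dvd_iff)
      then show "x = y" using sub x y by auto
    qed
    finally show ?thesis .
  qed
  have Gsub: "G ` ?X \<subseteq> {0..<int p}" unfolding G_def by (rule sub)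
  obtain x y where "x \<in> G ` ?X" "y \<in> G ` ?X" and xy: "[x + y = l] (mod int p)"
    using large_subsets_of_residues_meet [OF Gsub Gsub] c(1) GX by metis
  then obtain i3 j3 i4 j4 where ij': "i3 < k" "j3 < k" "i4 < k" "j4 < k"
      and x: "x = (\<beta> * a i3 + \<alpha> * b j3) mod int p" and y: "y = (\<beta> * a i4 + \<alpha> * b j4) mod int p"
    by (auto simp: G_def)
  \<comment> \<open>These list the products in (b j1 + b j2) a i3 + (a i1 + a i2) b j3, followed by
    the same with i4 and j4.\<close>
  define u where "u = (!) [i3, i3, i1, i2, i4, i4, i1, i2]"
  define v where "v = (!) [j1, j2, j3, j3, j1, j2, j4, j4]"
  have "(\<Sum>i<8. a (u i) * b (v i)) = (\<beta> * a i3 + \<alpha> * b j3) + (\<beta> * a i4 + \<alpha> * b j4)"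
    by (simp add: u_def v_def \<alpha>_def \<beta>_def eval_nat_numeral algebra_simps)
  also have "[\<dots> = x + y] (mod int p)" by (simp add: x y unique_euclidean_semiring_class.cong_def mod_simps)
  finally have "[(\<Sum>i<8. a (u i) * b (v i)) = l] (mod int p)" using xy cong_trans by blast
  moreover have "\<forall>i<8. u i < k" "\<forall>i<8. v i < k"
    using ij ij' by (auto simp: u_def v_def less_Suc_eq eval_nat_numeral)
  ultimately show ?thesis using that by blast
qed

subsection \<open>Fibonacci and Lucas numbers modulo a prime\<close>

text \<open>The usual F_(n-1) + F_(n+1), written without the index n - 1 so that
  \<open>lucas 0 = 2\<close> comes out right.\<close>

definition lucas :: "nat \<Rightarrow> int" where
  "lucas n = 2 * int (fib (Suc n)) - int (fib n)"

lemma fib_Cassini_quadratic: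
  "(int (fib (Suc n)))\<^sup>2 - int (fib (Suc n)) * int (fib n) - (int (fib n))\<^sup>2 = (-1) ^ n"
  using fib_Cassini_int [of n] by (simp add: power2_eq_square algebra_simps)

lemma fib_double:
  "int (fib (2 * n)) = 2 * int (fib (Suc n)) * int (fib n) - (int (fib n))\<^sup>2"
  "int (fib (Suc (2 * n))) = (int (fib (Suc n)))\<^sup>2 + (int (fib n))\<^sup>2"
proof -
  show "int (fib (Suc (2 * n))) = (int (fib (Suc n)))\<^sup>2 + (int (fib n))\<^sup>2"
    using fib_add [of n n] by (simp add: mult_2 power2_eq_square)
  show "int (fib (2 * n)) = 2 * int (fib (Suc n)) * int (fib n) - (int (fib n))\<^sup>2"
  proof (cases n)
    case (Suc m)
    have "fib (2 * n) = fib (Suc (n + m))" by (simp add: Suc mult_2)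
    also have "\<dots> = fib (Suc m) * fib (Suc n) + fib m * fib n" by (rule fib_add)
    finally have "int (fib (2 * n)) = int (fib n) * int (fib (Suc n)) + int (fib m) * int (fib n)"
      by (simp add: Suc)
    moreover have "int (fib (Suc n)) = int (fib n) + int (fib m)" by (simp add: Suc)
    ultimately show ?thesis by (simp add: algebra_simps power2_eq_square)
  qed simp
qed

text \<open>Both sides satisfy the Fibonacci recurrence in \<open>j\<close>, so the cases
  \<open>j = 0\<close> and \<open>j = 1\<close> decide; they follow from the doubling formulas and
  Cassini's identity. The next two identities are proved in the same way.\<close>

lemma lucas_mult_fib: "lucas n * int (fib (n + j)) = int (fib (2 * n + j)) + (-1) ^ n * int (fib j)"
proof (induction j rule: fib.induct)
  case 1
  show ?case
    using fib_double(1) [of n] by (simp add: lucas_def power2_eq_square algebra_simps)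
next
  case 2
  show ?case
    using fib_double(2) [of n] fib_Cassini_quadratic [of n]
    by (simp add: lucas_def power2_eq_square algebra_simps)
next
  case (3 j)
  then show ?case by (simp add: algebra_simps)
qed

lemma fib_mult_lucas: "int (fib n) * lucas (n + j) = int (fib (2 * n + j)) - (-1) ^ n * int (fib j)"
proof (induction j rule: fib.induct)
  case 1
  show ?case
    using fib_double(1) [of n] by (simp add: lucas_def power2_eq_square algebra_simps)
next
  case 2
  show ?case
    using fib_double(2) [of n] fib_Cassini_quadratic [of n]
    by (simp add: lucas_def power2_eq_square algebra_simps)
next
  case (3 j)
  then show ?case by (simp add: lucas_def algebra_simps)
qed

text \<open>For even \<open>n\<close> this and \<open>fib_mult_lucas\<close> factor differences of
  two Lucas or two Fibonacci numbers, and \<open>lucas_mult_fib\<close> factors sums. Congruences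
  between terms thus reduce to the vanishing of single terms modulo \<open>p\<close>.\<close>

lemma fib_mult_fib: "5 * int (fib n) * int (fib (n + j)) = lucas (2 * n + j) - (-1) ^ n * lucas j"
proof (induction j rule: fib.induct)
  case 1
  show ?case
    using fib_double [of n] fib_Cassini_quadratic [of n]
    by (simp add: lucas_def power2_eq_square algebra_simps)
next
  case 2
  show ?case
    using fib_double [of n] fib_Cassini_quadratic [of n]
    by (simp add: lucas_def power2_eq_square algebra_simps)
next
  case (3 j)
  then show ?case by (simp add: lucas_def algebra_simps)
qed

lemma dvd_lucas_imp_dvd_fib: "int p dvd lucas n \<Longrightarrow> p dvd fib (2 * n)"
  using lucas_mult_fib [of n 0] by (metis add_0_right dvd_mult2 fib.simps(1) int_dvd_int_iff mult_zero_right of_nat_0)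

text \<open>The indices are multiples of four so that half the difference of two of them is still
  even and the sign in the product formulas is +1. Starting \<open>b\<close> at index
  \<open>4 * k\<close> keeps the difference of the two indices in a product positive. The condition
  \<open>p > 5\<close> makes 2 = \<open>lucas 0\<close> and the factor 5 of
  \<open>fib_mult_fib\<close> invertible.\<close>

lemma every_residue_is_sum_of_16_fib:
  fixes p k :: nat
  assumes p: "prime p" "p > 5" and k: "p < k\<^sup>2"
    and rank: "\<And>d. 0 < d \<Longrightarrow> d \<le> 16 * k \<Longrightarrow> \<not> p dvd fib d"
  shows "\<exists>n :: nat \<Rightarrow> nat. (\<forall>i<16. 1 \<le> n i \<and> n i \<le> 12 * k) \<and> [(\<Sum>i<16. int (fib (n i))) = l] (mod int p)"
proof -
  define a where "a i = lucas (4 * i)" for i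
  define b where "b j = int (fib (4 * (k + j)))" for j
  have pp: "prime (int p)" using p by simp
  have k0: "k > 0" using k by (cases k) auto
  have n2: "\<not> int p dvd 2" using p zdvd_imp_le [of "int p" 2] by auto
  have n5: "\<not> int p dvd 5" using p zdvd_imp_le [of "int p" 5] by auto
  have nfib: "\<not> int p dvd int (fib d)" if "0 < d" "d \<le> 16 * k" for d
    using rank that by (simp add: int_dvd_int_iff)
  have nluc: "\<not> int p dvd lucas d" if "0 < d" "2 * d \<le> 16 * k" for d
    using rank [of "2 * d"] that dvd_lucas_imp_dvd_fib by auto
  have a_diff: "\<not> int p dvd a (j + e) - a j" if "j + e < k" "e > 0" for j e
  proof -
    have "a (j + e) - a j = 5 * int (fib (2 * e)) * int (fib (2 * e + 4 * j))"
      using fib_mult_fib [of "2 * e" "4 * j"] by (simp add: a_def algebra_simps)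
    moreover have "\<not> int p dvd int (fib (2 * e))" "\<not> int p dvd int (fib (2 * e + 4 * j))"
      using that by (intro nfib; simp)+
    ultimately show ?thesis using pp n5 by (simp add: prime_dvd_mult_iff)
  qed
  have b_diff: "\<not> int p dvd b (j + e) - b j" if "j + e < k" "e > 0" for j e
  proof -
    have "b (j + e) - b j = int (fib (2 * e)) * lucas (2 * e + 4 * (k + j))"
      using fib_mult_lucas [of "2 * e" "4 * (k + j)"] by (simp add: b_def algebra_simps)
    \<comment> \<open>The vanishing of \<open>lucas d\<close> is controlled only through
      \<open>fib (2 * d)\<close>. Doubling \<open>2 * e + 4 * (k + j)\<close> stays below
      \<open>16 * k\<close> because \<open>j + e < k\<close>; this is the origin of the constant
      16.\<close>
    moreover have "\<not> int p dvd int (fib (2 * e))" "\<not> int p dvd lucas (2 * e + 4 * (k + j))"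
      using that by (intro nfib nluc; simp)+
    ultimately show ?thesis using pp by (simp add: prime_dvd_mult_iff)
  qed
  have b_add: "\<not> int p dvd b (j + e) + b j" if "j + e < k" for j e
  proof -
    have "b (j + e) + b j = lucas (2 * e) * int (fib (2 * e + 4 * (k + j)))"
      using lucas_mult_fib [of "2 * e" "4 * (k + j)"] by (simp add: b_def algebra_simps)
    moreover have "\<not> int p dvd int (fib (2 * e + 4 * (k + j)))"
      using that k0 by (intro nfib) simp_all
    moreover have "\<not> int p dvd lucas (2 * e)"
    proof (cases "e = 0")
      case True
      then show ?thesis using n2 by (simp add: lucas_def)
    next
      case False
      then show ?thesis using that by (intro nluc) simp_all
    qed
    ultimately show ?thesis using pp by (simp add: prime_dvd_mult_iff)
  qed
  obtain u v :: "nat \<Rightarrow> nat" where u: "\<And>i. i < 8 \<Longrightarrow> u i < k" and v: "\<And>i. i < 8 \<Longrightarrow> v i < k"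
    and uv: "[(\<Sum>i<8. a (u i) * b (v i)) = l] (mod int p)"
  proof (rule every_residue_is_sum_of_8_products [OF p(1) k, of a b l])
    show "i = j" if "i < k" "j < k" "int p dvd a i - a j" for i j
    proof (rule ccontr)
      assume "i \<noteq> j"
      then consider "i < j" | "j < i" by linarith
      then show False
      proof cases
        case 1
        then show False using a_diff [of i "j - i"] that dvd_diff_commute by auto
      next
        case 2
        then show False using a_diff [of j "i - j"] that by auto
      qed
    qed
    show "i = j" if "i < k" "j < k" "int p dvd b i - b j" for i j
    proof (rule ccontr)
      assume "i \<noteq> j"
      then consider "i < j" | "j < i" by linarith
      then show False
      proof cases
        case 1
        then show False using b_diff [of i "j - i"] that dvd_diff_commute by auto
      next
        case 2
        then show False using b_diff [of j "i - j"] that by auto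
      qed
    qed
    show "\<not> int p dvd b i + b j" if "i < k" "j < k" for i j
      using b_add [of i "j - i"] b_add [of j "i - j"] that
      by (cases "i \<le> j") (auto simp: add.commute)
  qed blast
  \<comment> \<open>Product number \<open>i div 2\<close> supplies two Fibonacci numbers, at the sum
    and the difference of its indices; the subtraction is not truncated since
    \<open>u (i div 2) < k\<close>.\<close>
  define n where "n i = (if even i then 4 * (k + v (i div 2)) + 4 * u (i div 2)
    else 4 * (k + v (i div 2)) - 4 * u (i div 2))" for i
  have pair: "a (u i) * b (v i) = int (fib (n (2 * i))) + int (fib (n (2 * i + 1)))" if "i < 8" for i
  proof -
    have "4 * (k + v i) = 4 * u i + 4 * (k + v i - u i)" using u [OF that] by simp
    then have "a (u i) * b (v i) = lucas (4 * u i) * int (fib (4 * u i + 4 * (k + v i - u i)))"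
      by (simp only: a_def b_def)
    also have "\<dots> = int (fib (2 * (4 * u i) + 4 * (k + v i - u i))) + int (fib (4 * (k + v i - u i)))"
      by (subst lucas_mult_fib) simp
    also have "2 * (4 * u i) + 4 * (k + v i - u i) = n (2 * i)"
      using u [OF that] by (simp add: n_def)
    also have "4 * (k + v i - u i) = n (2 * i + 1)"
      using u [OF that] by (simp add: n_def)
    finally show ?thesis .
  qed
  have "(\<Sum>i<16. int (fib (n i))) = (\<Sum>i<8. int (fib (n (2 * i))) + int (fib (n (2 * i + 1))))"
    by (simp add: eval_nat_numeral)
  also have "\<dots> = (\<Sum>i<8. a (u i) * b (v i))"
    by (intro sum.cong) (auto simp: pair)
  finally have "[(\<Sum>i<16. int (fib (n i))) = l] (mod int p)" using uv by simp
  moreover have "1 \<le> n i \<and> n i \<le> 12 * k" if "i < 16" for i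
  proof -
    have "i div 2 < 8" using that by auto
    from u [OF this] v [OF this] show ?thesis by (auto simp: n_def)
  qed
  ultimately show ?thesis by blast
qed

section \<open>The rank of apparition divides p - 1 or p + 1\<close>

text \<open>Binet's formula expanded by the binomial theorem, where the even powers of sqrt 5
  cancel. Modulo an odd prime \<open>n\<close> all terms except \<open>k = n\<close> vanish.\<close>

lemma two_power_mult_fib:
  "2 ^ n * fib n = (\<Sum>k\<le>n. if odd k then 2 * (n choose k) * 5 ^ (k div 2) else 0)"
proof -
  let ?s = "sqrt 5 :: real"
  have s2: "?s * ?s = 5" by simp
  have pw: "?s ^ k - (- ?s) ^ k = (if odd k then 2 * ?s * 5 ^ (k div 2) else 0)" for k
  proof (cases "odd k")
    case True
    then obtain m where k: "k = 2 * m + 1" by (elim oddE)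
    then show ?thesis by (simp add: power_mult)
  qed simp
  have "real (fib n) = (((1 + ?s) / 2) ^ n - ((1 - ?s) / 2) ^ n) / ?s"
    by (rule fib_closed_form [THEN trans]) simp
  then have "real (2 ^ n * fib n) * ?s = (1 + ?s) ^ n - (1 - ?s) ^ n"
    by (simp add: power_divide field_simps)
  also have "\<dots> = (?s + 1) ^ n - (- ?s + 1) ^ n" by (simp add: add.commute)
  also have "\<dots> = (\<Sum>k\<le>n. real (n choose k) * ?s ^ k) - (\<Sum>k\<le>n. real (n choose k) * (- ?s) ^ k)"
    unfolding binomial_ring by simp
  also have "\<dots> = (\<Sum>k\<le>n. real (n choose k) * (?s ^ k - (- ?s) ^ k))"
    by (simp add: sum_subtractf algebra_simps)
  also have "\<dots> = (\<Sum>k\<le>n. ?s * real (if odd k then 2 * (n choose k) * 5 ^ (k div 2) else 0))"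
    by (intro sum.cong refl) (simp add: pw)
  also have "\<dots> = ?s * real (\<Sum>k\<le>n. if odd k then 2 * (n choose k) * 5 ^ (k div 2) else 0)"
    by (simp only: of_nat_sum sum_distrib_left)
  finally have "real (2 ^ n * fib n) = real (\<Sum>k\<le>n. if odd k then 2 * (n choose k) * 5 ^ (k div 2) else 0)"
    by simp
  then show ?thesis by (simp only: of_nat_eq_iff)
qed

text \<open>\<open>fib p\<close> is congruent to 5^((p-1)/2), the Legendre symbol of 5, whose square
  is 1 by Fermat. Its sign decides between p - 1 and p + 1; both cases are treated later, so only
  the square is kept.\<close>

lemma fib_prime_squared_cong:
  fixes p :: nat
  assumes p: "prime p" "p > 5"
  shows "[(fib p)\<^sup>2 = 1] (mod p)"
proof -
  have odd: "odd p" using p prime_odd_nat by auto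
  have "[2 ^ p * fib p = 2 * 5 ^ (p div 2)] (mod p)"
  proof -
    have "{..p} = insert p {..<p}" by auto
    then have "2 ^ p * fib p = 2 * 5 ^ (p div 2) + (\<Sum>k<p. if odd k then 2 * (p choose k) * 5 ^ (k div 2) else 0)"
      using odd by (simp add: two_power_mult_fib)
    moreover have "p dvd (\<Sum>k<p. if odd k then 2 * (p choose k) * 5 ^ (k div 2) else 0)"
    proof (rule dvd_sum)
      fix k assume "k \<in> {..<p}"
      then have "p dvd (p choose k)" if "odd k"
        using that p by (intro dvd_choose_prime) (auto elim: oddE)
      then show "p dvd (if odd k then 2 * (p choose k) * 5 ^ (k div 2) else 0)" by auto
    qed
    ultimately show ?thesis
      by (auto simp: unique_euclidean_semiring_class.cong_def elim!: dvdE)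
  qed
  moreover have "[2 ^ p = 2] (mod p)"
  proof -
    have "\<not> p dvd 2" using p by (auto dest: dvd_imp_le)
    then have "[2 ^ (p - 1) = 1] (mod p)" using fermat_theorem p by blast
    then have "[2 ^ (p - 1) * 2 = 1 * 2] (mod p)" by (rule cong_mult) simp
    moreover have "2 ^ (p - 1) * 2 = (2::nat) ^ p" using p by (metis mult.commute power_minus_mult prime_gt_0_nat)
    ultimately show ?thesis by simp
  qed
  ultimately have "[2 * fib p = 2 * 5 ^ (p div 2)] (mod p)"
    by (meson cong_scalar_right cong_sym cong_trans)
  moreover have "coprime 2 p" using odd by simp
  ultimately have "[fib p = 5 ^ (p div 2)] (mod p)"
    by (simp add: cong_mult_lcancel_nat)
  then have "[(fib p)\<^sup>2 = (5 ^ (p div 2))\<^sup>2] (mod p)" by (rule cong_pow)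
  also have "(5 ^ (p div 2))\<^sup>2 = (5::nat) ^ (p - 1)"
  proof -
    obtain m where "p = 2 * m + 1" using odd by (elim oddE)
    then show ?thesis by (simp add: mult.commute flip: power_mult)
  qed
  also have "[5 ^ (p - 1) = 1] (mod p)"
  proof -
    have "\<not> p dvd 5" using p by (auto dest: dvd_imp_le)
    then show ?thesis using fermat_theorem p by blast
  qed
  finally show ?thesis .
qed

text \<open>For odd \<open>p\<close> Cassini's identity reads F_(p-1) F_(p+1) = F_p^2 - 1.\<close>

lemma prime_dvd_fib_neighbour:
  fixes p :: nat
  assumes p: "prime p" "p > 5"
  shows "p dvd fib (p - 1) \<or> p dvd fib (p + 1)"
proof -
  have odd: "odd p" using p prime_odd_nat by auto
  obtain m where m: "p = Suc m" using p by (cases p) auto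
  have "int (fib (p + 1) * fib (p - 1)) - int ((fib p)\<^sup>2) = - 1"
    using fib_Cassini_int [of m] odd by (simp add: m)
  then have "int (fib (p + 1) * fib (p - 1)) = int ((fib p)\<^sup>2) - 1" by simp
  moreover have "int p dvd int ((fib p)\<^sup>2) - 1"
    using fib_prime_squared_cong [OF p] by (metis cong_iff_dvd_diff cong_int_iff of_nat_1)
  ultimately have "p dvd fib (p + 1) * fib (p - 1)" by (metis int_dvd_int_iff)
  then show ?thesis using p prime_dvd_mult_iff by blast
qed

text \<open>Since gcd (F_d, F_m) = F_(gcd (d, m)), every index \<open>m\<close> with
  \<open>p\<close> dividing F_m is a multiple of the least positive one.\<close>

lemma fib_rank_dvd_neighbour:
  fixes p d :: nat
  assumes p: "prime p" "p > 5" and d: "d > 0" "p dvd fib d"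
    and least: "\<And>e. 0 < e \<Longrightarrow> e < d \<Longrightarrow> \<not> p dvd fib e"
  shows "d dvd p - 1 \<or> d dvd p + 1"
proof -
  have *: "d dvd m" if "p dvd fib m" for m
  proof -
    have "p dvd fib (gcd d m)" using that d by (simp add: fib_gcd)
    then have "\<not> gcd d m < d" using least d by (metis gcd_pos_nat)
    then have "gcd d m = d" using d by (metis gcd_le1_nat le_neq_implies_less less_not_refl2)
    then show ?thesis by (metis gcd_dvd2)
  qed
  show ?thesis using prime_dvd_fib_neighbour [OF p] * by blast
qed

subsection \<open>Euler products\<close>

lemma prod_primes_dvd:
  fixes n :: nat
  assumes "finite S" "\<And>r. r \<in> S \<Longrightarrow> prime r" "\<And>r. r \<in> S \<Longrightarrow> r dvd n"
  shows "\<Prod>S dvd n"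
  using assms
proof (induction S rule: finite_induct)
  case (insert r S)
  have "coprime r (\<Prod>S)"
    using insert by (intro prod_coprime_right) (metis insertI1 insertI2 primes_coprime)
  then have "r * \<Prod>S dvd n" using insert by (intro divides_mult) auto
  then show ?case using insert by simp
qed simp

lemma geometric_sum_le:
  fixes x :: real
  assumes "0 \<le> x" "x < 1"
  shows "(\<Sum>e=0..M. x ^ e) \<le> 1 / (1 - x)" "(\<Sum>e=1..M. x ^ e) \<le> x / (1 - x)"
proof -
  have le: "(\<Sum>e<n. x ^ e) \<le> 1 / (1 - x)" for n
    using assms by (subst sum_gp_strict) (auto simp: divide_simps)
  have "{0..M} = {..<Suc M}" by auto
  then show "(\<Sum>e=0..M. x ^ e) \<le> 1 / (1 - x)" using le by metis
  have "(\<Sum>e=1..M. x ^ e) = (\<Sum>e<M. x ^ Suc e)"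
    by (rule sum.reindex_bij_witness [of _ Suc "\<lambda>e. e - 1"]) auto
  also have "\<dots> = x * (\<Sum>e<M. x ^ e)" by (simp add: sum_distrib_left)
  also have "\<dots> \<le> x * (1 / (1 - x))" using assms le by (intro mult_left_mono) auto
  finally show "(\<Sum>e=1..M. x ^ e) \<le> x / (1 - x)" by simp
qed

text \<open>Unique factorisation embeds \<open>X\<close> into exponent vectors, with exponents at
  least 1 on \<open>S\<close> and at least 0 on \<open>W\<close>; the factors on the right are the
  two geometric series. With \<open>S\<close> empty it gives the divergence of the sum of reciprocal
  primes; with \<open>W\<close> the primes dividing \<open>q\<close> it bounds the sieve mass from
  below.\<close>

lemma sum_inverse_le_Euler_product:
  fixes S W X :: "nat set"
  assumes fin: "finite S" "finite W" "finite X" and disj: "S \<inter> W = {}"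
    and primes: "\<And>r. r \<in> S \<union> W \<Longrightarrow> prime r"
    and X: "\<And>n. n \<in> X \<Longrightarrow> n > 0 \<and> S \<subseteq> prime_factors n \<and> prime_factors n \<subseteq> S \<union> W"
  shows "(\<Sum>n\<in>X. 1 / real n) \<le> (\<Prod>r\<in>S. 1 / (real r - 1)) * (\<Prod>r\<in>W. real r / (real r - 1))"
proof -
  \<comment> \<open>\<open>M\<close> bounds all elements of \<open>X\<close>, hence all exponents,
    so that the vectors range over a finite product set.\<close>
  define M where "M = \<Sum>X"
  define T where "T = S \<union> W"
  define Ex where "Ex r = (if r \<in> S then {1..M} else {0..M})" for r
  define \<Phi> where "\<Phi> n = restrict (\<lambda>r. multiplicity r n) T" for n :: nat
  have finT: "finite T" using fin by (simp add: T_def)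
  have eq: "n = (\<Prod>r\<in>T. r ^ multiplicity r n)" if "n \<in> X" for n
  proof -
    have "n = (\<Prod>r\<in>prime_factors n. r ^ multiplicity r n)"
      using X [OF that] by (simp add: prod_prime_factors)
    also have "\<dots> = (\<Prod>r\<in>T. r ^ multiplicity r n)"
    proof (intro prod.mono_neutral_left ballI)
      fix r assume r: "r \<in> T - prime_factors n"
      then have "\<not> r dvd n" using primes X [OF that] by (auto simp: T_def in_prime_factors_iff)
      then show "r ^ multiplicity r n = 1" by (simp add: not_dvd_imp_multiplicity_0)
    qed (use finT X [OF that] in \<open>auto simp: T_def\<close>)
    finally show ?thesis .
  qed
  have inj: "inj_on \<Phi> X"
  proof (rule inj_onI)
    fix n m assume nm: "n \<in> X" "m \<in> X" "\<Phi> n = \<Phi> m"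
    then have "multiplicity r n = multiplicity r m" if "r \<in> T" for r
      using that by (metis \<Phi>_def restrict_apply')
    then have "(\<Prod>r\<in>T. r ^ multiplicity r n) = (\<Prod>r\<in>T. r ^ multiplicity r m)" by simp
    then show "n = m" using eq nm by metis
  qed
  have sub: "\<Phi> ` X \<subseteq> PiE T Ex"
  proof clarify
    fix n assume n: "n \<in> X"
    have "multiplicity r n \<in> Ex r" if r: "r \<in> T" for r
    proof -
      have pr: "prime r" using r primes by (auto simp: T_def)
      have "r ^ multiplicity r n dvd n" by (rule multiplicity_dvd)
      then have "r ^ multiplicity r n \<le> n" using X [OF n] by (auto dest: dvd_imp_le)
      moreover have "multiplicity r n < r ^ multiplicity r n"
        using pr by (intro power_gt_expt) (auto dest: prime_gt_1_nat)
      moreover have "n \<le> M" unfolding M_def using fin n by (intro member_le_sum) auto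
      ultimately have "multiplicity r n \<le> M" by linarith
      moreover have "1 \<le> multiplicity r n" if "r \<in> S"
        using X [OF n] that pr by (auto simp: prime_factors_multiplicity)
      ultimately show ?thesis by (auto simp: Ex_def)
    qed
    then show "\<Phi> n \<in> PiE T Ex" by (auto simp: \<Phi>_def)
  qed
  have finEx: "finite (Ex r)" for r by (simp add: Ex_def)
  have "(\<Sum>n\<in>X. 1 / real n) = (\<Sum>n\<in>X. \<Prod>r\<in>T. (1 / real r) ^ \<Phi> n r)"
  proof (intro sum.cong refl)
    fix n assume "n \<in> X"
    then have "real n = (\<Prod>r\<in>T. real r ^ multiplicity r n)"
      using eq by (metis (mono_tags, lifting) of_nat_power of_nat_prod prod.cong)
    then have "1 / real n = (\<Prod>r\<in>T. 1 / real r ^ multiplicity r n)"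
      by (simp add: prod_dividef)
    also have "\<dots> = (\<Prod>r\<in>T. (1 / real r) ^ \<Phi> n r)"
      by (intro prod.cong refl) (simp add: \<Phi>_def power_one_over)
    finally show "1 / real n = (\<Prod>r\<in>T. (1 / real r) ^ \<Phi> n r)" .
  qed
  also have "\<dots> = (\<Sum>g\<in>\<Phi> ` X. \<Prod>r\<in>T. (1 / real r) ^ g r)"
    by (simp add: sum.reindex [OF inj])
  also have "\<dots> \<le> (\<Sum>g\<in>PiE T Ex. \<Prod>r\<in>T. (1 / real r) ^ g r)"
    using sub finT finEx by (intro sum_mono2 finite_PiE prod_nonneg) auto
  also have "\<dots> = (\<Prod>r\<in>T. \<Sum>e\<in>Ex r. (1 / real r) ^ e)"
    by (rule prod_sum_PiE [symmetric]) (use finT finEx in auto)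
  also have "\<dots> \<le> (\<Prod>r\<in>T. if r \<in> S then 1 / (real r - 1) else real r / (real r - 1))"
  proof (intro prod_mono conjI)
    fix r assume "r \<in> T"
    then have r: "real r > 1" using primes prime_gt_1_nat by (auto simp: T_def)
    show "0 \<le> (\<Sum>e\<in>Ex r. (1 / real r) ^ e)" by (intro sum_nonneg) auto
    have "(1 / real r) / (1 - 1 / real r) = 1 / (real r - 1)" "1 / (1 - 1 / real r) = real r / (real r - 1)"
      using r by (simp_all add: field_simps)
    then show "(\<Sum>e\<in>Ex r. (1 / real r) ^ e) \<le> (if r \<in> S then 1 / (real r - 1) else real r / (real r - 1))"
      using geometric_sum_le [of "1 / real r" M] r by (auto simp: Ex_def)
  qed
  also have "\<dots> = (\<Prod>r\<in>S. 1 / (real r - 1)) * (\<Prod>r\<in>W. real r / (real r - 1))"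
  proof -
    have "r \<notin> S" if "r \<in> W" for r using that disj by auto
    then show ?thesis using fin disj by (simp add: T_def prod.union_disjoint)
  qed
  finally show ?thesis .
qed

text \<open>Euler's argument: the harmonic sum up to \<open>n\<close> is at most the product of r /
  (r - 1) over the primes up to \<open>n\<close>. The prime 2 is dropped because the later
  comparison of q / 2 with q - 3/2 requires \<open>q \<ge> 3\<close>.\<close>

lemma sum_inverse_primes_unbounded: "\<exists>Q. finite Q \<and> (\<forall>q\<in>Q. prime q \<and> q \<ge> 3) \<and> B \<le> (\<Sum>q\<in>Q. 1 / real (q :: nat))"
proof -
  \<comment> \<open>In the sum of 1 / (r - 1) the prime 2 contributes 1, and the other terms are at
    most 2 / r; hence \<open>2 * B + 1\<close>.\<close>
  have "eventually (\<lambda>n. exp (2 * B + 1) \<le> (harm n :: real)) sequentially"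
    using harm_at_top by (simp add: filterlim_at_top)
  then obtain n where n: "exp (2 * B + 1) \<le> (harm n :: real)" by (metis eventually_at_top_linorder order_refl)
  define Q0 where "Q0 = {q. prime q \<and> q \<le> n}"
  have fin: "finite Q0" unfolding Q0_def by (rule finite_subset [of _ "{..n}"]) auto
  have "(harm n :: real) = (\<Sum>k\<in>{1..n}. 1 / real k)" by (simp add: harm_def inverse_eq_divide)
  also have "\<dots> \<le> (\<Prod>r\<in>{}. 1 / (real r - 1)) * (\<Prod>r\<in>Q0. real r / (real r - 1))"
  proof (rule sum_inverse_le_Euler_product)
    fix k assume k: "k \<in> {1..n}"
    have "r \<in> Q0" if "r \<in> prime_factors k" for r
    proof -
      have "prime r" "r dvd k" using that by (simp_all add: in_prime_factors_iff)
      then show ?thesis using k dvd_imp_le [of r k] by (simp add: Q0_def)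
    qed
    then show "0 < k \<and> {} \<subseteq> prime_factors k \<and> prime_factors k \<subseteq> {} \<union> Q0"
      using k by auto
  qed (use fin in \<open>simp_all add: Q0_def\<close>)
  also have "\<dots> \<le> (\<Prod>r\<in>Q0. exp (1 / (real r - 1)))"
    unfolding prod.empty mult_1
  proof (intro prod_mono conjI)
    fix r assume "r \<in> Q0"
    then have r: "real r > 1" using prime_gt_1_nat by (auto simp: Q0_def)
    show "0 \<le> real r / (real r - 1)" using r by simp
    have "real r / (real r - 1) = 1 + 1 / (real r - 1)" using r by (simp add: field_simps)
    also have "\<dots> \<le> exp (1 / (real r - 1))" by (rule exp_ge_add_one_self)
    finally show "real r / (real r - 1) \<le> exp (1 / (real r - 1))" .
  qed
  also have "\<dots> = exp (\<Sum>r\<in>Q0. 1 / (real r - 1))" using fin by (simp add: exp_sum)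
  finally have "2 * B + 1 \<le> (\<Sum>r\<in>Q0. 1 / (real r - 1))"
    using n by (metis exp_le_cancel_iff order_trans)
  also have "\<dots> \<le> (\<Sum>r\<in>insert 2 (Q0 - {2}). 1 / (real r - 1))"
    using fin prime_gt_1_nat by (intro sum_mono2) (auto simp: Q0_def)
  also have "\<dots> = 1 + (\<Sum>r\<in>Q0 - {2}. 1 / (real r - 1))"
    using fin by (subst sum.insert) simp_all
  also have "(\<Sum>r\<in>Q0 - {2}. 1 / (real r - 1)) \<le> (\<Sum>r\<in>Q0 - {2}. 2 * (1 / real r))"
  proof (rule sum_mono)
    fix r assume "r \<in> Q0 - {2}"
    then have "real r \<ge> 2" using prime_ge_2_nat by (auto simp: Q0_def)
    then show "1 / (real r - 1) \<le> 2 * (1 / real r)" by (simp add: field_simps)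
  qed
  also have "\<dots> = 2 * (\<Sum>r\<in>Q0 - {2}. 1 / real r)" by (simp add: sum_distrib_left)
  finally have "B \<le> (\<Sum>r\<in>Q0 - {2}. 1 / real r)" by simp
  moreover have "\<forall>q\<in>Q0 - {2}. prime q \<and> q \<ge> 3"
  proof
    fix q assume q: "q \<in> Q0 - {2}"
    then have "q \<ge> 2" using prime_ge_2_nat by (simp add: Q0_def)
    then show "prime q \<and> q \<ge> 3" using q by (simp add: Q0_def)
  qed
  ultimately show ?thesis using fin by (intro exI [of _ "Q0 - {2}"]) auto
qed

subsection \<open>Chebyshev's lower bound\<close>

text \<open>
  By induction via \<open>1 / ((k + 1) C(n, k + 1)) = 1 / (k C(n - 1, k)) - 1 / (k C(n, k))\<close>.
\<close>

lemma mult_binomial_dvd_Lcm: "1 \<le> k \<Longrightarrow> k \<le> n \<Longrightarrow> k * (n choose k) dvd Lcm {1..n::nat}"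
proof (induction k arbitrary: n rule: nat_induct_at_least [of 1])
  case base
  then show ?case by (auto intro: dvd_Lcm)
next
  case (Suc k)
  obtain m where n: "n = Suc m" using Suc.prems by (cases n) auto
  define L where "L = Lcm {1..n}"
  have "k * (n choose k) dvd L" unfolding L_def using Suc by (intro Suc.IH) auto
  then obtain x where x: "L = k * (n choose k) * x" by (elim dvdE)
  have "k * (m choose k) dvd Lcm {1..m}" using Suc n by (intro Suc.IH) auto
  moreover have "Lcm {1..m} dvd L" unfolding L_def using n by (intro Lcm_subset) auto
  ultimately obtain y where y: "L = k * (m choose k) * y" by (meson dvd_trans dvdE)
  define c where "c = int (m choose k)"
  have 1: "int (Suc k) * int (n choose Suc k) = int n * c"
    unfolding c_def n of_nat_mult [symmetric] Suc_times_binomial ..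
  have 2: "(int n - int k) * int (n choose k) = int n * c"
  proof -
    have "int n - int k = int (n - k)" using Suc.prems by (simp add: of_nat_diff)
    moreover have "(n - k) * (n choose k) = n * (m choose k)"
      using binomial_absorb_comp [of n k] n by simp
    ultimately show ?thesis by (simp only: c_def of_nat_mult [symmetric])
  qed
  have x': "int L = int k * int (n choose k) * int x" unfolding x by simp
  have y': "int L = int k * c * int y" unfolding y c_def by simp
  have "int k * (int n * c * (int y - int x)) = int n * (int k * c * int y) - int k * (int n * c) * int x"
    by (simp add: algebra_simps)
  also have "\<dots> = int n * int L - (int n - int k) * int L"
    unfolding y' [symmetric] 2 [symmetric] by (subst (2) x') (simp add: algebra_simps)
  also have "\<dots> = int k * int L" by (simp add: algebra_simps)
  finally have "int L = int n * c * (int y - int x)" using Suc.hyps by simp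
  then have "int (Suc k * (n choose Suc k)) dvd int L" unfolding of_nat_mult 1 by simp
  then show ?case unfolding L_def by (simp only: int_dvd_int_iff)
qed

text \<open>The least common multiple divides a product of prime powers, each at most
  \<open>n\<close>, with one for each prime up to \<open>n\<close>.\<close>

lemma Lcm_le_power_card_primes:
  fixes n :: nat
  assumes "n \<ge> 1"
  shows "Lcm {1..n} \<le> n ^ card {p. prime p \<and> p \<le> n}"
proof -
  define P where "P = {p. prime p \<and> p \<le> n}"
  \<comment> \<open>Restricting the exponents to \<open>{..n}\<close> keeps the set finite even for
    \<open>p \<le> 1\<close>.\<close>
  define e where "e p = Max {e \<in> {..n}. p ^ e \<le> n}" for p
  have fin: "finite P" unfolding P_def by (rule finite_subset [of _ "{..n}"]) auto
  have pe: "p ^ e p \<le> n" for p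
  proof -
    have "0 \<in> {e \<in> {..n}. p ^ e \<le> n}" using assms by simp
    moreover have "finite {e \<in> {..n}. p ^ e \<le> n}" by (rule finite_subset [of _ "{..n}"]) blast+
    ultimately have "e p \<in> {e \<in> {..n}. p ^ e \<le> n}" unfolding e_def using Max_in by blast
    then show ?thesis by blast
  qed
  have le_e: "j \<le> e p" if "p ^ j \<le> n" "prime p" for p j
  proof -
    have "j < p ^ j" using that by (intro power_gt_expt) (auto dest: prime_gt_1_nat)
    then have "j \<in> {e \<in> {..n}. p ^ e \<le> n}" using that by simp
    moreover have "finite {e \<in> {..n}. p ^ e \<le> n}" by (rule finite_subset [of _ "{..n}"]) blast+
    ultimately show ?thesis unfolding e_def by (intro Max_ge)
  qed
  have "Lcm {1..n} dvd (\<Prod>p\<in>P. p ^ e p)"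
  proof (rule Lcm_least)
    fix m assume m: "m \<in> {1..n}"
    then have "m = (\<Prod>p\<in>prime_factors m. p ^ multiplicity p m)" by (simp add: prod_prime_factors)
    also have "\<dots> dvd (\<Prod>p\<in>prime_factors m. p ^ e p)"
    proof (intro prod_dvd_prod le_imp_power_dvd)
      fix p assume p: "p \<in> prime_factors m"
      have "p ^ multiplicity p m \<le> m" using m by (intro dvd_imp_le multiplicity_dvd) auto
      then show "multiplicity p m \<le> e p" using m p by (intro le_e) auto
    qed
    also have "\<dots> dvd (\<Prod>p\<in>P. p ^ e p)"
      using m fin by (intro prod_dvd_prod_subset) (auto simp: P_def in_prime_factors_iff dest!: dvd_imp_le)
    finally show "m dvd (\<Prod>p\<in>P. p ^ e p)" .
  qed
  moreover have "(\<Prod>p\<in>P. p ^ e p) > 0" by (auto simp: P_def prime_gt_0_nat intro!: prod_pos)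
  ultimately have "Lcm {1..n} \<le> (\<Prod>p\<in>P. p ^ e p)" by (intro dvd_imp_le) auto
  also have "\<dots> \<le> (\<Prod>p\<in>P. n)" using pe by (intro prod_mono) auto
  finally show ?thesis by (simp add: P_def)
qed

text \<open>The central binomial coefficient, at least 4^m / (2 m), divides
  \<open>Lcm {1..2 * m}\<close>, which is at most \<open>N\<close> to the number of primes. The
  bound serves only to compare N / ln N with pi(N). Its constant 1/2 lies below 2/3 \<le> ln 2,
  which leaves room for the lower-order terms.\<close>

lemma Chebyshev_lower_bound:
  "eventually (\<lambda>N. real N / (2 * ln (real N)) \<le> real (card {p. prime p \<and> p \<le> N})) sequentially"
proof -
  have "eventually (\<lambda>N::nat. real N / (2 * ln (real N)) \<le> (real N - 1) * (2 / 3) / ln (real N) - 1) sequentially"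
    by real_asymp
  then show ?thesis using eventually_ge_at_top [of "2 :: nat"]
  proof eventually_elim
    case (elim N)
    define m where "m = N div 2"
    have m: "m \<ge> 1" "2 * m \<le> N" "N \<le> 2 * m + 1" using elim by (auto simp: m_def)
    define \<pi> where "\<pi> = card {p. prime p \<and> p \<le> N}"
    have "card {p. prime p \<and> p \<le> 2 * m} \<le> \<pi>"
      unfolding \<pi>_def using m by (intro card_mono finite_subset [of "{p. prime p \<and> p \<le> N}" "{..N}"]) auto
    have "4 ^ m / (2 * real m) \<le> real ((2 * m) choose m)"
      using m by (intro central_binomial_lower_bound) auto
    also have "(2 * m) choose m \<le> Lcm {1..2 * m}"
    proof (rule dvd_imp_le)
      show "(2 * m) choose m dvd Lcm {1..2 * m}"
        by (rule dvd_mult_right, rule mult_binomial_dvd_Lcm) (use m in simp_all)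
      show "0 < Lcm {1..2 * m}" by (rule Nat.gr0I) (simp add: Lcm_0_iff)
    qed
    also have "Lcm {1..2 * m} \<le> (2 * m) ^ card {p. prime p \<and> p \<le> 2 * m}"
      using m by (intro Lcm_le_power_card_primes) auto
    also have "\<dots> \<le> (2 * m) ^ \<pi>"
      using m \<open>card {p. prime p \<and> p \<le> 2 * m} \<le> \<pi>\<close> by (intro power_increasing) auto
    finally have "4 ^ m / (2 * real m) \<le> (2 * real m) ^ \<pi>" by simp
    \<comment> \<open>The denominator \<open>2 * m\<close> is absorbed by one more power.\<close>
    then have "4 ^ m \<le> (2 * real m) ^ Suc \<pi>" using m by (simp add: field_simps)
    also have "\<dots> \<le> real N ^ Suc \<pi>" using m by (intro power_mono) linarith+
    finally have "ln (4 ^ m) \<le> ln (real N ^ Suc \<pi>)" using elim by (subst ln_le_cancel_iff) auto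
    moreover have "ln (4 ^ m :: real) = real m * ln 4" by (rule ln_realpow)
    moreover have "ln (real N ^ Suc \<pi>) = real (Suc \<pi>) * ln (real N)"
      by (rule ln_realpow)
    ultimately have "real m * ln 4 \<le> (real \<pi> + 1) * ln (real N)" by (simp add: add.commute)
    moreover have "ln (4::real) = 2 * ln 2" using ln_realpow [of 2 2] by simp
    ultimately have "(2 * real m) * ln 2 \<le> (real \<pi> + 1) * ln (real N)" by simp
    moreover have "(real N - 1) * (2 / 3) \<le> (2 * real m) * ln 2"
      using m ln2_ge_two_thirds by (intro mult_mono) auto
    ultimately have "(real N - 1) * (2 / 3) / ln (real N) \<le> real \<pi> + 1"
      using elim by (simp add: divide_le_eq)
    then show ?case using elim by (simp add: \<pi>_def)
  qed
qed

section \<open>Primes dividing a Fibonacci number of small index\<close>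

lemma fib_le_power2: "fib n \<le> 2 ^ n"
  by (induction n rule: fib.induct) auto

text \<open>The product of these primes divides the product of all F_d with
  \<open>d \<le> Y\<close>, which is at most 2^(Y^2). Requiring \<open>p\<close> to exceed sqrt N
  makes each prime contribute at least ln N / 2 to the logarithm; the primes up to sqrt N are
  counted separately.\<close>

lemma card_primes_of_small_rank:
  fixes N Y :: nat
  assumes N: "N \<ge> 2"
  defines "P \<equiv> {p. prime p \<and> sqrt (real N) < real p \<and> (\<exists>d. 0 < d \<and> d \<le> Y \<and> p dvd fib d)}"
  shows "finite P" "real (card P) * ln (real N) \<le> 2 * (real Y)\<^sup>2"
proof -
  define F where "F = (\<Prod>d=1..Y. fib d)"
  have F0: "F > 0" unfolding F_def by (intro prod_pos) (auto simp: fib_neq_0_nat)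
  have dvd: "p dvd F" if p: "p \<in> P" for p
  proof -
    obtain d where "0 < d" "d \<le> Y" "p dvd fib d" using p unfolding P_def by blast
    then have d: "d \<in> {1..Y}" "p dvd fib d" by simp_all
    have "fib d dvd F" unfolding F_def using d by (intro dvd_prodI) auto
    then show ?thesis using d dvd_trans by blast
  qed
  show fin: "finite P"
    by (rule finite_subset [of _ "{..F}"]) (use dvd F0 in \<open>auto dest: dvd_imp_le\<close>)
  have "\<Prod>P dvd F" by (rule prod_primes_dvd) (use fin dvd in \<open>auto simp: P_def\<close>)
  then have "\<Prod>P \<le> F" using F0 by (rule dvd_imp_le)
  also have "F \<le> (\<Prod>d=1..Y. 2 ^ Y)" unfolding F_def
  proof (intro prod_mono conjI)
    fix d assume "d \<in> {1..Y}"
    then have "(2::nat) ^ d \<le> 2 ^ Y" by (intro power_increasing) auto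
    then show "fib d \<le> 2 ^ Y" using fib_le_power2 [of d] by linarith
  qed simp
  also have "\<dots> = 2 ^ (Y\<^sup>2)" by (simp add: power2_eq_square power_mult)
  finally have le: "\<Prod>P \<le> 2 ^ (Y\<^sup>2)" .
  have "sqrt (real N) ^ card P = (\<Prod>p\<in>P. sqrt (real N))" by simp
  also have "\<dots> \<le> (\<Prod>p\<in>P. real p)" by (intro prod_mono) (auto simp: P_def)
  also have "\<dots> = real (\<Prod>P)" by (rule of_nat_prod [symmetric])
  also have "\<dots> \<le> real (2 ^ (Y\<^sup>2))" using le by (rule of_nat_mono)
  also have "\<dots> = 2 ^ (Y\<^sup>2)" by simp
  finally have "ln (sqrt (real N) ^ card P) \<le> ln (2 ^ (Y\<^sup>2))"
    using N by (subst ln_le_cancel_iff) auto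
  then have "real (card P) * (ln (real N) / 2) \<le> real (Y\<^sup>2) * ln 2"
    using N by (simp add: ln_realpow ln_sqrt)
  also have "\<dots> \<le> real (Y\<^sup>2) * 1" using ln_2_less_1 by (intro mult_left_mono) auto
  finally show "real (card P) * ln (real N) \<le> 2 * (real Y)\<^sup>2" by simp
qed

subsection \<open>Selberg's sieve and the Brun--Titchmarsh inequality\<close>

text \<open>
  Squarefree sieving moduli coprime to \<open>q\<close> are represented by their sets of prime factors, so that
  least common multiples, greatest common divisors and divisors become unions, intersections and subsets.
\<close>

definition sieve_sets :: "nat \<Rightarrow> nat \<Rightarrow> nat set set" where
  "sieve_sets q R = {S. finite S \<and> (\<forall>r\<in>S. prime r \<and> \<not> r dvd q) \<and> \<Prod>S \<le> R}"

definition phi_set :: "nat set \<Rightarrow> real" where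
  "phi_set S = (\<Prod>r\<in>S. real r - 1)"

text \<open>The sum of mu(n)^2 / phi(n) over n \<le> R coprime to \<open>q\<close>, the denominator
  in Selberg's upper bound.\<close>

definition sieve_mass :: "nat \<Rightarrow> nat \<Rightarrow> real" where
  "sieve_mass q R = (\<Sum>S\<in>sieve_sets q R. 1 / phi_set S)"

text \<open>
  These are Selberg's optimal weights. Only the crude bound \<open>\<bar>sieve_weight q R S\<bar> \<le> R\<close> is needed,
  since the level \<open>R\<close> is taken to be a small power of the number of terms sieved.
\<close>

definition sieve_weight :: "nat \<Rightarrow> nat \<Rightarrow> nat set \<Rightarrow> real" where
  "sieve_weight q R S = (-1) ^ card S * real (\<Prod>S) *
     (\<Sum>T\<in>sieve_sets q R. if S \<subseteq> T then 1 / phi_set T else 0) / sieve_mass q R"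

lemma sieve_setsD:
  assumes "S \<in> sieve_sets q R"
  shows "finite S" "\<And>r. r \<in> S \<Longrightarrow> prime r" "\<And>r. r \<in> S \<Longrightarrow> \<not> r dvd q" "\<Prod>S \<le> R" "\<Prod>S > 0"
  using assms prime_gt_0_nat by (auto simp: sieve_sets_def intro!: prod_pos)

lemma sieve_sets_subset:
  assumes "S \<in> sieve_sets q R" "T \<subseteq> S"
  shows "T \<in> sieve_sets q R"
proof -
  have "\<Prod>T dvd \<Prod>S" using assms by (intro prod_dvd_prod_subset) (auto dest: sieve_setsD)
  then have "\<Prod>T \<le> \<Prod>S" using sieve_setsD(5) [OF assms(1)] by (rule dvd_imp_le)
  then show ?thesis using assms finite_subset [OF assms(2)] by (auto simp: sieve_sets_def)
qed

lemma prime_dvd_prod_primes_iff: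
  fixes r :: nat
  assumes "finite S" "\<And>s. s \<in> S \<Longrightarrow> prime s" "prime r"
  shows "r dvd \<Prod>S \<longleftrightarrow> r \<in> S"
proof
  assume "r dvd \<Prod>S"
  then obtain s where "s \<in> S" "r dvd s" using assms prime_dvd_prod_iff [of S r "\<lambda>x. x"] by auto
  then show "r \<in> S" using assms primes_dvd_imp_eq by blast
next
  assume "r \<in> S"
  then show "r dvd \<Prod>S" using assms by (intro dvd_prodI)
qed

lemma sieve_sets_finite: "finite (sieve_sets q R)"
proof (rule finite_subset)
  show "sieve_sets q R \<subseteq> Pow {..R}"
  proof (intro subsetI PowI)
    fix S r assume S: "S \<in> sieve_sets q R" and r: "r \<in> S"
    have "r dvd \<Prod>S" using sieve_setsD(1) [OF S] r by (rule dvd_prodI)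
    then have "r \<le> \<Prod>S" using sieve_setsD(5) [OF S] by (rule dvd_imp_le)
    then show "r \<in> {..R}" using sieve_setsD(4) [OF S] by simp
  qed
qed simp

lemma sieve_sets_card: "card (sieve_sets q R) \<le> R"
proof -
  have "inj_on (\<lambda>S. \<Prod>S) (sieve_sets q R)"
  proof (rule inj_onI)
    fix S T assume ST: "S \<in> sieve_sets q R" "T \<in> sieve_sets q R" "\<Prod>S = \<Prod>T"
    have "r \<in> S \<longleftrightarrow> r \<in> T" if "prime r" for r
      using prime_dvd_prod_primes_iff [OF sieve_setsD(1,2) [OF ST(1)] that]
        prime_dvd_prod_primes_iff [OF sieve_setsD(1,2) [OF ST(2)] that] ST(3) by metis
    then show "S = T" using sieve_setsD(2) [OF ST(1)] sieve_setsD(2) [OF ST(2)] by blast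
  qed
  moreover have "(\<lambda>S. \<Prod>S) ` sieve_sets q R \<subseteq> {1..R}"
  proof clarify
    fix S assume S: "S \<in> sieve_sets q R"
    show "\<Prod>S \<in> {1..R}" using sieve_setsD(4,5) [OF S] by simp
  qed
  ultimately have "card (sieve_sets q R) \<le> card {1..R}" by (intro card_inj_on_le) auto
  then show ?thesis by simp
qed

lemma phi_set_pos: "(\<And>r. r \<in> S \<Longrightarrow> prime r) \<Longrightarrow> phi_set S > 0"
  unfolding phi_set_def using prime_gt_1_nat by (intro prod_pos) fastforce

lemma phi_set_pos_sieve: "S \<in> sieve_sets q R \<Longrightarrow> phi_set S > 0"
  using phi_set_pos sieve_setsD(2) by metis

text \<open>Expansion of the product of (r - 1) + 1: the squarefree case of Gauss's identity for the
  sum of phi over divisors.\<close>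

lemma sum_phi_set_subsets: "finite S \<Longrightarrow> (\<Sum>U\<in>Pow S. phi_set U) = real (\<Prod>S)"
  using prod_add [of S "\<lambda>r. real r - 1" "\<lambda>_. 1"] by (simp add: phi_set_def)

lemma empty_in_sieve_sets: "R \<ge> 1 \<Longrightarrow> {} \<in> sieve_sets q R"
  by (simp add: sieve_sets_def)

lemma sieve_mass_pos: "R \<ge> 1 \<Longrightarrow> sieve_mass q R > 0"
  unfolding sieve_mass_def
  using empty_in_sieve_sets [of R q]
  by (intro sum_pos sieve_sets_finite divide_pos_pos zero_less_one phi_set_pos_sieve) auto

text \<open>Moebius inversion on the Boolean interval from \<open>U\<close> to \<open>T\<close>:
  even and odd sizes balance unless the interval is a single point.\<close>

lemma sum_alternating_between:
  assumes "finite T"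
  shows "(\<Sum>X | U \<subseteq> X \<and> X \<subseteq> T. (-1) ^ card X) = (if U = T then (-1) ^ card T else 0 :: real)"
proof (cases "U \<subset> T")
  case True
  have fin: "finite {X. U \<subseteq> X \<and> X \<subseteq> T}" by (rule finite_subset [of _ "Pow T"]) (use assms in auto)
  have "(\<Sum>X | U \<subseteq> X \<and> X \<subseteq> T. (-1) ^ card X) = (0 :: real)"
  proof (rule sum_alternating_cancels [OF fin])
    have "card {X. X \<subseteq> T \<and> U \<subseteq> X \<and> even (card X)} = card {X. X \<subseteq> T \<and> U \<subseteq> X \<and> odd (card X)}"
      by (rule card_subsupersets_even_odd [OF assms True])
    moreover have "{X. X \<subseteq> T \<and> U \<subseteq> X \<and> even (card X)} = {X \<in> {X. U \<subseteq> X \<and> X \<subseteq> T}. even (card X)}"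
      "{X. X \<subseteq> T \<and> U \<subseteq> X \<and> odd (card X)} = {X \<in> {X. U \<subseteq> X \<and> X \<subseteq> T}. odd (card X)}" by blast+
    ultimately show "card {X \<in> {X. U \<subseteq> X \<and> X \<subseteq> T}. even (card X)} = card {X \<in> {X. U \<subseteq> X \<and> X \<subseteq> T}. odd (card X)}"
      by simp
  qed
  then show ?thesis using True by auto
next
  case False
  show ?thesis
  proof (cases "U = T")
    case True
    then have "{X. U \<subseteq> X \<and> X \<subseteq> T} = {T}" by blast
    then show ?thesis using True by simp
  next
    case ne: False
    then have empty: "{X. U \<subseteq> X \<and> X \<subseteq> T} = {}" using False by blast
    show ?thesis unfolding empty using ne by simp
  qed
qed

text \<open>After the sums are interchanged, Moebius inversion leaves only \<open>T = U\<close>. The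
  left side is the variable in which the quadratic form of the sieve becomes diagonal.\<close>

lemma sum_sieve_weight_supersets:
  assumes U: "U \<in> sieve_sets q R"
  shows "(\<Sum>S\<in>sieve_sets q R. if U \<subseteq> S then sieve_weight q R S / real (\<Prod>S) else 0)
    = (-1) ^ card U / (phi_set U * sieve_mass q R)"
proof -
  let ?D = "sieve_sets q R" and ?G = "sieve_mass q R"
  note fin = sieve_sets_finite [of q R]
  have "(\<Sum>S\<in>?D. if U \<subseteq> S then sieve_weight q R S / real (\<Prod>S) else 0)
      = (\<Sum>S\<in>?D. \<Sum>T\<in>?D. if U \<subseteq> S \<and> S \<subseteq> T then (-1) ^ card S * (1 / phi_set T) / ?G else 0)"
  proof (rule sum.cong [OF refl])
    fix S assume S: "S \<in> ?D"
    have nz: "real (\<Prod>S) \<noteq> 0" using sieve_setsD(5) [OF S] unfolding of_nat_eq_0_iff by simp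
    have "sieve_weight q R S / real (\<Prod>S) = (-1) ^ card S * (\<Sum>T\<in>?D. if S \<subseteq> T then 1 / phi_set T else 0) / ?G"
      using nz unfolding sieve_weight_def by simp
    also have "\<dots> = (\<Sum>T\<in>?D. if S \<subseteq> T then (-1) ^ card S * (1 / phi_set T) / ?G else 0)"
      unfolding sum_distrib_left sum_divide_distrib by (intro sum.cong refl) simp
    finally show "(if U \<subseteq> S then sieve_weight q R S / real (\<Prod>S) else 0)
      = (\<Sum>T\<in>?D. if U \<subseteq> S \<and> S \<subseteq> T then (-1) ^ card S * (1 / phi_set T) / ?G else 0)"
      by simp
  qed
  also have "\<dots> = (\<Sum>T\<in>?D. \<Sum>S\<in>?D. if U \<subseteq> S \<and> S \<subseteq> T then (-1) ^ card S * (1 / phi_set T) / ?G else 0)"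
    by (rule sum.swap)
  also have "\<dots> = (\<Sum>T\<in>?D. if T = U then (-1) ^ card U / (phi_set U * ?G) else 0)"
  proof (rule sum.cong [OF refl])
    fix T assume T: "T \<in> ?D"
    have "(\<Sum>S\<in>?D. if U \<subseteq> S \<and> S \<subseteq> T then (-1) ^ card S * (1 / phi_set T) / ?G else 0)
        = (\<Sum>S\<in>?D \<inter> {S. U \<subseteq> S \<and> S \<subseteq> T}. (-1) ^ card S * (1 / phi_set T) / ?G)"
      by (simp only: sum.inter_restrict [OF fin] mem_Collect_eq)
    also have "?D \<inter> {S. U \<subseteq> S \<and> S \<subseteq> T} = {S. U \<subseteq> S \<and> S \<subseteq> T}"
      using sieve_sets_subset [OF T] by blast
    also have "(\<Sum>S | U \<subseteq> S \<and> S \<subseteq> T. (-1) ^ card S * (1 / phi_set T) / ?G)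
        = (\<Sum>S | U \<subseteq> S \<and> S \<subseteq> T. (-1) ^ card S) * (1 / phi_set T / ?G)"
      unfolding sum_distrib_right by (intro sum.cong refl) simp
    also have "\<dots> = (if T = U then (-1) ^ card U / (phi_set U * ?G) else 0)"
      unfolding sum_alternating_between [OF sieve_setsD(1) [OF T]] by auto
    finally show "(\<Sum>S\<in>?D. if U \<subseteq> S \<and> S \<subseteq> T then (-1) ^ card S * (1 / phi_set T) / ?G else 0)
        = (if T = U then (-1) ^ card U / (phi_set U * ?G) else 0)" .
  qed
  also have "\<dots> = (-1) ^ card U / (phi_set U * ?G)"
    using fin U by simp
  finally show ?thesis .
qed

text \<open>Since 1 / lcm is gcd over the product, and the gcd is the sum of phi over its divisors,
  the form is a sum of \<open>phi_set U\<close> times squares. The squared variables are 1 / (phi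
  G)^2, where \<open>G\<close> is the sieve mass, and the total is G / G^2.\<close>

lemma sieve_quadratic_form:
  assumes R: "R \<ge> 1"
  shows "(\<Sum>S\<in>sieve_sets q R. \<Sum>T\<in>sieve_sets q R.
      sieve_weight q R S * sieve_weight q R T / real (\<Prod>(S \<union> T))) = 1 / sieve_mass q R"
proof -
  let ?D = "sieve_sets q R" and ?G = "sieve_mass q R" and ?w = "sieve_weight q R"
  note fin = sieve_sets_finite [of q R]
  define y where "y U S = (if U \<subseteq> S then ?w S / real (\<Prod>S) else 0)" for U S
  have arith: "a * b / u = i * (a / s * (b / t))" if "u * i = s * t" "s > 0" "t > 0" "u > 0" for a b u i s t :: real
  proof -
    have "i = s * t / u" using that by (simp add: field_simps)
    then show ?thesis using that by simp
  qed
  have expand: "?w S * ?w T / real (\<Prod>(S \<union> T)) = (\<Sum>U\<in>?D. phi_set U * (y U S * y U T))"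
    if S: "S \<in> ?D" and T: "T \<in> ?D" for S T
  proof -
    have "S \<inter> T \<in> ?D" using sieve_sets_subset [OF S] by blast
    then have sub: "Pow (S \<inter> T) \<subseteq> ?D" using sieve_sets_subset by blast
    have fS: "finite S" "finite T" using sieve_setsD(1) S T by auto
    have un: "\<Prod>(S \<union> T) > 0"
      using fS sieve_setsD(2) [OF S] sieve_setsD(2) [OF T] prime_gt_0_nat by (intro prod_pos) auto
    have "\<Prod>(S \<union> T) * \<Prod>(S \<inter> T) = \<Prod>S * \<Prod>T"
      using fS by (rule prod.union_inter)
    then have "real (\<Prod>(S \<union> T)) * real (\<Prod>(S \<inter> T)) = real (\<Prod>S) * real (\<Prod>T)"
      unfolding of_nat_mult [symmetric] by (rule arg_cong)
    moreover have "real (\<Prod>S) > 0" "real (\<Prod>T) > 0" "real (\<Prod>(S \<union> T)) > 0"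
      using sieve_setsD(5) [OF S] sieve_setsD(5) [OF T] un unfolding of_nat_0_less_iff by blast+
    ultimately have "?w S * ?w T / real (\<Prod>(S \<union> T)) = real (\<Prod>(S \<inter> T)) * (?w S / real (\<Prod>S) * (?w T / real (\<Prod>T)))"
      by (rule arith)
    also have "real (\<Prod>(S \<inter> T)) = (\<Sum>U\<in>Pow (S \<inter> T). phi_set U)"
      using fS by (intro sum_phi_set_subsets [symmetric]) simp
    also have "\<dots> * (?w S / real (\<Prod>S) * (?w T / real (\<Prod>T))) = (\<Sum>U\<in>Pow (S \<inter> T). phi_set U * (y U S * y U T))"
      unfolding sum_distrib_right by (intro sum.cong refl) (auto simp: y_def)
    also have "\<dots> = (\<Sum>U\<in>?D. phi_set U * (y U S * y U T))"
      by (intro sum.mono_neutral_left sub fin) (auto simp: y_def)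
    finally show ?thesis .
  qed
  have "(\<Sum>S\<in>?D. \<Sum>T\<in>?D. ?w S * ?w T / real (\<Prod>(S \<union> T)))
      = (\<Sum>S\<in>?D. \<Sum>T\<in>?D. \<Sum>U\<in>?D. phi_set U * (y U S * y U T))"
    by (intro sum.cong refl expand)
  also have "\<dots> = (\<Sum>S\<in>?D. \<Sum>U\<in>?D. \<Sum>T\<in>?D. phi_set U * (y U S * y U T))"
    by (intro sum.cong refl sum.swap)
  also have "\<dots> = (\<Sum>U\<in>?D. \<Sum>S\<in>?D. \<Sum>T\<in>?D. phi_set U * (y U S * y U T))"
    by (rule sum.swap)
  also have "\<dots> = (\<Sum>U\<in>?D. phi_set U * ((\<Sum>S\<in>?D. y U S) * (\<Sum>T\<in>?D. y U T)))"
    unfolding sum_product by (simp only: sum_distrib_left)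
  also have "\<dots> = (\<Sum>U\<in>?D. 1 / phi_set U / ?G\<^sup>2)"
  proof (rule sum.cong [OF refl])
    fix U assume U: "U \<in> ?D"
    have yU: "(\<Sum>S\<in>?D. y U S) = (-1) ^ card U / (phi_set U * ?G)"
      unfolding y_def by (rule sum_sieve_weight_supersets [OF U])
    have pos: "phi_set U > 0" "?G > 0" using U R by (simp_all add: phi_set_pos_sieve sieve_mass_pos)
    define \<sigma> where "\<sigma> = (-1 :: real) ^ card U"
    have "\<sigma> * \<sigma> = 1" by (simp add: \<sigma>_def flip: power_mult_distrib)
    moreover have "phi_set U * (\<sigma> / (phi_set U * ?G) * (\<sigma> / (phi_set U * ?G))) = (\<sigma> * \<sigma>) * (1 / phi_set U / ?G\<^sup>2)"
      using pos by (simp add: field_simps power2_eq_square)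
    ultimately show "phi_set U * ((\<Sum>S\<in>?D. y U S) * (\<Sum>T\<in>?D. y U T)) = 1 / phi_set U / ?G\<^sup>2"
      unfolding yU \<sigma>_def [symmetric] by simp
  qed
  also have "\<dots> = ?G / ?G\<^sup>2" unfolding sum_divide_distrib [symmetric] sieve_mass_def ..
  also have "\<dots> = 1 / ?G" using sieve_mass_pos [OF R] by (simp add: power2_eq_square)
  finally show ?thesis .
qed

lemma sieve_weight_empty: "R \<ge> 1 \<Longrightarrow> sieve_weight q R {} = 1"
  using sieve_mass_pos [of R q] by (simp add: sieve_weight_def) (simp add: sieve_mass_def)

lemma sieve_weight_abs_le:
  assumes R: "R \<ge> 1" and S: "S \<in> sieve_sets q R"
  shows "\<bar>sieve_weight q R S\<bar> \<le> real R"
proof -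
  define M where "M = (\<Sum>T\<in>sieve_sets q R. if S \<subseteq> T then 1 / phi_set T else 0)"
  have "0 \<le> M" unfolding M_def by (intro sum_nonneg) (auto simp: phi_set_pos_sieve less_imp_le)
  moreover have "M \<le> sieve_mass q R" unfolding M_def sieve_mass_def
    by (intro sum_mono) (auto simp: phi_set_pos_sieve less_imp_le)
  ultimately have frac: "0 \<le> M / sieve_mass q R" "M / sieve_mass q R \<le> 1"
    using sieve_mass_pos [OF R, of q] by simp_all
  have w: "sieve_weight q R S = (-1) ^ card S * (real (\<Prod>S) * (M / sieve_mass q R))"
    by (simp add: sieve_weight_def M_def)
  have "\<bar>sieve_weight q R S\<bar> = \<bar>real (\<Prod>S) * (M / sieve_mass q R)\<bar>"
    unfolding w by (simp only: abs_mult power_abs abs_minus_cancel abs_one power_one mult_1_left)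
  also have "\<dots> = real (\<Prod>S) * (M / sieve_mass q R)"
    by (intro abs_of_nonneg mult_nonneg_nonneg of_nat_0_le_iff frac(1))
  also have "\<dots> \<le> real (\<Prod>S) * 1" by (intro mult_left_mono frac(2) of_nat_0_le_iff)
  also have "\<dots> \<le> real R" using sieve_setsD(4) [OF S] by (simp only: mult_1_right of_nat_le_iff)
  finally show ?thesis .
qed

section \<open>Counting divisible terms of an arithmetic progression\<close>

lemma card_residue_class:
  fixes e c K :: nat
  assumes "c < e"
  shows "\<bar>real (card {k. k < K \<and> k mod e = c}) - real K / real e\<bar> \<le> 1"
proof -
  define m where "m = K div e"
  define A where "A K = {k. k < K \<and> k mod e = c}" for K
  have finA: "finite (A K)" for K by (rule finite_subset [of _ "{..<K}"]) (auto simp: A_def)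
  have cardA: "card (A (e * j)) = j" for j
  proof -
    have "bij_betw (\<lambda>i. e * i + c) {..<j} (A (e * j))"
    proof (rule bij_betw_byWitness [where f' = "\<lambda>k. k div e"])
      show "(\<lambda>i. e * i + c) ` {..<j} \<subseteq> A (e * j)"
      proof clarify
        fix i assume "i < j"
        then have "e * Suc i \<le> e * j" by (intro mult_le_mono2) simp
        then show "e * i + c \<in> A (e * j)" using assms by (simp add: A_def)
      qed
      show "(\<lambda>k. k div e) ` A (e * j) \<subseteq> {..<j}"
        using assms by (auto simp: A_def less_mult_imp_div_less mult.commute)
      show "\<forall>i\<in>{..<j}. (e * i + c) div e = i" using assms by auto
      show "\<forall>k\<in>A (e * j). e * (k div e) + c = k" by (auto simp: A_def)
    qed
    then show ?thesis by (metis bij_betw_same_card card_lessThan)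
  qed
  have K: "e * m \<le> K" "K < e * Suc m"
    using assms by (auto simp: m_def dividend_less_times_div)
  have "card (A (e * m)) \<le> card (A K)" "card (A K) \<le> card (A (e * Suc m))"
    using K by (auto intro!: card_mono finA simp: A_def)
  then have "m \<le> card (A K)" "card (A K) \<le> Suc m" unfolding cardA by auto
  moreover have "real m \<le> real K / real e" "real K / real e \<le> real m + 1"
  proof -
    have "real (e * m) \<le> real K" "real K \<le> real (e * Suc m)"
      using K by (intro of_nat_mono; simp)+
    then have "real e * real m \<le> real K" "real K \<le> real e * (real m + 1)"
      by (simp_all add: algebra_simps)
    then show "real m \<le> real K / real e" "real K / real e \<le> real m + 1"
      using assms by (simp_all add: field_simps)
  qed
  ultimately have "\<bar>real (card (A K)) - real K / real e\<bar> \<le> 1" by linarith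
  then show ?thesis by (simp add: A_def)
qed

text \<open>As \<open>q\<close> is invertible modulo \<open>e\<close>, the divisibility confines
  \<open>k\<close> to a single residue class.\<close>

lemma card_progression_divisible:
  fixes a q e K :: nat
  assumes "coprime e q" "e > 0"
  shows "\<bar>real (card {k. k < K \<and> e dvd a + q * k}) - real K / real e\<bar> \<le> 1"
proof -
  have "coprime q e" using assms by (simp add: coprime_commute)
  from cong_solve_coprime_nat [OF this] obtain x where "[q * x = Suc 0] (mod e)" ..
  then have "[int (q * x) = int (Suc 0)] (mod int e)" by (simp only: cong_int_iff)
  then have x: "[int q * int x = 1] (mod int e)" by simp
  define c where "c = nat ((- int a * int x) mod int e)"
  have ic: "int c = (- int a * int x) mod int e" using assms by (simp add: c_def)
  have "int c < int e" unfolding ic using assms by simp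
  then have ce: "c < e" by simp
  have iff: "e dvd a + q * k \<longleftrightarrow> k mod e = c" for k
  proof -
    have "e dvd a + q * k \<longleftrightarrow> int e dvd int a + int q * int k"
      by (simp only: int_dvd_int_iff of_nat_add [symmetric] of_nat_mult [symmetric])
    also have "\<dots> \<longleftrightarrow> int e dvd int k - (- int a * int x)"
    proof
      assume "int e dvd int a + int q * int k"
      then have 1: "int e dvd int x * (int a + int q * int k)" by (rule dvd_mult)
      have "int e dvd int q * int x - 1" using x by (simp add: cong_iff_dvd_diff)
      then have 2: "int e dvd int k * (int q * int x - 1)" by (rule dvd_mult)
      show "int e dvd int k - (- int a * int x)"
        using dvd_diff [OF 1 2] by (simp add: algebra_simps)
    next
      assume "int e dvd int k - (- int a * int x)"
      then have 1: "int e dvd int q * (int k - (- int a * int x))" by (rule dvd_mult)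
      have "int e dvd int q * int x - 1" using x by (simp add: cong_iff_dvd_diff)
      then have 2: "int e dvd int a * (int q * int x - 1)" by (rule dvd_mult)
      show "int e dvd int a + int q * int k"
        using dvd_diff [OF 1 2] by (simp add: algebra_simps)
    qed
    also have "\<dots> \<longleftrightarrow> int k mod int e = int c" unfolding ic by (simp add: mod_eq_dvd_iff)
    also have "\<dots> \<longleftrightarrow> k mod e = c" by (simp flip: of_nat_mod)
    finally show ?thesis .
  qed
  show ?thesis unfolding iff by (rule card_residue_class [OF ce])
qed

text \<open>The square of the weighted sum of divisibility indicators majorises the indicator of the
  sifted set: there only \<open>S = {}\<close> contributes, with weight 1. Expanding the square
  gives \<open>K\<close> times the quadratic form, and each of at most R^2 pairs of sets adds an
  error of at most R^2.\<close>

lemma Selberg_sieve: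
  fixes a q K R :: nat
  assumes R: "R \<ge> 1"
  shows "real (card {k. k < K \<and> (\<forall>r. prime r \<longrightarrow> r \<le> R \<longrightarrow> \<not> r dvd q \<longrightarrow> \<not> r dvd a + q * k)})
    \<le> real K / sieve_mass q R + real R ^ 4"
proof -
  let ?D = "sieve_sets q R" and ?G = "sieve_mass q R" and ?w = "sieve_weight q R"
  note fin = sieve_sets_finite [of q R]
  define B where "B = {k. k < K \<and> (\<forall>r. prime r \<longrightarrow> r \<le> R \<longrightarrow> \<not> r dvd q \<longrightarrow> \<not> r dvd a + q * k)}"
  define I where "I S k = (if \<Prod>S dvd a + q * k then 1 else 0 :: real)" for S k
  have inter: "I S k * I T k = I (S \<union> T) k" if S: "S \<in> ?D" and T: "T \<in> ?D" for S T k
  proof -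
    have fS: "finite S" "finite T" using sieve_setsD(1) S T by auto
    have "\<Prod>(S \<union> T) dvd n" if "\<Prod>S dvd n" "\<Prod>T dvd n" for n
    proof (rule prod_primes_dvd)
      fix r assume "r \<in> S \<union> T"
      then show "prime r" using sieve_setsD(2) S T by blast
      from \<open>r \<in> S \<union> T\<close> show "r dvd n"
        using dvd_prodI [of S r "\<lambda>x. x"] dvd_prodI [of T r "\<lambda>x. x"] fS that dvd_trans by blast
    qed (use fS in simp)
    moreover have "\<Prod>S dvd \<Prod>(S \<union> T)" "\<Prod>T dvd \<Prod>(S \<union> T)"
      using fS by (auto intro!: prod_dvd_prod_subset)
    ultimately have "\<Prod>(S \<union> T) dvd a + q * k \<longleftrightarrow> \<Prod>S dvd a + q * k \<and> \<Prod>T dvd a + q * k"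
      by (meson dvd_trans)
    then show ?thesis unfolding I_def by simp
  qed
  have cnt: "\<bar>(\<Sum>k<K. I (S \<union> T) k) - real K / real (\<Prod>(S \<union> T))\<bar> \<le> 1"
    if S: "S \<in> ?D" and T: "T \<in> ?D" for S T
  proof -
    have fS: "finite S" "finite T" using sieve_setsD(1) S T by auto
    have "coprime (\<Prod>(S \<union> T)) q"
    proof (rule prod_coprime_left)
      fix r assume "r \<in> S \<union> T"
      then have "prime r" "\<not> r dvd q" using sieve_setsD(2,3) S T by blast+
      then show "coprime r q" by (rule prime_imp_coprime)
    qed
    moreover have "\<Prod>(S \<union> T) > 0"
      using fS sieve_setsD(2) [OF S] sieve_setsD(2) [OF T] prime_gt_0_nat by (intro prod_pos) auto
    ultimately have "\<bar>real (card {k. k < K \<and> \<Prod>(S \<union> T) dvd a + q * k}) - real K / real (\<Prod>(S \<union> T))\<bar> \<le> 1"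
      by (rule card_progression_divisible)
    moreover have "(\<Sum>k<K. I (S \<union> T) k) = real (card {k. k < K \<and> \<Prod>(S \<union> T) dvd a + q * k})"
    proof -
      have "(\<Sum>k<K. I (S \<union> T) k) = (\<Sum>k\<in>{..<K} \<inter> {k. \<Prod>(S \<union> T) dvd a + q * k}. 1)"
        unfolding I_def by (simp only: sum.inter_restrict [OF finite_lessThan] mem_Collect_eq)
      also have "{..<K} \<inter> {k. \<Prod>(S \<union> T) dvd a + q * k} = {k. k < K \<and> \<Prod>(S \<union> T) dvd a + q * k}"
        by blast
      finally show ?thesis by simp
    qed
    ultimately show ?thesis by simp
  qed
  have finB: "finite B" by (rule finite_subset [of _ "{..<K}"]) (auto simp: B_def)
  have "real (card B) = (\<Sum>k\<in>B. (1::real))" by simp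
  also have "\<dots> = (\<Sum>k\<in>B. (\<Sum>S\<in>?D. I S k * ?w S)\<^sup>2)"
  proof (rule sum.cong [OF refl])
    fix k assume k: "k \<in> B"
    have "(\<Sum>S\<in>?D. I S k * ?w S) = (\<Sum>S\<in>{{}}. I S k * ?w S)"
    proof (rule sum.mono_neutral_right [OF fin])
      show "\<forall>S\<in>?D - {{}}. I S k * ?w S = 0"
      proof
        fix S assume S: "S \<in> ?D - {{}}"
        then obtain r where r: "r \<in> S" by blast
        have SD: "S \<in> ?D" using S by blast
        have rdvd: "r dvd \<Prod>S" using sieve_setsD(1) [OF SD] r by (rule dvd_prodI)
        then have "r \<le> \<Prod>S" using sieve_setsD(5) [OF SD] by (rule dvd_imp_le)
        then have "r \<le> R" using sieve_setsD(4) [OF SD] by linarith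
        then have "\<not> r dvd a + q * k" using k sieve_setsD(2,3) [OF SD r] unfolding B_def by blast
        then have "\<not> \<Prod>S dvd a + q * k" using rdvd dvd_trans by blast
        then show "I S k * ?w S = 0" by (simp add: I_def)
      qed
    qed (use empty_in_sieve_sets R in auto)
    then show "1 = (\<Sum>S\<in>?D. I S k * ?w S)\<^sup>2" using sieve_weight_empty [OF R] by (simp add: I_def)
  qed
  also have "\<dots> \<le> (\<Sum>k<K. (\<Sum>S\<in>?D. I S k * ?w S)\<^sup>2)"
    by (intro sum_mono2) (auto simp: B_def)
  also have "\<dots> = (\<Sum>k<K. \<Sum>S\<in>?D. \<Sum>T\<in>?D. (?w S * ?w T) * I (S \<union> T) k)"
    unfolding power2_eq_square sum_product by (intro sum.cong refl) (simp flip: inter)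
  also have "\<dots> = (\<Sum>S\<in>?D. \<Sum>k<K. \<Sum>T\<in>?D. (?w S * ?w T) * I (S \<union> T) k)"
    by (rule sum.swap)
  also have "\<dots> = (\<Sum>S\<in>?D. \<Sum>T\<in>?D. \<Sum>k<K. (?w S * ?w T) * I (S \<union> T) k)"
    by (intro sum.cong refl sum.swap)
  also have "\<dots> = (\<Sum>S\<in>?D. \<Sum>T\<in>?D. (?w S * ?w T) * (\<Sum>k<K. I (S \<union> T) k))"
    by (simp only: sum_distrib_left)
  also have "\<dots> \<le> (\<Sum>S\<in>?D. \<Sum>T\<in>?D. real K * (?w S * ?w T / real (\<Prod>(S \<union> T))) + (real R)\<^sup>2)"
  proof (intro sum_mono)
    fix S T assume S: "S \<in> ?D" and T: "T \<in> ?D"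
    define d where "d = (\<Sum>k<K. I (S \<union> T) k) - real K / real (\<Prod>(S \<union> T))"
    have "\<bar>?w S * ?w T * d\<bar> \<le> (real R * real R) * 1"
      unfolding abs_mult using sieve_weight_abs_le [OF R S] sieve_weight_abs_le [OF R T] cnt [OF S T]
      by (intro mult_mono) (auto simp: d_def)
    moreover have "(\<Sum>k<K. I (S \<union> T) k) = real K / real (\<Prod>(S \<union> T)) + d" by (simp add: d_def)
    then have "(?w S * ?w T) * (\<Sum>k<K. I (S \<union> T) k) = real K * (?w S * ?w T / real (\<Prod>(S \<union> T))) + ?w S * ?w T * d"
      by (simp only:) (simp add: algebra_simps)
    ultimately show "(?w S * ?w T) * (\<Sum>k<K. I (S \<union> T) k) \<le> real K * (?w S * ?w T / real (\<Prod>(S \<union> T))) + (real R)\<^sup>2"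
      unfolding power2_eq_square by linarith
  qed
  also have "\<dots> = real K * (\<Sum>S\<in>?D. \<Sum>T\<in>?D. ?w S * ?w T / real (\<Prod>(S \<union> T))) + (real (card ?D))\<^sup>2 * (real R)\<^sup>2"
    unfolding sum.distrib sum_distrib_left by (simp add: power2_eq_square)
  also have "\<dots> = real K / ?G + (real (card ?D))\<^sup>2 * (real R)\<^sup>2"
    unfolding sieve_quadratic_form [OF R] by simp
  also have "(real (card ?D))\<^sup>2 * (real R)\<^sup>2 \<le> (real R)\<^sup>2 * (real R)\<^sup>2"
    using sieve_sets_card [of q R] by (intro mult_right_mono power_mono) auto
  also have "(real R)\<^sup>2 * (real R)\<^sup>2 = real R ^ 4" by (simp flip: power_add)
  finally show ?thesis by (simp add: B_def)
qed

text \<open>The integers up to \<open>R\<close> are grouped by the set \<open>S\<close> of their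
  prime factors not dividing \<open>q\<close>. Exponents of the primes dividing \<open>q\<close> are
  free, so each group contributes at most 1 / phi(S) times q / phi(q).\<close>

lemma harm_le_sieve_mass:
  assumes q: "q \<ge> 1"
  shows "harm R * (real (totient q) / real q) \<le> sieve_mass q R"
proof -
  define W where "W = prime_factors q"
  let ?D = "sieve_sets q R"
  define g where "g n = prime_factors n - W" for n
  have finW: "finite W" by (simp add: W_def)
  have gD: "g ` {1..R} \<subseteq> ?D"
  proof clarify
    fix n assume n: "n \<in> {1..R}"
    have "\<Prod>(g n) dvd n"
      by (rule prod_primes_dvd) (auto simp: g_def in_prime_factors_iff)
    then have "\<Prod>(g n) \<le> n" using n by (intro dvd_imp_le) auto
    moreover have "\<forall>r\<in>g n. prime r \<and> \<not> r dvd q"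
      using q by (auto simp: g_def W_def in_prime_factors_iff)
    moreover have "finite (g n)" by (simp add: g_def)
    ultimately show "g n \<in> ?D" using n unfolding sieve_sets_def by simp
  qed
  have W1: "real r > 1" if "r \<in> W" for r
    using that prime_gt_1_nat [of r] by (simp add: W_def in_prime_factors_iff)
  have tot: "(\<Prod>r\<in>W. real r / (real r - 1)) * (real (totient q) / real q) = 1"
  proof -
    have "real (totient q) / real q = (\<Prod>r\<in>W. 1 - 1 / real r)"
      using q by (simp add: totient_formula2 W_def)
    then have "(\<Prod>r\<in>W. real r / (real r - 1)) * (real (totient q) / real q) = (\<Prod>r\<in>W. real r / (real r - 1) * (1 - 1 / real r))"
      by (simp only: prod.distrib)
    also have "\<dots> = (\<Prod>r\<in>W. 1)"
      by (rule prod.cong) (auto dest!: W1 simp: field_simps)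
    also have "\<dots> = 1" by simp
    finally show ?thesis .
  qed
  have "harm R = (\<Sum>n\<in>{1..R}. 1 / real n)" by (simp add: harm_def inverse_eq_divide)
  also have "\<dots> = (\<Sum>S\<in>?D. \<Sum>n\<in>{n \<in> {1..R}. g n = S}. 1 / real n)"
    by (rule sum.group [symmetric]) (use gD sieve_sets_finite in auto)
  also have "\<dots> \<le> (\<Sum>S\<in>?D. 1 / phi_set S * (\<Prod>r\<in>W. real r / (real r - 1)))"
  proof (rule sum_mono)
    fix S assume S: "S \<in> ?D"
    have "(\<Sum>n\<in>{n \<in> {1..R}. g n = S}. 1 / real n)
        \<le> (\<Prod>r\<in>S. 1 / (real r - 1)) * (\<Prod>r\<in>W. real r / (real r - 1))"
    proof (rule sum_inverse_le_Euler_product)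
      show "S \<inter> W = {}" using sieve_setsD(3) [OF S] by (auto simp: W_def in_prime_factors_iff)
      show "\<And>r. r \<in> S \<union> W \<Longrightarrow> prime r" using sieve_setsD(2) [OF S] by (auto simp: W_def in_prime_factors_iff)
      show "finite {n \<in> {1..R}. g n = S}" by (rule finite_subset [of _ "{1..R}"]) blast+
      show "0 < n \<and> S \<subseteq> prime_factors n \<and> prime_factors n \<subseteq> S \<union> W" if "n \<in> {n \<in> {1..R}. g n = S}" for n
        using that by (auto simp: g_def)
    qed (use sieve_setsD(1) [OF S] finW in auto)
    then show "(\<Sum>n\<in>{n \<in> {1..R}. g n = S}. 1 / real n) \<le> 1 / phi_set S * (\<Prod>r\<in>W. real r / (real r - 1))"
      by (simp add: phi_set_def prod_dividef)
  qed
  also have "\<dots> = sieve_mass q R * (\<Prod>r\<in>W. real r / (real r - 1))"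
    unfolding sieve_mass_def sum_distrib_right ..
  finally have "harm R * (real (totient q) / real q)
      \<le> sieve_mass q R * (\<Prod>r\<in>W. real r / (real r - 1)) * (real (totient q) / real q)"
    by (rule mult_right_mono) simp
  then show ?thesis unfolding mult.assoc tot by simp
qed

text \<open>The exponent 3/5 only has to exceed 1/2: the largest moduli used later are a bounded
  multiple of sqrt N. The bound is uniform in \<open>q\<close> and \<open>a\<close>, which permits
  summation over the divisors \<open>d\<close>.\<close>

lemma Brun_Titchmarsh:
  "eventually (\<lambda>N. \<forall>q a. 1 \<le> q \<longrightarrow> real q \<le> real N powr (3/5) \<longrightarrow>
     real (card {p. prime p \<and> p \<le> N \<and> [int p = a] (mod int q)})
       \<le> 41 * real N / (real (totient q) * ln (real N))) sequentially"
proof -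
  have "eventually (\<lambda>N::nat. 2 * ln (real N) \<le> real N powr (1/5)) sequentially"
    by real_asymp
  then show ?thesis using eventually_ge_at_top [of "2 :: nat"]
  proof eventually_elim
    case (elim N)
    show ?case
    proof (intro allI impI)
      fix q :: nat and a :: int
      assume q: "1 \<le> q" "real q \<le> real N powr (3/5)"
      \<comment> \<open>With the power 1/8 the sieve error R^4 is at most sqrt (N / q), while N / q
        \<ge> N^(2/5) gives ln x \<ge> (2/5) (1/8) ln N = ln N / 20.\<close>
      define x where "x = (real N / real q) powr (1/8)"
      define R where "R = nat \<lfloor>x\<rfloor>"
      define K where "K = N div q + 1"
      define b where "b = nat (a mod int q)"
      define G where "G = sieve_mass q R"
      have N0: "real N > 1" "ln (real N) > 0" using elim by auto
      have t0: "0 < totient q" "totient q \<le> q" using q by (auto simp: totient_le)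
      have Nq: "real N powr (2/5) \<le> real N / real q"
      proof -
        have "real N powr (2/5) * real q \<le> real N powr (2/5) * real N powr (3/5)"
          using q by (intro mult_left_mono) auto
        also have "\<dots> = real N" using N0 by (simp flip: powr_add)
        finally show ?thesis using q by (simp add: field_simps)
      qed
      have Nq1: "real N / real q \<ge> 1"
        using Nq N0 ge_one_powr_ge_zero [of "real N" "2/5"] by linarith
      have Nq0: "real N / real q > 0" using Nq1 by linarith
      have x1: "x \<ge> 1" unfolding x_def using Nq1 by (intro ge_one_powr_ge_zero) auto
      have R1: "R \<ge> 1" unfolding R_def using x1 by (simp add: le_nat_iff le_floor_iff)
      have Rx: "real R \<le> x" "x \<le> real R + 1" unfolding R_def using x1 by linarith+
      have R4: "real R ^ 4 \<le> sqrt (real N / real q)"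
      proof -
        have "real R ^ 4 \<le> x ^ 4" using Rx by (intro power_mono) auto
        also have "x ^ 4 = (real N / real q) powr (1/2)"
        proof -
          have "x ^ 4 = x powr real 4" using x1 by (intro powr_realpow [symmetric]) simp
          also have "\<dots> = (real N / real q) powr (1 / 8 * real 4)" unfolding x_def by (rule powr_powr)
          finally show ?thesis by simp
        qed
        also have "\<dots> = sqrt (real N / real q)" using Nq1 by (intro powr_half_sqrt) auto
        finally show ?thesis .
      qed
      have "ln (real N) / 20 \<le> ln x"
      proof -
        have "ln (real N) * (2/5) = ln (real N powr (2/5))" using N0 by (simp add: ln_powr)
        also have "\<dots> \<le> ln (real N / real q)" 
          by (rule ln_le_cancel_iff [THEN iffD2, OF _ Nq0 Nq]) (use N0 in simp)
        finally have "ln (real N) * (2/5) * (1/8) \<le> ln (real N / real q) * (1/8)" by simp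
        also have "\<dots> = ln x" unfolding x_def using Nq1 by (simp add: ln_powr)
        finally show ?thesis by simp
      qed
      also have "\<dots> \<le> ln (real R + 1)" using Rx x1 by (subst ln_le_cancel_iff) auto
      also have "\<dots> \<le> harm R" by (rule ln_le_harm)
      finally have harmR: "ln (real N) / 20 \<le> harm R" .
      have "ln (real N) / 20 * (real (totient q) / real q) \<le> harm R * (real (totient q) / real q)"
        using harmR by (intro mult_right_mono) auto
      also have "\<dots> \<le> G" unfolding G_def by (rule harm_le_sieve_mass [OF q(1)])
      finally have G: "ln (real N) / 20 * (real (totient q) / real q) \<le> G" .
      \<comment> \<open>Since K \<le> 2 N / q, the constant 20 doubles to 40; the error terms raise
        it to 41.\<close>
      have KG: "real K / G \<le> 40 * real N / (real (totient q) * ln (real N))"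
      proof -
        have "real K \<le> 2 * (real N / real q)"
        proof -
          have "real (N div q) \<le> real N / real q" 
            using q by (subst pos_le_divide_eq) (simp_all flip: of_nat_mult)
          then show ?thesis unfolding K_def using Nq1 by simp
        qed
        then have "real K / G \<le> 2 * (real N / real q) / (ln (real N) / 20 * (real (totient q) / real q))"
          using G N0 t0 q by (intro frac_le) auto
        also have "\<dots> = 40 * real N / (real (totient q) * ln (real N))"
          using q N0 t0 by (simp add: field_simps)
        finally show ?thesis .
      qed
      have err: "2 * real R ^ 4 \<le> real N / (real (totient q) * ln (real N))"
      proof -
        have "2 * ln (real N) \<le> sqrt (real N / real q)"
        proof -
          have "2 * ln (real N) \<le> real N powr (1/5)" by (rule elim)
          also have "\<dots> = (real N powr (2/5)) powr (1/2)" by (simp add: powr_powr)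
          also have "\<dots> = sqrt (real N powr (2/5))" by (intro powr_half_sqrt) auto
          also have "\<dots> \<le> sqrt (real N / real q)" using Nq by simp
          finally show ?thesis .
        qed
        then have "2 * ln (real N) * sqrt (real N / real q) \<le> sqrt (real N / real q) * sqrt (real N / real q)"
          by (intro mult_right_mono) auto
        also have "\<dots> = real N / real q" by simp
        finally have "2 * sqrt (real N / real q) \<le> real N / real q / ln (real N)"
          using N0 by (subst pos_le_divide_eq) (simp_all add: mult_ac)
        also have "\<dots> = real N / (real q * ln (real N))" by simp
        also have "\<dots> \<le> real N / (real (totient q) * ln (real N))"
          using t0 N0 by (intro divide_left_mono mult_right_mono) auto
        finally show ?thesis using R4 by simp
      qed
      define P where "P = {p. prime p \<and> p \<le> N \<and> [int p = a] (mod int q)}"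
      define B where "B = {k. k < K \<and> (\<forall>r. prime r \<longrightarrow> r \<le> R \<longrightarrow> \<not> r dvd q \<longrightarrow> \<not> r dvd b + q * k)}"
      have finB: "finite B" by (rule finite_subset [of _ "{..<K}"]) (auto simp: B_def)
      \<comment> \<open>A prime up to \<open>R\<close> may be sifted out by itself, so these are
        counted trivially; their number is at most R \<le> R^4, hence the factor 2 in
        \<open>err\<close>.\<close>
      have sub: "P \<subseteq> {1..R} \<union> (\<lambda>k. b + q * k) ` B"
      proof
        fix p assume p: "p \<in> P"
        have "int (p mod q) = a mod int q"
          using p by (simp add: P_def unique_euclidean_semiring_class.cong_def zmod_int)
        then have "p mod q = b" unfolding b_def by linarith
        then have pb: "p = b + q * (p div q)" by (metis add.commute mult_div_mod_eq)
        show "p \<in> {1..R} \<union> (\<lambda>k. b + q * k) ` B"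
        proof (cases "p \<le> R")
          case True
          moreover have "p > 0" using p prime_gt_0_nat by (simp add: P_def)
          ultimately show ?thesis by simp
        next
          case False
          have "p div q \<in> B"
          proof -
            have "p div q < K" using p by (simp add: P_def K_def div_le_mono le_imp_less_Suc)
            moreover have "\<not> r dvd b + q * (p div q)" if "prime r" "r \<le> R" for r
            proof
              assume "r dvd b + q * (p div q)"
              then have "r dvd p" by (simp only: pb [symmetric])
              moreover have "prime p" using p by (simp add: P_def)
              ultimately have "r = p" using that(1) primes_dvd_imp_eq by blast
              then show False using that(2) False by simp
            qed
            ultimately show ?thesis unfolding B_def by blast
          qed
          then show ?thesis using pb by blast
        qed
      qed
      have "card P \<le> card ({1..R} \<union> (\<lambda>k. b + q * k) ` B)"
        using finB by (intro card_mono sub) auto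
      also have "\<dots> \<le> card {1..R} + card ((\<lambda>k. b + q * k) ` B)" by (rule card_Un_le)
      also have "\<dots> \<le> R + card B" using finB by (simp add: card_image_le)
      finally have "real (card P) \<le> real R + real (card B)" by linarith
      also have "real (card B) \<le> real K / G + real R ^ 4"
        unfolding B_def G_def by (rule Selberg_sieve [OF R1])
      finally have "real (card P) \<le> real R + (real K / G + real R ^ 4)" by simp
      moreover have "real R \<le> real R ^ 4" using R1 by (intro self_le_power) auto
      ultimately have "real (card P) \<le> 2 * real R ^ 4 + real K / G" by linarith
      also have "\<dots> \<le> 41 * real N / (real (totient q) * ln (real N))"
        using add_mono [OF err KG] by (simp flip: add_divide_distrib)
      finally show "real (card {p. prime p \<and> p \<le> N \<and> [int p = a] (mod int q)})
          \<le> 41 * real N / (real (totient q) * ln (real N))"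
        unfolding P_def .
    qed
  qed
qed

subsection \<open>Prime factors of shifted primes from a fixed finite set\<close>

lemma sum_inverse_pronic_le:
  assumes "finite A" "\<And>k. k \<in> A \<Longrightarrow> k \<ge> (2::nat)"
  shows "(\<Sum>k\<in>A. 1 / (real k * (real k - 1))) \<le> 1"
proof -
  define M where "M = Suc (\<Sum>A)"
  have partial_fraction: "1 / (x * (x - 1)) = 1 / (x - 1) - 1 / x" if "x > 1" for x :: real
    using that by (simp add: field_simps)
  have tel: "(\<Sum>k=2..Suc n. 1 / (real k * (real k - 1))) = 1 - 1 / real (Suc n)" for n
  proof (induction n)
    case (Suc n)
    have "(\<Sum>k=2..Suc (Suc n). 1 / (real k * (real k - 1)))
        = (\<Sum>k=2..Suc n. 1 / (real k * (real k - 1))) + 1 / (real (Suc (Suc n)) * (real (Suc (Suc n)) - 1))"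
      by (subst sum.cl_ivl_Suc) simp
    also have "1 / (real (Suc (Suc n)) * (real (Suc (Suc n)) - 1)) = 1 / real (Suc n) - 1 / real (Suc (Suc n))"
      using partial_fraction [of "real (Suc (Suc n))"] by simp
    also have "(\<Sum>k=2..Suc n. 1 / (real k * (real k - 1))) + (1 / real (Suc n) - 1 / real (Suc (Suc n)))
        = 1 - 1 / real (Suc (Suc n))"
      unfolding Suc.IH by simp
    finally show ?case .
  qed simp
  have "(\<Sum>k\<in>A. 1 / (real k * (real k - 1))) \<le> (\<Sum>k=2..M. 1 / (real k * (real k - 1)))"
  proof (rule sum_mono2)
    show "A \<subseteq> {2..M}"
    proof
      fix k assume k: "k \<in> A"
      then have "k \<le> \<Sum>A" using assms(1) by (intro member_le_sum) auto
      then show "k \<in> {2..M}" using assms(2) [OF k] by (simp add: M_def)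
    qed
  qed auto
  also have "\<dots> = 1 - 1 / real M" unfolding M_def by (rule tel)
  also have "\<dots> \<le> 1" by simp
  finally show ?thesis .
qed

text \<open>The argument is an integer so that p - 1 and p + 1 are both \<open>int p - s\<close>
  with \<open>s\<close> equal to 1 or -1.\<close>

definition omega_in :: "nat set \<Rightarrow> int \<Rightarrow> nat" where
  "omega_in Q n = card {q \<in> Q. int q dvd n}"

lemma power_omega_in:
  fixes c :: real
  assumes "finite Q"
  shows "c ^ omega_in Q n = (\<Prod>q\<in>Q. if int q dvd n then c else 1)"
  unfolding omega_in_def prod.inter_filter [OF assms, symmetric] by simp

lemma prime_factors_prod_primes:
  fixes S :: "nat set"
  assumes "finite S" "\<And>r. r \<in> S \<Longrightarrow> prime r"
  shows "prime_factors (\<Prod>S) = S"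
proof -
  have "\<Prod>S > 0" using assms(2) prime_gt_0_nat by (intro prod_pos) auto
  then show ?thesis
    using prime_dvd_prod_primes_iff [OF assms] assms(2) by (auto simp: in_prime_factors_iff)
qed

lemma totient_prod_primes:
  fixes S :: "nat set"
  assumes "finite S" "\<And>r. r \<in> S \<Longrightarrow> prime r"
  shows "real (totient (\<Prod>S)) = (\<Prod>r\<in>S. real r - 1)"
proof -
  have "real (totient (\<Prod>S)) = real (\<Prod>S) * (\<Prod>r\<in>prime_factors (\<Prod>S). 1 - 1 / real r)"
    by (rule totient_formula2)
  also have "prime_factors (\<Prod>S) = S" using assms by (rule prime_factors_prod_primes)
  also have "real (\<Prod>S) = (\<Prod>r\<in>S. real r)" by simp
  finally have "real (totient (\<Prod>S)) = (\<Prod>r\<in>S. real r) * (\<Prod>r\<in>S. 1 - 1 / real r)" .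
  also have "\<dots> = (\<Prod>r\<in>S. real r * (1 - 1 / real r))" by (simp only: prod.distrib)
  also have "\<dots> = (\<Prod>r\<in>S. real r - 1)"
  proof (rule prod.cong [OF refl])
    fix r assume "r \<in> S"
    then have "r > 0" using assms(2) prime_gt_0_nat by blast
    then show "real r * (1 - 1 / real r) = real r - 1" by (simp add: field_simps)
  qed
  finally show ?thesis .
qed

lemma prod_primes_dvd_int_iff:
  fixes S :: "nat set" and n :: int
  assumes "finite S" "\<And>r. r \<in> S \<Longrightarrow> prime r"
  shows "int (\<Prod>S) dvd n \<longleftrightarrow> (\<forall>r\<in>S. int r dvd n)"
proof
  assume "int (\<Prod>S) dvd n"
  then have d: "\<Prod>S dvd nat \<bar>n\<bar>" by (simp add: dvd_nat_abs_iff)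
  show "\<forall>r\<in>S. int r dvd n"
  proof
    fix r assume "r \<in> S"
    then have "r dvd \<Prod>S" using assms(1) by (intro dvd_prodI)
    then have "r dvd nat \<bar>n\<bar>" using d dvd_trans by blast
    then show "int r dvd n" by (simp add: dvd_nat_abs_iff)
  qed
next
  assume "\<forall>r\<in>S. int r dvd n"
  then have "r dvd nat \<bar>n\<bar>" if "r \<in> S" for r using that by (simp add: dvd_nat_abs_iff)
  then have "\<Prod>S dvd nat \<bar>n\<bar>" by (intro prod_primes_dvd assms)
  then show "int (\<Prod>S) dvd n" by (simp add: dvd_nat_abs_iff)
qed

text \<open>Writing 3/2 = 1 + 1/2 expands the moment over the subsets of \<open>Q\<close>, and
  Brun-Titchmarsh applies to each product of primes, all of which are bounded because
  \<open>Q\<close> is fixed. The factors 1 + 1 / (2 (q - 1)) reflect that \<open>q\<close> divides a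
  shifted prime with frequency 1 / (q - 1).\<close>

lemma sum_three_halves_power_omega:
  fixes Q :: "nat set" and s :: int
  assumes Q: "finite Q" "\<And>q. q \<in> Q \<Longrightarrow> prime q"
  shows "eventually (\<lambda>N. (\<Sum>p | prime p \<and> p \<le> N. (3/2) ^ omega_in Q (int p - s))
    \<le> 41 * real N / ln (real N) * exp ((\<Sum>q\<in>Q. 1 / real q) / 2 + 1 / 2)) sequentially"
proof -
  have "filterlim (\<lambda>N::nat. real N powr (3/5)) at_top sequentially" by real_asymp
  then have "eventually (\<lambda>N::nat. real (\<Prod>Q) \<le> real N powr (3/5)) sequentially"
    unfolding filterlim_at_top by blast
  then show ?thesis using Brun_Titchmarsh eventually_ge_at_top [of "2 :: nat"]
  proof eventually_elim
    case (elim N)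
    define P where "P = {p. prime p \<and> p \<le> N}"
    have finP: "finite P" unfolding P_def by (rule finite_subset [of _ "{..N}"]) auto
    have lnN: "ln (real N) > 0" using elim(3) by simp
    have expand: "(3/2 :: real) ^ omega_in Q n = (\<Sum>S\<in>Pow Q. (1/2) ^ card S * (if int (\<Prod>S) dvd n then 1 else 0))"
      for n :: int
    proof -
      have "(3/2 :: real) ^ omega_in Q n = (\<Prod>q\<in>Q. (if int q dvd n then 1/2 else 0) + 1)"
        unfolding power_omega_in [OF Q(1)] by (intro prod.cong refl) simp
      also have "\<dots> = (\<Sum>S\<in>Pow Q. \<Prod>q\<in>S. if int q dvd n then 1/2 else 0)"
        using prod_add [OF Q(1), of "\<lambda>q. if int q dvd n then 1/2 else 0 :: real" "\<lambda>_. 1"] by simp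
      also have "\<dots> = (\<Sum>S\<in>Pow Q. (1/2) ^ card S * (if int (\<Prod>S) dvd n then 1 else 0))"
      proof (rule sum.cong [OF refl])
        fix S assume "S \<in> Pow Q"
        then have S: "finite S" "\<And>r. r \<in> S \<Longrightarrow> prime r" using Q finite_subset by auto
        show "(\<Prod>q\<in>S. if int q dvd n then 1/2 else 0) = (1/2 :: real) ^ card S * (if int (\<Prod>S) dvd n then 1 else 0)"
        proof (cases "\<forall>r\<in>S. int r dvd n")
          case True
          then have "(\<Prod>q\<in>S. if int q dvd n then 1/2 else 0) = (\<Prod>q\<in>S. 1/2 :: real)"
            by (intro prod.cong) auto
          moreover have "int (\<Prod>S) dvd n" using prod_primes_dvd_int_iff [OF S] True by blast
          ultimately show ?thesis by (simp only: prod_constant if_True mult_1_right)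
        next
          case False
          then have "(\<Prod>q\<in>S. if int q dvd n then 1/2 else 0) = (0::real)"
            using S(1) by (intro prod_zero) auto
          moreover have "\<not> int (\<Prod>S) dvd n" using prod_primes_dvd_int_iff [OF S] False by blast
          ultimately show ?thesis by (simp only: if_False mult_zero_right)
        qed
      qed
      finally show ?thesis .
    qed
    have "(\<Sum>p\<in>P. (3/2 :: real) ^ omega_in Q (int p - s))
        = (\<Sum>p\<in>P. \<Sum>S\<in>Pow Q. (1/2) ^ card S * (if int (\<Prod>S) dvd int p - s then 1 else 0))"
      unfolding expand ..
    also have "\<dots> = (\<Sum>S\<in>Pow Q. \<Sum>p\<in>P. (1/2) ^ card S * (if int (\<Prod>S) dvd int p - s then 1 else 0))"
      by (rule sum.swap)
    also have "\<dots> \<le> (\<Sum>S\<in>Pow Q. 41 * real N / ln (real N) * (\<Prod>q\<in>S. 1 / (2 * (real q - 1))))"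
    proof (rule sum_mono)
      fix S assume SQ: "S \<in> Pow Q"
      then have S: "finite S" "\<And>r. r \<in> S \<Longrightarrow> prime r" using Q finite_subset by auto
      have pos: "\<Prod>S \<ge> 1"
        using prod_pos [of S "\<lambda>x. x"] S(2) prime_gt_0_nat by fastforce
      have "\<Prod>S dvd \<Prod>Q" using SQ Q by (intro prod_dvd_prod_subset) auto
      moreover have "\<Prod>Q > 0" using Q(2) prime_gt_0_nat by (intro prod_pos) auto
      ultimately have "\<Prod>S \<le> \<Prod>Q" by (rule dvd_imp_le)
      then have "real (\<Prod>S) \<le> real (\<Prod>Q)" by (rule of_nat_mono)
      then have "real (\<Prod>S) \<le> real N powr (3/5)" using elim(1) by linarith
      then have BT: "real (card {p. prime p \<and> p \<le> N \<and> [int p = s] (mod int (\<Prod>S))})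
          \<le> 41 * real N / (real (totient (\<Prod>S)) * ln (real N))"
        using elim(2) pos by blast
      have "(\<Sum>p\<in>P. (1/2 :: real) ^ card S * (if int (\<Prod>S) dvd int p - s then 1 else 0))
          = (1/2) ^ card S * (\<Sum>p\<in>P. if int (\<Prod>S) dvd int p - s then 1 else 0)"
        by (rule sum_distrib_left [symmetric])
      also have "(\<Sum>p\<in>P. if int (\<Prod>S) dvd int p - s then 1 else (0::real))
          = (\<Sum>p\<in>P \<inter> {p. int (\<Prod>S) dvd int p - s}. 1)"
        by (simp only: sum.inter_restrict [OF finP] mem_Collect_eq)
      also have "\<dots> = real (card (P \<inter> {p. int (\<Prod>S) dvd int p - s}))" by simp
      also have "P \<inter> {p. int (\<Prod>S) dvd int p - s} = {p. prime p \<and> p \<le> N \<and> [int p = s] (mod int (\<Prod>S))}"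
        unfolding P_def cong_iff_dvd_diff by blast
      also have "(1/2) ^ card S * real (card {p. prime p \<and> p \<le> N \<and> [int p = s] (mod int (\<Prod>S))})
          \<le> (1/2) ^ card S * (41 * real N / (real (totient (\<Prod>S)) * ln (real N)))"
        using BT by (intro mult_left_mono) auto
      also have "\<dots> = 41 * real N / ln (real N) * (\<Prod>q\<in>S. 1 / (2 * (real q - 1)))"
      proof -
        have "real (totient (\<Prod>S)) = (\<Prod>r\<in>S. real r - 1)" using S by (rule totient_prod_primes)
        moreover have "(\<Prod>q\<in>S. 1 / (2 * (real q - 1))) = (1/2) ^ card S * (1 / (\<Prod>r\<in>S. real r - 1))"
          by (simp only: prod_dividef prod.distrib prod_constant power_one_over power_one) simp
        ultimately show ?thesis by (simp add: mult_ac)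
      qed
      finally show "(\<Sum>p\<in>P. (1/2) ^ card S * (if int (\<Prod>S) dvd int p - s then 1 else 0))
          \<le> 41 * real N / ln (real N) * (\<Prod>q\<in>S. 1 / (2 * (real q - 1)))" .
    qed
    also have "\<dots> = 41 * real N / ln (real N) * (\<Prod>q\<in>Q. 1 / (2 * (real q - 1)) + 1)"
      unfolding sum_distrib_left [symmetric]
      using prod_add [OF Q(1), of "\<lambda>q. 1 / (2 * (real q - 1))" "\<lambda>_. 1"] by simp
    also have "\<dots> \<le> 41 * real N / ln (real N) * exp ((\<Sum>q\<in>Q. 1 / real q) / 2 + 1 / 2)"
    proof (rule mult_left_mono)
      have q1: "real q > 1" if "q \<in> Q" for q using Q(2) [OF that] prime_gt_1_nat by simp
      have "(\<Prod>q\<in>Q. 1 / (2 * (real q - 1)) + 1) \<le> (\<Prod>q\<in>Q. exp (1 / (2 * (real q - 1))))"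
      proof (intro prod_mono conjI)
        fix q assume "q \<in> Q"
        then show "0 \<le> 1 / (2 * (real q - 1)) + 1" using q1 by (simp add: less_imp_le)
        show "1 / (2 * (real q - 1)) + 1 \<le> exp (1 / (2 * (real q - 1)))"
          using exp_ge_add_one_self [of "1 / (2 * (real q - 1))"] by linarith
      qed
      also have "\<dots> = exp (\<Sum>q\<in>Q. 1 / (2 * (real q - 1)))" using Q(1) by (simp add: exp_sum)
      \<comment> \<open>From 1 / (q - 1) = 1 / q + 1 / (q (q - 1)); the last terms sum to at most 1,
        hence the constant 1/2 in the exponent.\<close>
      also have "(\<Sum>q\<in>Q. 1 / (2 * (real q - 1))) = (\<Sum>q\<in>Q. 1 / real q / 2 + 1 / (real q * (real q - 1)) / 2)"
      proof (rule sum.cong [OF refl])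
        fix q assume "q \<in> Q"
        then show "1 / (2 * (real q - 1)) = 1 / real q / 2 + 1 / (real q * (real q - 1)) / 2"
          using q1 [of q] by (simp add: field_simps)
      qed
      also have "\<dots> = (\<Sum>q\<in>Q. 1 / real q) / 2 + (\<Sum>q\<in>Q. 1 / (real q * (real q - 1))) / 2"
        by (simp only: sum.distrib sum_divide_distrib)
      also have "exp \<dots> \<le> exp ((\<Sum>q\<in>Q. 1 / real q) / 2 + 1 / 2)"
        using sum_inverse_pronic_le [OF Q(1)] Q(2) prime_ge_2_nat by simp
      finally show "(\<Prod>q\<in>Q. 1 / (2 * (real q - 1)) + 1) \<le> exp ((\<Sum>q\<in>Q. 1 / real q) / 2 + 1 / 2)" .
    qed (use lnN in simp)
    finally show ?case unfolding P_def .
  qed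
qed

text \<open>Chinese remainder theorem. Iterated in \<open>sum_prod_periodic\<close>, it reduces a
  sum over residues modulo \<Prod>Q to local sums at each prime.\<close>

lemma sum_mult_periodic:
  fixes g h :: "nat \<Rightarrow> real" and m n :: nat
  assumes "coprime m n" "m > 0" "n > 0"
    and g: "\<And>x. g (x mod m) = g x" and h: "\<And>x. h (x mod n) = h x"
  shows "(\<Sum>x<m * n. g x * h x) = (\<Sum>x<m. g x) * (\<Sum>y<n. h y)"
proof -
  define \<phi> where "\<phi> x = (x mod m, x mod n)" for x
  have inj: "inj_on \<phi> {..<m * n}"
  proof (rule inj_onI)
    fix x y assume xy: "x \<in> {..<m * n}" "y \<in> {..<m * n}" "\<phi> x = \<phi> y"
    then have "[x = y] (mod m)" "[x = y] (mod n)"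
      by (simp_all add: \<phi>_def unique_euclidean_semiring_class.cong_def)
    then have "[x = y] (mod m * n)" using assms(1) by (rule coprime_cong_mult_nat)
    then show "x = y" using xy by (simp add: unique_euclidean_semiring_class.cong_def)
  qed
  have "\<phi> ` {..<m * n} = {..<m} \<times> {..<n}"
  proof (rule card_subset_eq)
    show "\<phi> ` {..<m * n} \<subseteq> {..<m} \<times> {..<n}" using assms by (auto simp: \<phi>_def)
    show "card (\<phi> ` {..<m * n}) = card ({..<m} \<times> {..<n})"
      using card_image [OF inj] by simp
  qed simp
  then have "(\<Sum>z\<in>{..<m} \<times> {..<n}. g (fst z) * h (snd z)) = (\<Sum>z\<in>\<phi> ` {..<m * n}. g (fst z) * h (snd z))"
    by simp
  also have "\<dots> = (\<Sum>x<m * n. g x * h x)"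
    by (subst sum.reindex [OF inj]) (simp add: \<phi>_def g h)
  finally show ?thesis by (simp add: sum_product sum.cartesian_product split_def)
qed

lemma sum_prod_periodic:
  fixes f :: "nat \<Rightarrow> nat \<Rightarrow> real"
  assumes "finite Q" "\<And>q. q \<in> Q \<Longrightarrow> prime q" "\<And>q x. q \<in> Q \<Longrightarrow> f q (x mod q) = f q x"
  shows "(\<Sum>x<\<Prod>Q. \<Prod>q\<in>Q. f q x) = (\<Prod>q\<in>Q. \<Sum>x<q. f q x)"
  using assms
proof (induction Q rule: finite_induct)
  case (insert q Q)
  have cop: "coprime q (\<Prod>Q)"
    using insert by (intro prod_coprime_right) (metis insertI1 insertI2 primes_coprime)
  have Q: "\<Prod>Q > 0" using insert.prems(1) prime_gt_0_nat by (intro prod_pos) auto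
  have per: "(\<Prod>r\<in>Q. f r (x mod \<Prod>Q)) = (\<Prod>r\<in>Q. f r x)" for x
  proof (rule prod.cong [OF refl])
    fix r assume r: "r \<in> Q"
    then have "r dvd \<Prod>Q" using insert.hyps by (intro dvd_prodI)
    then have "(x mod \<Prod>Q) mod r = x mod r" by (rule mod_mod_cancel)
    then show "f r (x mod \<Prod>Q) = f r x" using insert.prems(2) r by (metis insertI2)
  qed
  have "(\<Sum>x<\<Prod>(insert q Q). \<Prod>r\<in>insert q Q. f r x) = (\<Sum>x<q * \<Prod>Q. f q x * (\<Prod>r\<in>Q. f r x))"
    using insert.hyps by simp
  also have "\<dots> = (\<Sum>x<q. f q x) * (\<Sum>x<\<Prod>Q. \<Prod>r\<in>Q. f r x)"
    using cop Q per insert.prems prime_gt_0_nat by (intro sum_mult_periodic) auto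
  also have "\<dots> = (\<Prod>r\<in>insert q Q. \<Sum>x<r. f r x)"
    using insert by simp
  finally show ?case .
qed simp

subsection \<open>Shifted primes with a divisor in a short range\<close>

text \<open>
  \<open>divisor_weight Q d\<close> bounds the sum of \<open>2\<close> to the power \<open>- omega_in Q (d m)\<close> over those residues
  \<open>m\<close> modulo \<open>\<Prod>Q\<close> for which \<open>d m + s\<close> is coprime to \<open>\<Prod>Q\<close>, where \<open>s\<close> is \<open>1\<close> or \<open>-1\<close>;
  \<open>cofactor_weight\<close> is the local factor of the summand.
\<close>

definition divisor_weight :: "nat set \<Rightarrow> nat \<Rightarrow> real" where
  "divisor_weight Q d = (\<Prod>q\<in>Q. if q dvd d then real q / 2 else real q - 3 / 2)"

definition cofactor_weight :: "nat \<Rightarrow> int \<Rightarrow> nat \<Rightarrow> nat \<Rightarrow> real" where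
  "cofactor_weight d s q m =
     (if int q dvd int d * int m + s then 0 else if q dvd d * m then 1 / 2 else 1)"

lemma cofactor_weight_mod: "cofactor_weight d s q (m mod q) = cofactor_weight d s q m"
proof -
  have "(int d * int (m mod q) + s) mod int q = (int d * int m + s) mod int q"
    unfolding zmod_int by (metis mod_add_left_eq mod_mult_right_eq)
  then have "int q dvd int d * int (m mod q) + s \<longleftrightarrow> int q dvd int d * int m + s"
    by (simp only: dvd_eq_mod_eq_0)
  moreover have "q dvd d * (m mod q) \<longleftrightarrow> q dvd d * m"
    by (simp only: dvd_eq_mod_eq_0 mod_mult_right_eq)
  ultimately show ?thesis by (simp only: cofactor_weight_def)
qed

lemma cofactor_weight_nonneg: "0 \<le> cofactor_weight d s q m"
  by (simp add: cofactor_weight_def)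

text \<open>If \<open>q\<close> divides \<open>d\<close>, then \<open>q\<close> never divides d m +
  s, and all \<open>q\<close> weights are 1/2. Otherwise the solution \<open>m0\<close> of d m + s =
  0 modulo \<open>q\<close> has weight 0, the residue 0, distinct from \<open>m0\<close>, has weight
  1/2, and the rest have weight 1, in total q - 1 - 1/2.\<close>

lemma sum_cofactor_weight_le:
  assumes q: "prime q" and s: "s = 1 \<or> s = -1"
  shows "(\<Sum>m<q. cofactor_weight d s q m) \<le> (if q dvd d then real q / 2 else real q - 3 / 2)"
proof -
  have q1: "q > 1" using q prime_gt_1_nat by blast
  have nds: "\<not> int q dvd s"
  proof
    assume "int q dvd s"
    then have "int q dvd 1" using s by auto
    then show False using q1 by simp
  qed
  show ?thesis
  proof (cases "q dvd d")
    case True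
    have half: "cofactor_weight d s q m = 1 / 2" for m
    proof -
      have "int q dvd int d * int m" using True by (intro dvd_mult2) simp
      then have "\<not> int q dvd int d * int m + s" using nds dvd_add_right_iff by blast
      moreover have "q dvd d * m" using True by simp
      ultimately show ?thesis by (simp add: cofactor_weight_def)
    qed
    show ?thesis unfolding half using True by simp
  next
    case False
    then have "coprime d q" using q prime_imp_coprime coprime_commute by metis
    from cong_solve_coprime_nat [OF this] obtain x where "[d * x = Suc 0] (mod q)" ..
    then have "[int (d * x) = int (Suc 0)] (mod int q)" by (simp only: cong_int_iff)
    then have x: "int q dvd int d * int x - 1" by (simp add: cong_iff_dvd_diff)
    define m0 where "m0 = nat ((- s * int x) mod int q)"
    have im0: "int m0 = (- s * int x) mod int q" using q1 by (simp add: m0_def)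
    have "int m0 < int q" unfolding im0 using q1 by simp
    then have m0q: "m0 < q" by simp
    have dm0: "int q dvd int d * int m0 + s"
    proof -
      have "int m0 mod int q = (- s * int x) mod int q" by (simp only: im0 mod_mod_trivial)
      then have "int q dvd int m0 - (- s * int x)" by (simp only: mod_eq_dvd_iff)
      then have 1: "int q dvd int d * (int m0 - (- s * int x))" by (rule dvd_mult)
      have 2: "int q dvd s * (int d * int x - 1)" using x by (rule dvd_mult)
      show ?thesis using dvd_diff [OF 1 2] by (simp add: algebra_simps)
    qed
    have m00: "m0 \<noteq> 0"
    proof
      assume "m0 = 0"
      then show False using dm0 nds by simp
    qed
    have "(\<Sum>m<q. cofactor_weight d s q m)
        \<le> (\<Sum>m<q. 1 - (if m = 0 then 1 / 2 else 0) - (if m = m0 then 1 else 0))"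
    proof (rule sum_mono)
      fix m
      consider "m = 0" | "m = m0" | "m \<noteq> 0" "m \<noteq> m0" by blast
      then show "cofactor_weight d s q m \<le> 1 - (if m = 0 then 1 / 2 else 0) - (if m = m0 then 1 else 0)"
      proof cases
        case 1
        then show ?thesis using nds m00 by (simp add: cofactor_weight_def)
      next
        case 2
        then show ?thesis using dm0 m00 by (simp add: cofactor_weight_def)
      next
        case 3
        then show ?thesis by (simp add: cofactor_weight_def)
      qed
    qed
    also have "\<dots> = real q - 3 / 2"
      using m0q q1 by (simp add: sum_subtractf)
    finally show ?thesis using False by simp
  qed
qed

text \<open>Applied to \<open>d\<close> and \<Prod>Q, which may share primes: phi(a) phi(b) gcd(a,
  b) = phi(a b) phi(gcd(a, b)).\<close>

lemma totient_mult_ge: "a \<ge> 1 \<Longrightarrow> totient a * totient b \<le> totient (a * b)"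
proof -
  assume a: "a \<ge> 1"
  have g: "gcd a b > 0" using a by simp
  have "totient a * totient b * totient (gcd a b) \<le> totient a * totient b * gcd a b"
    by (intro mult_le_mono2 totient_le)
  also have "\<dots> = totient (a * b) * totient (gcd a b)" by (rule totient_gcd [symmetric])
  finally show ?thesis using g unfolding mult_le_cancel2 by (simp only: totient_gt_0_iff)
qed

text \<open>With p - s = d k, the summand depends only on the residue \<kappa> of the cofactor
  \<open>k\<close> modulo M = \<Prod>Q. Fixing \<kappa> puts \<open>p\<close> into one class modulo
  \<open>d * M\<close>, where Brun-Titchmarsh gives the same bound for every class; the remaining
  sum over classes factors over \<open>Q\<close>.\<close>

lemma sum_half_power_omega_multiples:
  fixes Q :: "nat set" and s :: int and N d :: nat
  assumes Q: "finite Q" "\<And>q. q \<in> Q \<Longrightarrow> prime q" and s: "s = 1 \<or> s = -1"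
    and d: "d \<ge> 1" and N: "N \<ge> 2" and dQ: "real (d * \<Prod>Q) \<le> real N powr (3/5)"
    and BT: "\<forall>q a. 1 \<le> q \<longrightarrow> real q \<le> real N powr (3/5) \<longrightarrow>
     real (card {p. prime p \<and> p \<le> N \<and> [int p = a] (mod int q)})
       \<le> 41 * real N / (real (totient q) * ln (real N))"
  shows "(\<Sum>p | prime p \<and> p \<le> N \<and> p \<notin> Q \<and> int d dvd int p - s. (1/2) ^ omega_in Q (int p - s))
    \<le> 41 * real N / ln (real N) * (divisor_weight Q d / (real (totient d) * real (totient (\<Prod>Q))))"
proof -
  define M where "M = \<Prod>Q"
  define P where "P = {p. prime p \<and> p \<le> N \<and> p \<notin> Q \<and> int d dvd int p - s}"
  define k where "k p = (int p - s) div int d" for p :: nat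
  define \<kappa> where "\<kappa> p = nat (k p mod int M)" for p
  define F where "F m = (\<Prod>q\<in>Q. cofactor_weight d s q m)" for m
  define B where "B = 41 * real N / (real (totient d) * real (totient M) * ln (real N))"
  have finP: "finite P" unfolding P_def by (rule finite_subset [of _ "{..N}"]) auto
  have M0: "M > 0" unfolding M_def using Q(2) prime_gt_0_nat by (intro prod_pos) auto
  have lnN: "ln (real N) > 0" using N by simp
  have \<kappa>M: "\<kappa> p < M" for p
  proof -
    have "int (\<kappa> p) < int M" using M0 by (simp add: \<kappa>_def)
    then show ?thesis by simp
  qed
  have kp: "int p - s = int d * k p" if "p \<in> P" for p
    using that by (simp add: P_def k_def)
  have k\<kappa>: "int M dvd k p - int (\<kappa> p)" for p
  proof -
    have "int (\<kappa> p) = k p mod int M" using M0 by (simp add: \<kappa>_def)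
    then have "k p mod int M = int (\<kappa> p) mod int M" by (simp only: mod_mod_trivial)
    then show ?thesis by (simp only: mod_eq_dvd_iff)
  qed
  have F: "(1/2) ^ omega_in Q (int p - s) = F (\<kappa> p)" if p: "p \<in> P" for p
    unfolding power_omega_in [OF Q(1)] F_def
  proof (rule prod.cong [OF refl])
    fix q assume q: "q \<in> Q"
    have "q dvd M" unfolding M_def using Q(1) q by (rule dvd_prodI)
    then have "int q dvd int M" by simp
    then have "int q dvd k p - int (\<kappa> p)" using k\<kappa> dvd_trans by blast
    then have "int q dvd int d * (k p - int (\<kappa> p))" by (rule dvd_mult)
    then have diff: "int q dvd int d * k p - int d * int (\<kappa> p)" by (simp add: right_diff_distrib)
    have 1: "int q dvd int p - s \<longleftrightarrow> q dvd d * \<kappa> p"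
    proof -
      have "int q dvd int p - s \<longleftrightarrow> int q dvd int d * int (\<kappa> p)"
        unfolding kp [OF p] using dvd_add_right_iff [OF diff, of "int d * int (\<kappa> p)"] by simp
      also have "\<dots> \<longleftrightarrow> q dvd d * \<kappa> p" by (simp only: of_nat_mult [symmetric] int_dvd_int_iff)
      finally show ?thesis .
    qed
    \<comment> \<open>Otherwise \<open>q\<close> would divide \<open>p\<close> and so equal it; this
      is why the primes in \<open>Q\<close> are excluded.\<close>
    have 2: "\<not> int q dvd int d * int (\<kappa> p) + s"
    proof
      assume "int q dvd int d * int (\<kappa> p) + s"
      then have "int q dvd (int d * int (\<kappa> p) + s) + (int d * k p - int d * int (\<kappa> p))"
        using diff by (rule dvd_add)
      then have "int q dvd int p" using kp [OF p] by (simp add: algebra_simps)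
      then have "q dvd p" by simp
      moreover have "prime p" using p by (simp add: P_def)
      ultimately have "q = p" using Q(2) [OF q] primes_dvd_imp_eq by blast
      then show False using p q by (simp add: P_def)
    qed
    show "(if int q dvd int p - s then 1 / 2 else 1) = cofactor_weight d s q (\<kappa> p)"
      unfolding cofactor_weight_def using 1 2 by simp
  qed
  have card_le: "real (card {p \<in> P. \<kappa> p = m}) \<le> B" for m
  proof -
    have "{p \<in> P. \<kappa> p = m} \<subseteq> {p. prime p \<and> p \<le> N \<and> [int p = int d * int m + s] (mod int (d * M))}"
    proof clarify
      fix p assume p: "p \<in> P" "m = \<kappa> p"
      have "int d * int M dvd int d * (k p - int (\<kappa> p))" using k\<kappa> by (intro mult_dvd_mono) auto
      moreover have "int p - (int d * int (\<kappa> p) + s) = int d * (k p - int (\<kappa> p))"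
        using kp [OF p(1)] by (simp add: algebra_simps)
      ultimately have "[int p = int d * int (\<kappa> p) + s] (mod int (d * M))"
        by (simp add: cong_iff_dvd_diff)
      then show "prime p \<and> p \<le> N \<and> [int p = int d * int (\<kappa> p) + s] (mod int (d * M))"
        using p by (simp add: P_def)
    qed
    moreover have "finite {p. prime p \<and> p \<le> N \<and> [int p = int d * int m + s] (mod int (d * M))}"
      by (rule finite_subset [of _ "{..N}"]) auto
    ultimately have "card {p \<in> P. \<kappa> p = m} \<le> card {p. prime p \<and> p \<le> N \<and> [int p = int d * int m + s] (mod int (d * M))}"
      by (intro card_mono)
    also have "real \<dots> \<le> 41 * real N / (real (totient (d * M)) * ln (real N))"
    proof -
      have "1 \<le> d * M" using d M0 by simp
      then show ?thesis using BT dQ unfolding M_def by blast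
    qed
    also have "\<dots> \<le> B"
    proof -
      have "real (totient d) * real (totient M) \<le> real (totient (d * M))"
        using totient_mult_ge [OF d, of M] by (simp flip: of_nat_mult)
      moreover have "totient d > 0" "totient M > 0" using d M0 by auto
      ultimately show ?thesis unfolding B_def using lnN
        by (intro divide_left_mono mult_right_mono mult_pos_pos) auto
    qed
    finally show ?thesis by simp
  qed
  have "(\<Sum>p\<in>P. (1/2 :: real) ^ omega_in Q (int p - s)) = (\<Sum>p\<in>P. F (\<kappa> p))"
    by (rule sum.cong [OF refl F])
  also have "\<dots> = (\<Sum>m<M. \<Sum>p\<in>{p \<in> P. \<kappa> p = m}. F (\<kappa> p))"
    by (rule sum.group [symmetric]) (use finP \<kappa>M in auto)
  also have "\<dots> = (\<Sum>m<M. F m * real (card {p \<in> P. \<kappa> p = m}))"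
    by (rule sum.cong) (simp_all add: mult.commute)
  also have "\<dots> \<le> (\<Sum>m<M. F m * B)"
    using card_le by (intro sum_mono mult_left_mono) (auto simp: F_def intro!: prod_nonneg cofactor_weight_nonneg)
  also have "\<dots> = (\<Sum>m<M. F m) * B" by (rule sum_distrib_right [symmetric])
  also have "\<dots> \<le> divisor_weight Q d * B"
  proof (rule mult_right_mono)
    have "(\<Sum>m<M. F m) = (\<Prod>q\<in>Q. \<Sum>m<q. cofactor_weight d s q m)"
      unfolding F_def M_def using Q cofactor_weight_mod by (intro sum_prod_periodic) auto
    also have "\<dots> \<le> divisor_weight Q d"
      unfolding divisor_weight_def using Q s
      by (intro prod_mono conjI sum_nonneg cofactor_weight_nonneg sum_cofactor_weight_le) auto
    finally show "(\<Sum>m<M. F m) \<le> divisor_weight Q d" .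
    show "0 \<le> B" unfolding B_def using lnN by simp
  qed
  also have "\<dots> = 41 * real N / ln (real N) * (divisor_weight Q d / (real (totient d) * real (totient M)))"
    by (simp add: B_def mult_ac)
  finally show ?thesis unfolding P_def M_def .
qed

section \<open>Summation of the weights over the divisor\<close>

lemma prod_square_ratio_le:
  assumes "finite A" "\<And>k. k \<in> A \<Longrightarrow> k \<ge> (2::nat)"
  shows "(\<Prod>k\<in>A. (real k)\<^sup>2 / ((real k)\<^sup>2 - 1)) \<le> 2"
proof -
  define n where "n = \<Sum>A"
  have ge1: "1 \<le> (real k)\<^sup>2 / ((real k)\<^sup>2 - 1)" if "k \<ge> 2" for k :: nat
  proof -
    have "(real k)\<^sup>2 \<ge> 2\<^sup>2" using that by (intro power_mono) auto
    then show ?thesis by simp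
  qed
  have tel: "(\<Prod>k=2..Suc n. (real k)\<^sup>2 / ((real k)\<^sup>2 - 1)) = 2 * (real n + 1) / (real n + 2)" for n
  proof (induction n)
    case (Suc n)
    have "(\<Prod>k=2..Suc (Suc n). (real k)\<^sup>2 / ((real k)\<^sup>2 - 1))
        = (\<Prod>k=2..Suc n. (real k)\<^sup>2 / ((real k)\<^sup>2 - 1)) * ((real (Suc (Suc n)))\<^sup>2 / ((real (Suc (Suc n)))\<^sup>2 - 1))"
      by (subst prod.cl_ivl_Suc) simp
    also have "\<dots> = 2 * (real n + 1) / (real n + 2) * ((real n + 2)\<^sup>2 / ((real n + 1) * (real n + 3)))"
      unfolding Suc.IH by (simp add: power2_eq_square algebra_simps)
    also have "\<dots> = 2 * (real n + 2) / (real n + 3)"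
    proof -
      have cancel: "2 * a / b * (b\<^sup>2 / (a * c)) = 2 * b / c" if "a > 0" "b > 0" "c > 0" for a b c :: real
        using that by (simp add: field_simps power2_eq_square)
      show ?thesis by (rule cancel) simp_all
    qed
    also have "\<dots> = 2 * (real (Suc n) + 1) / (real (Suc n) + 2)" by (simp add: algebra_simps)
    finally show ?case .
  qed simp
  have "(\<Prod>k\<in>A. (real k)\<^sup>2 / ((real k)\<^sup>2 - 1)) \<le> (\<Prod>k=2..Suc n. (real k)\<^sup>2 / ((real k)\<^sup>2 - 1))"
  proof (rule prod_mono2)
    show "A \<subseteq> {2..Suc n}"
    proof
      fix k assume k: "k \<in> A"
      then have "k \<le> \<Sum>A" using assms(1) by (intro member_le_sum) auto
      then show "k \<in> {2..Suc n}" using assms(2) [OF k] by (simp add: n_def)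
    qed
    show "1 \<le> (real k)\<^sup>2 / ((real k)\<^sup>2 - 1)" if "k \<in> {2..Suc n} - A" for k using that by (intro ge1) simp
    show "0 \<le> (real k)\<^sup>2 / ((real k)\<^sup>2 - 1)" if "k \<in> A" for k
      using ge1 [OF assms(2) [OF that]] by linarith
  qed simp
  also have "\<dots> = 2 * (real n + 1) / (real n + 2)" by (rule tel)
  also have "\<dots> \<le> 2" by (simp add: divide_le_eq)
  finally show ?thesis .
qed

text \<open>Each Euler factor 1 / (1 - 1/r) is (1 + 1/r) r^2 / (r^2 - 1). The second factors have
  product at most 2, and the first expand into reciprocals of squarefree divisors. A divisor sum can
  be interchanged with a sum over \<open>d\<close>, unlike the totient.\<close>

lemma ratio_totient_le_sum_divisors:
  fixes d :: nat
  assumes d: "d \<ge> 1"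
  shows "real d / real (totient d) \<le> 2 * (\<Sum>e | e dvd d. 1 / real e)"
proof -
  define W where "W = prime_factors d"
  have finW: "finite W" by (simp add: W_def)
  have W: "prime r" "r dvd d" "r \<ge> 2" if "r \<in> W" for r
    using that prime_ge_2_nat [of r] by (auto simp: W_def in_prime_factors_iff)
  have findiv: "finite {e. e dvd d}" using d by (intro finite_divisors_nat) simp
  have "real (totient d) = real d * (\<Prod>r\<in>W. 1 - 1 / real r)" unfolding W_def by (rule totient_formula2)
  then have "real d / real (totient d) = 1 / (\<Prod>r\<in>W. 1 - 1 / real r)" using d by simp
  also have "\<dots> = (\<Prod>r\<in>W. 1 / (1 - 1 / real r))" by (simp only: prod_dividef prod.neutral_const)
  also have "\<dots> = (\<Prod>r\<in>W. (real r)\<^sup>2 / ((real r)\<^sup>2 - 1) * (1 / real r + 1))"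
  proof (rule prod.cong [OF refl])
    fix r assume "r \<in> W"
    then have r: "real r \<ge> 2" using W(3) by fastforce
    have fr: "1 / (1 - 1 / x) = x\<^sup>2 / ((x - 1) * (x + 1)) * (1 / x + 1)" if "x \<ge> 2" for x :: real
    proof -
      have "x\<^sup>2 / ((x - 1) * (x + 1)) * (1 / x + 1) = x\<^sup>2 / ((x - 1) * (x + 1)) * ((x + 1) / x)"
        using that by (simp add: field_simps)
      also have "\<dots> = x / (x - 1)" using that by (simp add: power2_eq_square)
      also have "\<dots> = 1 / (1 - 1 / x)" using that by (simp add: field_simps)
      finally show ?thesis by simp
    qed
    have "(real r)\<^sup>2 - 1 = (real r - 1) * (real r + 1)" by (simp add: power2_eq_square algebra_simps)
    then show "1 / (1 - 1 / real r) = (real r)\<^sup>2 / ((real r)\<^sup>2 - 1) * (1 / real r + 1)"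
      using fr [OF r] by simp
  qed
  also have "\<dots> = (\<Prod>r\<in>W. (real r)\<^sup>2 / ((real r)\<^sup>2 - 1)) * (\<Prod>r\<in>W. 1 / real r + 1)"
    by (rule prod.distrib)
  also have "\<dots> \<le> 2 * (\<Sum>e | e dvd d. 1 / real e)"
  proof (rule mult_mono)
    show "(\<Prod>r\<in>W. (real r)\<^sup>2 / ((real r)\<^sup>2 - 1)) \<le> 2" by (intro prod_square_ratio_le finW W(3))
    show "0 \<le> (\<Prod>r\<in>W. 1 / real r + 1)" by (intro prod_nonneg) simp
    have "(\<Prod>r\<in>W. 1 / real r + 1) = (\<Sum>S\<in>Pow W. \<Prod>r\<in>S. 1 / real r)"
      using prod_add [OF finW, of "\<lambda>r. 1 / real r" "\<lambda>_. 1"] by simp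
    also have "\<dots> = (\<Sum>S\<in>Pow W. 1 / real (\<Prod>S))"
      by (intro sum.cong refl) (simp add: prod_dividef)
    also have "\<dots> = (\<Sum>e\<in>(\<lambda>S. \<Prod>S) ` Pow W. 1 / real e)"
    proof -
      have "inj_on (\<lambda>S. \<Prod>S) (Pow W)"
      proof (rule inj_onI)
        fix S T assume S: "S \<in> Pow W" and T: "T \<in> Pow W" and eq: "\<Prod>S = \<Prod>T"
        have "prime_factors (\<Prod>S) = S" using S finW finite_subset W(1) by (intro prime_factors_prod_primes) auto
        moreover have "prime_factors (\<Prod>T) = T" using T finW finite_subset W(1) by (intro prime_factors_prod_primes) auto
        ultimately show "S = T" using eq by metis
      qed
      then show ?thesis by (simp add: sum.reindex)
    qed
    also have "\<dots> \<le> (\<Sum>e | e dvd d. 1 / real e)"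
    proof (rule sum_mono2 [OF findiv])
      show "(\<lambda>S. \<Prod>S) ` Pow W \<subseteq> {e. e dvd d}"
      proof clarify
        fix S assume "S \<subseteq> W"
        then show "\<Prod>S dvd d" using finW finite_subset W by (intro prod_primes_dvd) auto
      qed
    qed simp
    finally show "(\<Prod>r\<in>W. 1 / real r + 1) \<le> (\<Sum>e | e dvd d. 1 / real e)" .
  qed simp
  finally show ?thesis .
qed

lemma divisor_weight_nonneg: "(\<And>q. q \<in> Q \<Longrightarrow> q \<ge> 3) \<Longrightarrow> 0 \<le> divisor_weight Q d"
  unfolding divisor_weight_def by (intro prod_nonneg) fastforce

text \<open>An additional factor can only replace q - 3/2 by q / 2, which is no larger since
  \<open>q \<ge> 3\<close>.\<close>

lemma divisor_weight_mult_le: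
  assumes "\<And>q. q \<in> Q \<Longrightarrow> q \<ge> 3"
  shows "divisor_weight Q (e * d) \<le> divisor_weight Q d"
  unfolding divisor_weight_def
proof (intro prod_mono conjI)
  fix q assume "q \<in> Q"
  then have q: "real q \<ge> 3" using assms by fastforce
  show "0 \<le> (if q dvd e * d then real q / 2 else real q - 3 / 2)" using q by simp
  show "(if q dvd e * d then real q / 2 else real q - 3 / 2) \<le> (if q dvd d then real q / 2 else real q - 3 / 2)"
    using q by auto
qed

text \<open>The weight has period \<Prod>Q, the product on the right is its sum over one period, and
  \<open>Z div M + 1\<close> periods cover the range.\<close>

lemma sum_divisor_weight_le:
  assumes Q: "finite Q" "\<And>q. q \<in> Q \<Longrightarrow> prime q" "\<And>q. q \<in> Q \<Longrightarrow> q \<ge> 3"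
  shows "(\<Sum>d=1..Z. divisor_weight Q d) \<le> (real Z / real (\<Prod>Q) + 1) * (\<Prod>q\<in>Q. (real q)\<^sup>2 - 2 * real q + 3 / 2)"
proof -
  define M where "M = \<Prod>Q"
  define V where "V = (\<Prod>q\<in>Q. (real q)\<^sup>2 - 2 * real q + 3 / 2)"
  have M0: "M > 0" unfolding M_def using Q(2) prime_gt_0_nat by (intro prod_pos) auto
  have period: "(\<Sum>d<M. divisor_weight Q d) = V"
  proof -
    have "(\<Sum>d<M. divisor_weight Q d) = (\<Prod>q\<in>Q. \<Sum>d<q. if q dvd d then real q / 2 else real q - 3 / 2)"
      unfolding divisor_weight_def M_def using Q by (intro sum_prod_periodic) (auto simp: dvd_mod_iff)
    also have "\<dots> = V" unfolding V_def
    proof (rule prod.cong [OF refl])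
      fix q assume "q \<in> Q"
      then have q: "q \<ge> 3" using Q(3) by blast
      \<comment> \<open>One residue contributes q / 2 and the other q - 1 contribute q - 3/2
        each.\<close>
      have "(\<Sum>d<q. if q dvd d then real q / 2 else real q - 3 / 2)
          = (\<Sum>d<q. (real q - 3 / 2) + (if d = 0 then real q / 2 - (real q - 3 / 2) else 0))"
        by (rule sum.cong) (auto dest: dvd_imp_le)
      also have "\<dots> = (real q)\<^sup>2 - 2 * real q + 3 / 2"
        unfolding sum.distrib using q by (simp add: power2_eq_square algebra_simps)
      finally show "(\<Sum>d<q. if q dvd d then real q / 2 else real q - 3 / 2) = (real q)\<^sup>2 - 2 * real q + 3 / 2" .
    qed
    finally show ?thesis .
  qed
  have shift: "divisor_weight Q (m * M + d) = divisor_weight Q d" for m d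
    unfolding divisor_weight_def
  proof (rule prod.cong [OF refl])
    fix q assume q: "q \<in> Q"
    have "q dvd m * M" unfolding M_def using Q(1) q by (intro dvd_mult dvd_prodI)
    then have "q dvd m * M + d \<longleftrightarrow> q dvd d" by (rule dvd_add_right_iff)
    then show "(if q dvd m * M + d then real q / 2 else real q - 3 / 2) = (if q dvd d then real q / 2 else real q - 3 / 2)"
      by simp
  qed
  have blocks: "(\<Sum>d<j * M. divisor_weight Q d) = real j * V" for j
  proof -
    have "(\<Sum>d<j * M. divisor_weight Q d) = (\<Sum>m<j. \<Sum>d\<in>{m * M..<m * M + M}. divisor_weight Q d)"
      by (rule sum.nat_group [symmetric])
    also have "\<dots> = (\<Sum>m<j. V)"
    proof (rule sum.cong [OF refl])
      fix m
      have "(\<Sum>d\<in>{m * M..<m * M + M}. divisor_weight Q d) = (\<Sum>d<M. divisor_weight Q (m * M + d))"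
        by (rule sum.reindex_bij_witness [of _ "\<lambda>d. m * M + d" "\<lambda>d. d - m * M"]) auto
      also have "\<dots> = V" unfolding shift by (rule period)
      finally show "(\<Sum>d\<in>{m * M..<m * M + M}. divisor_weight Q d) = V" .
    qed
    finally show ?thesis by simp
  qed
  have V0: "V \<ge> 0" unfolding period [symmetric] using Q(3) by (intro sum_nonneg divisor_weight_nonneg)
  have "(\<Sum>d=1..Z. divisor_weight Q d) \<le> (\<Sum>d<(Z div M + 1) * M. divisor_weight Q d)"
  proof (rule sum_mono2)
    have "Z < (Z div M + 1) * M" using M0 dividend_less_div_times [of M Z] by (simp add: algebra_simps)
    then show "{1..Z} \<subseteq> {..<(Z div M + 1) * M}" by auto
  qed (use Q(3) in \<open>auto intro: divisor_weight_nonneg\<close>)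
  also have "\<dots> = real (Z div M + 1) * V" by (rule blocks)
  also have "\<dots> \<le> (real Z / real M + 1) * V"
  proof (rule mult_right_mono [OF _ V0])
    have "real (Z div M) \<le> real Z / real M"
      using M0 by (subst pos_le_divide_eq) (simp_all flip: of_nat_mult)
    then show "real (Z div M + 1) \<le> real Z / real M + 1" by simp
  qed
  finally show ?thesis by (simp only: M_def V_def)
qed

lemma harm_le_two_sqrt: "(harm n :: real) \<le> 2 * sqrt (real n)"
proof (induction n)
  case 0
  then show ?case by (simp add: harm_def)
next
  case (Suc n)
  define a where "a = sqrt (real n)"
  define b where "b = sqrt (real (Suc n))"
  have ab: "0 \<le> a" "a \<le> b" "b \<ge> 1" "b * b = a * a + 1" by (simp_all add: a_def b_def)
  have "(b - a) * (b + a) = 1" using ab by (simp add: algebra_simps)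
  moreover have "(b - a) * (b + a) \<le> (b - a) * (2 * b)" using ab by (intro mult_left_mono) auto
  ultimately have "1 / b \<le> 2 * (b - a)" using ab by (simp add: field_simps)
  moreover have "1 / (b * b) \<le> 1 / b"
  proof (rule divide_left_mono)
    show "b \<le> b * b" using mult_left_mono [of 1 b b] ab by simp
    have "b > 0" using ab by linarith
    then show "0 < b * b * b" by (intro mult_pos_pos)
  qed simp
  moreover have "inverse (real (Suc n)) = 1 / (b * b)" by (simp add: b_def inverse_eq_divide)
  ultimately have "inverse (real (Suc n)) \<le> 2 * (b - a)" by linarith
  then show ?case using Suc by (simp add: harm_Suc a_def b_def)
qed

text \<open>After \<open>d / totient d\<close> is replaced by a divisor sum and
  \<open>d = e * d'\<close> is substituted, the weight of \<open>e * d'\<close> is at most that of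
  \<open>d'\<close>. The sum of 1 / e^2 is at most 2, and 4 M^2 \<le> Y makes the harmonic term at
  most Y / M; so 6 = 2 (2 + 1).\<close>

lemma sum_divisor_weight_ratio_le:
  assumes Q: "finite Q" "\<And>q. q \<in> Q \<Longrightarrow> prime q" "\<And>q. q \<in> Q \<Longrightarrow> q \<ge> 3"
    and Y: "4 * (\<Prod>Q)\<^sup>2 \<le> Y"
  shows "(\<Sum>d=1..Y. divisor_weight Q d * (real d / real (totient d)))
    \<le> 6 * real Y / real (\<Prod>Q) * (\<Prod>q\<in>Q. (real q)\<^sup>2 - 2 * real q + 3 / 2)"
proof -
  define M where "M = \<Prod>Q"
  define V where "V = (\<Prod>q\<in>Q. (real q)\<^sup>2 - 2 * real q + 3 / 2)"
  let ?W = "divisor_weight Q"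
  have M0: "M > 0" unfolding M_def using Q(2) prime_gt_0_nat by (intro prod_pos) auto
  have W0: "?W d \<ge> 0" for d using Q(3) by (rule divisor_weight_nonneg)
  have V0: "V \<ge> 0" unfolding V_def
  proof (intro prod_nonneg)
    fix q assume "q \<in> Q"
    have "(real q)\<^sup>2 - 2 * real q + 3 / 2 = (real q - 1)\<^sup>2 + 1 / 2" by (simp add: power2_eq_square algebra_simps)
    then show "0 \<le> (real q)\<^sup>2 - 2 * real q + 3 / 2" by simp
  qed
  have "(\<Sum>d=1..Y. ?W d * (real d / real (totient d))) \<le> (\<Sum>d=1..Y. ?W d * (2 * (\<Sum>e | e dvd d. 1 / real e)))"
    using W0 by (intro sum_mono mult_left_mono ratio_totient_le_sum_divisors) auto
  also have "\<dots> = (\<Sum>d=1..Y. 2 * (\<Sum>e=1..Y. if e dvd d then ?W d / real e else 0))"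
  proof (rule sum.cong [OF refl])
    fix d assume d: "d \<in> {1..Y}"
    have "{e. e dvd d} = {1..Y} \<inter> {e. e dvd d}"
    proof
      show "{e. e dvd d} \<subseteq> {1..Y} \<inter> {e. e dvd d}"
      proof
        fix e assume "e \<in> {e. e dvd d}"
        then have e: "e dvd d" by simp
        then have "e \<le> d" using d by (intro dvd_imp_le) auto
        moreover have "e > 0" using e d by (intro Nat.gr0I) auto
        ultimately show "e \<in> {1..Y} \<inter> {e. e dvd d}" using d e by simp
      qed
    qed blast
    then have "(\<Sum>e | e dvd d. 1 / real e) = (\<Sum>e\<in>{1..Y} \<inter> {e. e dvd d}. 1 / real e)" by simp
    also have "\<dots> = (\<Sum>e=1..Y. if e dvd d then 1 / real e else 0)"
      by (simp only: sum.inter_restrict [OF finite_atLeastAtMost] mem_Collect_eq)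
    finally have eq: "(\<Sum>e | e dvd d. 1 / real e) = (\<Sum>e=1..Y. if e dvd d then 1 / real e else 0)" .
    have "(\<Sum>e=1..Y. if e dvd d then ?W d / real e else 0) = ?W d * (\<Sum>e=1..Y. if e dvd d then 1 / real e else 0)"
      unfolding sum_distrib_left by (intro sum.cong refl) simp
    then show "?W d * (2 * (\<Sum>e | e dvd d. 1 / real e)) = 2 * (\<Sum>e=1..Y. if e dvd d then ?W d / real e else 0)"
      unfolding eq by simp
  qed
  also have "\<dots> = 2 * (\<Sum>d=1..Y. \<Sum>e=1..Y. if e dvd d then ?W d / real e else 0)"
    by (rule sum_distrib_left [symmetric])
  also have "(\<Sum>d=1..Y. \<Sum>e=1..Y. if e dvd d then ?W d / real e else 0)
      = (\<Sum>e=1..Y. \<Sum>d=1..Y. if e dvd d then ?W d / real e else 0)"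
    by (rule sum.swap)
  also have "\<dots> \<le> (\<Sum>e=1..Y. V / real M * real Y * (1 / (real e)\<^sup>2) + V * (1 / real e))"
  proof (rule sum_mono)
    fix e assume "e \<in> {1..Y}"
    then have e: "e \<ge> 1" by simp
    have "(\<Sum>d=1..Y. if e dvd d then ?W d / real e else 0) = (\<Sum>d\<in>{1..Y} \<inter> {d. e dvd d}. ?W d / real e)"
      by (simp only: sum.inter_restrict [OF finite_atLeastAtMost] mem_Collect_eq)
    also have "{1..Y} \<inter> {d. e dvd d} = (\<lambda>d. e * d) ` {1..Y div e}"
    proof
      show "{1..Y} \<inter> {d. e dvd d} \<subseteq> (\<lambda>d. e * d) ` {1..Y div e}"
      proof
        fix x assume "x \<in> {1..Y} \<inter> {d. e dvd d}"
        then obtain c where c: "x = e * c" "1 \<le> x" "x \<le> Y" by (auto elim: dvdE)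
        have "c \<ge> 1" using c by (cases c) auto
        moreover have "c \<le> Y div e" using c e by (simp add: less_eq_div_iff_mult_less_eq mult.commute)
        ultimately show "x \<in> (\<lambda>d. e * d) ` {1..Y div e}" using c(1) by auto
      qed
      show "(\<lambda>d. e * d) ` {1..Y div e} \<subseteq> {1..Y} \<inter> {d. e dvd d}"
      proof clarify
        fix c assume "c \<in> {1..Y div e}"
        then have c: "c \<ge> 1" "c \<le> Y div e" by simp_all
        have "e * c \<le> Y" using c e by (simp add: less_eq_div_iff_mult_less_eq mult.commute)
        then show "e * c \<in> {1..Y} \<inter> {d. e dvd d}" using c e by simp
      qed
    qed
    also have "(\<Sum>d\<in>(\<lambda>d. e * d) ` {1..Y div e}. ?W d / real e) = (\<Sum>d=1..Y div e. ?W (e * d) / real e)"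
      using e by (subst sum.reindex) (auto simp: inj_on_def)
    also have "\<dots> \<le> (\<Sum>d=1..Y div e. ?W d / real e)"
      using Q(3) by (intro sum_mono divide_right_mono divisor_weight_mult_le) auto
    also have "\<dots> = (\<Sum>d=1..Y div e. ?W d) * (1 / real e)"
      unfolding sum_distrib_right by simp
    also have "\<dots> \<le> ((real (Y div e) / real M + 1) * V) * (1 / real e)"
      unfolding M_def V_def using Q by (intro mult_right_mono sum_divisor_weight_le) auto
    also have "\<dots> \<le> ((real Y / real e / real M + 1) * V) * (1 / real e)"
    proof -
      have "real (Y div e) \<le> real Y / real e"
        using e by (subst pos_le_divide_eq) (simp_all flip: of_nat_mult)
      then show ?thesis using V0 by (intro mult_right_mono add_right_mono divide_right_mono) auto
    qed
    also have "\<dots> = V / real M * real Y * (1 / (real e)\<^sup>2) + V * (1 / real e)"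
      by (simp add: algebra_simps power2_eq_square)
    finally show "(\<Sum>d=1..Y. if e dvd d then ?W d / real e else 0)
        \<le> V / real M * real Y * (1 / (real e)\<^sup>2) + V * (1 / real e)" .
  qed
  also have "\<dots> = V / real M * real Y * (\<Sum>e=1..Y. 1 / (real e)\<^sup>2) + V * harm Y"
    by (simp only: sum.distrib sum_distrib_left harm_def inverse_eq_divide)
  also have "\<dots> \<le> V / real M * real Y * 2 + V * (real Y / real M)"
  proof (intro add_mono mult_left_mono)
    have "(\<Sum>e=1..Y. 1 / (real e)\<^sup>2) \<le> (\<Sum>e\<in>insert 1 {2..Y}. 1 / (real e)\<^sup>2)"
      by (intro sum_mono2) auto
    also have "\<dots> = 1 + (\<Sum>e=2..Y. 1 / (real e)\<^sup>2)" by (subst sum.insert) auto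
    also have "(\<Sum>e=2..Y. 1 / (real e)\<^sup>2) \<le> (\<Sum>e=2..Y. 1 / (real e * (real e - 1)))"
    proof (rule sum_mono)
      fix e assume "e \<in> {2..Y}"
      then have "real e \<ge> 2" by simp
      then show "1 / (real e)\<^sup>2 \<le> 1 / (real e * (real e - 1))"
        unfolding power2_eq_square by (intro divide_left_mono mult_left_mono mult_pos_pos) auto
    qed
    also have "\<dots> \<le> 1" by (rule sum_inverse_pronic_le) auto
    finally show "(\<Sum>e=1..Y. 1 / (real e)\<^sup>2) \<le> 2" by simp
    have "real (4 * M\<^sup>2) \<le> real Y" using Y unfolding M_def by (rule of_nat_mono)
    then have "2 * real M \<le> sqrt (real Y)"
      by (intro real_le_rsqrt) (simp add: power_mult_distrib)
    then have "2 * real M * sqrt (real Y) \<le> sqrt (real Y) * sqrt (real Y)" by (intro mult_right_mono) auto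
    then have "2 * sqrt (real Y) \<le> real Y / real M" using M0 by (simp add: field_simps)
    then show "harm Y \<le> real Y / real M" using harm_le_two_sqrt [of Y] by linarith
  qed (use V0 in auto)
  also have "\<dots> = 3 * real Y / real M * V" by simp
  finally have "(\<Sum>d=1..Y. ?W d * (real d / real (totient d))) \<le> 6 * real Y / real M * V" by simp
  then show ?thesis by (simp only: M_def V_def)
qed

text \<open>Each factor is 1 - 1/q + 1 / (2 q (q - 1)). The loss 1/q is made up of two halves, one
  for \<open>d\<close> and one for its cofactor: each is divisible by \<open>q\<close> with
  frequency about 1/q and then weighted by 1/2.\<close>

lemma weight_product_le_exp:
  assumes Q: "finite Q" "\<And>q. q \<in> Q \<Longrightarrow> prime q"
  shows "(\<Prod>q\<in>Q. (real q)\<^sup>2 - 2 * real q + 3 / 2) / (real (\<Prod>Q) * real (totient (\<Prod>Q)))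
    \<le> exp (1 / 2 - (\<Sum>q\<in>Q. 1 / real q))"
proof -
  have q1: "real q > 1" if "q \<in> Q" for q using Q(2) [OF that] prime_gt_1_nat by simp
  define h where "h q = - (1 / real q) + 1 / (real q * (real q - 1)) / 2" for q :: nat
  have tot: "real (totient (\<Prod>Q)) = (\<Prod>q\<in>Q. real q - 1)" using Q by (rule totient_prod_primes)
  have "(\<Prod>q\<in>Q. (real q)\<^sup>2 - 2 * real q + 3 / 2) / (real (\<Prod>Q) * real (totient (\<Prod>Q)))
      = (\<Prod>q\<in>Q. ((real q)\<^sup>2 - 2 * real q + 3 / 2) / (real q * (real q - 1)))"
    unfolding tot of_nat_prod by (simp only: prod_dividef prod.distrib)
  also have "\<dots> \<le> (\<Prod>q\<in>Q. exp (h q))"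
  proof (intro prod_mono conjI)
    fix q assume q: "q \<in> Q"
    have alg: "(x\<^sup>2 - 2 * x + 3 / 2) / (x * (x - 1)) = 1 + (- (1 / x) + 1 / (x * (x - 1)) / 2)" if "x > 1" for x :: real
    proof -
      have nz: "x \<noteq> 0" "x - 1 \<noteq> 0" using that by auto
      have "1 / x = (x - 1) / (x * (x - 1))" using nz by simp
      moreover have "1 = x * (x - 1) / (x * (x - 1))" using nz by simp
      ultimately have "1 + (- (1 / x) + 1 / (x * (x - 1)) / 2)
          = (x * (x - 1) - (x - 1) + 1 / 2) / (x * (x - 1))"
        by (simp add: add_divide_distrib diff_divide_distrib)
      also have "x * (x - 1) - (x - 1) + 1 / 2 = x\<^sup>2 - 2 * x + 3 / 2"
        by (simp add: power2_eq_square algebra_simps)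
      finally show ?thesis by simp
    qed
    have "(real q)\<^sup>2 - 2 * real q + 3 / 2 = (real q - 1)\<^sup>2 + 1 / 2" by (simp add: power2_eq_square algebra_simps)
    then show "0 \<le> ((real q)\<^sup>2 - 2 * real q + 3 / 2) / (real q * (real q - 1))"
      using q1 [OF q] by simp
    show "((real q)\<^sup>2 - 2 * real q + 3 / 2) / (real q * (real q - 1)) \<le> exp (h q)"
      unfolding alg [OF q1 [OF q]] h_def by (rule exp_ge_add_one_self)
  qed
  also have "\<dots> = exp (\<Sum>q\<in>Q. h q)" using Q(1) by (simp add: exp_sum)
  also have "(\<Sum>q\<in>Q. h q) = (\<Sum>q\<in>Q. 1 / (real q * (real q - 1))) / 2 - (\<Sum>q\<in>Q. 1 / real q)"
    unfolding h_def sum.distrib sum_negf sum_divide_distrib by simp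
  also have "exp \<dots> \<le> exp (1 / 2 - (\<Sum>q\<in>Q. 1 / real q))"
    using sum_inverse_pronic_le [OF Q(1)] Q(2) prime_ge_2_nat by simp
  finally show ?thesis .
qed

text \<open>Markov's inequality with 2^(t - omega), which is at least 1 on the set counted, and a
  union bound over \<open>d\<close>. In the application \<open>Y / X\<close> is bounded, so the
  union bound costs only a constant. The factor 246 is 41 * 6.\<close>

lemma card_shifted_primes_with_divisor:
  fixes Q :: "nat set" and s :: int and N Y :: nat and X t :: real
  assumes Q: "finite Q" "\<And>q. q \<in> Q \<Longrightarrow> prime q" "\<And>q. q \<in> Q \<Longrightarrow> q \<ge> 3"
    and s: "s = 1 \<or> s = -1" and N: "N \<ge> 2" and X: "X > 0" and Y: "4 * (\<Prod>Q)\<^sup>2 \<le> Y"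
    and YQ: "real (Y * \<Prod>Q) \<le> real N powr (3/5)"
    and BT: "\<forall>q a. 1 \<le> q \<longrightarrow> real q \<le> real N powr (3/5) \<longrightarrow>
     real (card {p. prime p \<and> p \<le> N \<and> [int p = a] (mod int q)})
       \<le> 41 * real N / (real (totient q) * ln (real N))"
  shows "real (card {p. prime p \<and> p \<le> N \<and> p \<notin> Q \<and> (\<exists>d. X < real d \<and> d \<le> Y \<and> int d dvd int p - s)
      \<and> real (omega_in Q (int p - s)) \<le> t})
    \<le> real N / ln (real N) * (246 * (real Y / X) * exp (t * ln 2 + 1 / 2 - (\<Sum>q\<in>Q. 1 / real q)))"
proof -
  define A where "A = {p. prime p \<and> p \<le> N \<and> p \<notin> Q \<and> (\<exists>d. X < real d \<and> d \<le> Y \<and> int d dvd int p - s)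
      \<and> real (omega_in Q (int p - s)) \<le> t}"
  define S where "S d = {p. prime p \<and> p \<le> N \<and> p \<notin> Q \<and> int d dvd int p - s}" for d
  define D where "D = {d. X < real d \<and> d \<le> Y}"
  define g where "g p = (1 / 2 :: real) ^ omega_in Q (int p - s)" for p :: nat
  define M where "M = \<Prod>Q"
  define V where "V = (\<Prod>q\<in>Q. (real q)\<^sup>2 - 2 * real q + 3 / 2)"
  let ?W = "divisor_weight Q"
  have finA: "finite A" unfolding A_def by (rule finite_subset [of _ "{..N}"]) auto
  have finS: "finite (S d)" for d unfolding S_def by (rule finite_subset [of _ "{..N}"]) auto
  have finD: "finite D" unfolding D_def by (rule finite_subset [of _ "{..Y}"]) auto
  have D1: "d \<ge> 1" if "d \<in> D" for d using that X by (cases d) (auto simp: D_def)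
  have M0: "M > 0" unfolding M_def using Q(2) prime_gt_0_nat by (intro prod_pos) auto
  have lnN: "ln (real N) > 0" using N by simp
  have g0: "g p \<ge> 0" for p by (simp add: g_def)
  have W0: "?W d \<ge> 0" for d using Q(3) by (rule divisor_weight_nonneg)
  have one: "1 \<le> exp (t * ln 2) * g p" if p: "p \<in> A" for p
  proof -
    have "g p = exp (- (real (omega_in Q (int p - s)) * ln 2))"
      by (simp add: g_def exp_minus exp_of_nat_mult power_inverse inverse_eq_divide power_one_over)
    then have "exp (t * ln 2) * g p = exp ((t - real (omega_in Q (int p - s))) * ln 2)"
      by (simp add: algebra_simps flip: exp_add)
    also have "\<dots> \<ge> 1" using p by (simp add: A_def)
    finally show ?thesis .
  qed
  have "real (card A) = (\<Sum>p\<in>A. 1)" by simp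
  also have "\<dots> \<le> (\<Sum>p\<in>A. \<Sum>d\<in>D. if p \<in> S d then exp (t * ln 2) * g p else 0)"
  proof (rule sum_mono)
    fix p assume p: "p \<in> A"
    then obtain d where d: "d \<in> D" "p \<in> S d" unfolding A_def D_def S_def by blast
    have "(if p \<in> S d then exp (t * ln 2) * g p else 0) \<le> (\<Sum>d\<in>D. if p \<in> S d then exp (t * ln 2) * g p else 0)"
      using d(1) finD g0 by (intro member_le_sum) auto
    then show "1 \<le> (\<Sum>d\<in>D. if p \<in> S d then exp (t * ln 2) * g p else 0)"
      using d(2) one [OF p] by simp
  qed
  also have "\<dots> = (\<Sum>d\<in>D. \<Sum>p\<in>A. if p \<in> S d then exp (t * ln 2) * g p else 0)"
    by (rule sum.swap)
  also have "\<dots> = (\<Sum>d\<in>D. \<Sum>p\<in>A \<inter> S d. exp (t * ln 2) * g p)"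
    by (simp only: sum.inter_restrict [OF finA])
  also have "\<dots> \<le> (\<Sum>d\<in>D. \<Sum>p\<in>S d. exp (t * ln 2) * g p)"
    using finS g0 by (intro sum_mono sum_mono2) auto
  also have "\<dots> = exp (t * ln 2) * (\<Sum>d\<in>D. \<Sum>p\<in>S d. g p)" by (simp only: sum_distrib_left)
  also have "\<dots> \<le> exp (t * ln 2) * (\<Sum>d\<in>D. 41 * real N / ln (real N) * (?W d / (real (totient d) * real (totient M))))"
  proof (intro mult_left_mono sum_mono)
    fix d assume d: "d \<in> D"
    have "d * M \<le> Y * M" using d by (simp add: D_def)
    then have "real (d * M) \<le> real (Y * M)" by (rule of_nat_mono)
    then have "real (d * \<Prod>Q) \<le> real N powr (3/5)" using YQ unfolding M_def by linarith
    then show "(\<Sum>p\<in>S d. g p) \<le> 41 * real N / ln (real N) * (?W d / (real (totient d) * real (totient M)))"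
      unfolding S_def g_def M_def
      by (intro sum_half_power_omega_multiples [OF Q(1,2) s D1 [OF d] N _ BT])
  qed simp
  \<comment> \<open>Inserting d / X \<ge> 1 turns 1 / phi(d) into d / phi(d), whose weighted sum is
    already bounded.\<close>
  also have "\<dots> \<le> exp (t * ln 2) * (\<Sum>d\<in>D. 41 * real N / ln (real N) * (?W d * (real d / real (totient d)) / (X * real (totient M))))"
  proof (intro mult_left_mono sum_mono)
    fix d assume d: "d \<in> D"
    have "?W d / (real (totient d) * real (totient M)) = ?W d / (real (totient d) * real (totient M)) * 1" by simp
    also have "\<dots> \<le> ?W d / (real (totient d) * real (totient M)) * (real d / X)"
      using d X W0 by (intro mult_left_mono) (auto simp: D_def)
    also have "\<dots> = ?W d * (real d / real (totient d)) / (X * real (totient M))" by simp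
    finally show "?W d / (real (totient d) * real (totient M)) \<le> ?W d * (real d / real (totient d)) / (X * real (totient M))" .
  qed (use lnN in auto)
  also have "\<dots> = exp (t * ln 2) * (41 * real N / ln (real N)) / (X * real (totient M)) * (\<Sum>d\<in>D. ?W d * (real d / real (totient d)))"
    by (simp add: sum_distrib_left sum_divide_distrib mult_ac)
  also have "\<dots> \<le> exp (t * ln 2) * (41 * real N / ln (real N)) / (X * real (totient M)) * (6 * real Y / real M * V)"
  proof (rule mult_left_mono)
    have "(\<Sum>d\<in>D. ?W d * (real d / real (totient d))) \<le> (\<Sum>d=1..Y. ?W d * (real d / real (totient d)))"
      using W0 D1 by (intro sum_mono2) (auto simp: D_def)
    also have "\<dots> \<le> 6 * real Y / real M * V"
      unfolding M_def V_def by (rule sum_divisor_weight_ratio_le [OF Q Y])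
    finally show "(\<Sum>d\<in>D. ?W d * (real d / real (totient d))) \<le> 6 * real Y / real M * V" .
  qed (use lnN X in auto)
  also have "\<dots> = real N / ln (real N) * (246 * (real Y / X) * exp (t * ln 2)) * (V / (real M * real (totient M)))"
    by (simp add: mult_ac)
  also have "\<dots> \<le> real N / ln (real N) * (246 * (real Y / X) * exp (t * ln 2)) * exp (1 / 2 - (\<Sum>q\<in>Q. 1 / real q))"
    unfolding V_def M_def using lnN X by (intro mult_left_mono weight_product_le_exp Q(1,2)) auto
  also have "\<dots> = real N / ln (real N) * (246 * (real Y / X) * exp (t * ln 2 + 1 / 2 - (\<Sum>q\<in>Q. 1 / real q)))"
    by (simp add: exp_add exp_diff)
  finally show ?thesis unfolding A_def .
qed

text \<open>Markov's inequality with (3/2)^(omega - t).\<close>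

lemma card_shifted_primes_with_many_factors:
  fixes Q :: "nat set" and s :: int and t :: real
  assumes Q: "finite Q" "\<And>q. q \<in> Q \<Longrightarrow> prime q"
  shows "eventually (\<lambda>N. real (card {p. prime p \<and> p \<le> N \<and> t < real (omega_in Q (int p - s))})
    \<le> real N / ln (real N) * (41 * exp ((\<Sum>q\<in>Q. 1 / real q) / 2 + 1 / 2 - t * ln (3 / 2)))) sequentially"
proof -
  have "eventually (\<lambda>N. (\<Sum>p | prime p \<and> p \<le> N. (3/2) ^ omega_in Q (int p - s))
    \<le> 41 * real N / ln (real N) * exp ((\<Sum>q\<in>Q. 1 / real q) / 2 + 1 / 2)) sequentially"
    using Q by (rule sum_three_halves_power_omega)
  then show ?thesis
  proof eventually_elim
    case (elim N)
    let ?L = "\<Sum>q\<in>Q. 1 / real q"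
    define A where "A = {p. prime p \<and> p \<le> N \<and> t < real (omega_in Q (int p - s))}"
    define P where "P = {p. prime p \<and> p \<le> N}"
    have finP: "finite P" unfolding P_def by (rule finite_subset [of _ "{..N}"]) auto
    have "real (card A) * exp (t * ln (3 / 2)) = (\<Sum>p\<in>A. exp (t * ln (3 / 2)))" by simp
    also have "\<dots> \<le> (\<Sum>p\<in>A. (3 / 2) ^ omega_in Q (int p - s))"
    proof (rule sum_mono)
      fix p assume "p \<in> A"
      then have "t * ln (3 / 2) \<le> real (omega_in Q (int p - s)) * ln (3 / 2)"
        unfolding A_def by (intro mult_right_mono) auto
      then have "exp (t * ln (3 / 2)) \<le> exp (real (omega_in Q (int p - s)) * ln (3 / 2))" by simp
      then show "exp (t * ln (3 / 2)) \<le> (3 / 2) ^ omega_in Q (int p - s)" by (simp add: exp_of_nat_mult)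
    qed
    also have "\<dots> \<le> (\<Sum>p\<in>P. (3 / 2) ^ omega_in Q (int p - s))"
      using finP by (intro sum_mono2) (auto simp: A_def P_def)
    also have "\<dots> \<le> 41 * real N / ln (real N) * exp (?L / 2 + 1 / 2)" using elim unfolding P_def .
    finally have "real (card A) \<le> 41 * real N / ln (real N) * exp (?L / 2 + 1 / 2) / exp (t * ln (3 / 2))"
      by (simp only: pos_le_divide_eq exp_gt_zero)
    also have "\<dots> = real N / ln (real N) * (41 * exp (?L / 2 + 1 / 2 - t * ln (3 / 2)))"
      by (simp add: exp_diff)
    finally show ?case unfolding A_def .
  qed
qed

lemma ln_three_halves_ge: "2 / 5 \<le> ln (3 / 2 :: real)"
  using ln_approx_bounds [of "3/2" 1] by simp

subsection \<open>Almost all primes have large rank of apparition\<close>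

text \<open>This is the \<open>k\<close> of the representation lemma: its square exceeds
  \<open>N\<close>, hence every prime up to \<open>N\<close>.\<close>

definition index_bound :: "nat \<Rightarrow> nat" where
  "index_bound N = nat \<lceil>sqrt (real N)\<rceil> + 1"

lemma index_bound: "N < (index_bound N)\<^sup>2" "sqrt (real N) \<le> real (index_bound N)"
  "real (index_bound N) \<le> sqrt (real N) + 2"
proof -
  have k: "sqrt (real N) + 1 \<le> real (index_bound N)" "real (index_bound N) \<le> sqrt (real N) + 2"
    unfolding index_bound_def using real_sqrt_ge_zero [of "real N"] by linarith+
  then show "real (index_bound N) \<le> sqrt (real N) + 2" "sqrt (real N) \<le> real (index_bound N)" by linarith+
  have "real N = (sqrt (real N))\<^sup>2" by simp
  also have "\<dots> < (real (index_bound N))\<^sup>2" using k by (intro power_strict_mono) auto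
  finally show "N < (index_bound N)\<^sup>2" by (simp flip: of_nat_power)
qed

lemma small_rank_negligible:
  fixes \<eta> :: real
  assumes \<eta>: "\<eta> > 0"
  shows "eventually (\<lambda>N. real (card {p. prime p \<and> p \<le> N \<and>
      (p \<le> 5 \<or> (\<exists>d. 0 < d \<and> d \<le> 16 * index_bound N \<and> p dvd fib d))})
    \<le> \<eta> * (real N / ln (real N))) sequentially"
proof -
  \<comment> \<open>Ranks up to \<epsilon> sqrt N then account for at most 2 \<epsilon>^2 N / ln N =
    (\<eta> / 8) N / ln N primes.\<close>
  define \<epsilon> where "\<epsilon> = sqrt (\<eta> / 16)"
  have \<epsilon>: "\<epsilon> > 0" "\<epsilon>\<^sup>2 = \<eta> / 16" using \<eta> by (simp_all add: \<epsilon>_def)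
  \<comment> \<open>The factor 2 counts the two shifts \<open>s\<close>. The 41 comes from shifted
    primes with many factors, and 4920 = 246 * 20 from those with a divisor in the window, where Y /
    X \<le> 20 / \<epsilon>.\<close>
  define C where "C = 2 * (41 + 4920 / \<epsilon>) * exp (1 / 2)"
  have C: "C > 0" using \<epsilon> by (simp add: C_def add_pos_pos)
  \<comment> \<open>\<open>Q\<close> is chosen after \<epsilon>; the lower bound for the reciprocal
    sum is exactly what \<open>small\<close> requires.\<close>
  obtain Q where Q: "finite Q" "\<forall>q\<in>Q. prime q \<and> q \<ge> 3" and L0: "max 0 (30 * ln (4 * C / \<eta>)) \<le> (\<Sum>q\<in>Q. 1 / real (q :: nat))"
    using sum_inverse_primes_unbounded by blast
  have Qp: "prime q" "q \<ge> 3" if "q \<in> Q" for q using Q(2) that by blast+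
  define L where "L = (\<Sum>q\<in>Q. 1 / real q)"
  define M where "M = \<Prod>Q"
  \<comment> \<open>With ln (3/2) \<ge> 2/5 and ln 2 \<le> 25/36 the coefficients of
    \<open>L\<close> in the two exponents are at most 1/2 - 8/15 = -1/30 and 25/27 - 1 =
    -2/27.\<close>
  define t where "t = 4 / 3 * L"
  have L: "L \<ge> 0" "L \<ge> 30 * ln (4 * C / \<eta>)" using L0 by (simp_all add: L_def)
  have small: "C * exp (- L / 30) \<le> \<eta> / 4"
  proof -
    have "exp (ln (4 * C / \<eta>)) \<le> exp (L / 30)" using L by simp
    then have "4 * C / \<eta> \<le> exp (L / 30)" using C \<eta> by simp
    then have "4 * C \<le> \<eta> * exp (L / 30)" using \<eta> by (simp add: field_simps)
    then show ?thesis by (simp add: exp_minus field_simps)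
  qed
  have e1: "exp (L / 2 + 1 / 2 - t * ln (3 / 2)) \<le> exp (1 / 2) * exp (- L / 30)"
  proof -
    have "t * (2 / 5) \<le> t * ln (3 / 2)" using L ln_three_halves_ge by (intro mult_left_mono) (auto simp: t_def)
    then have "L / 2 + 1 / 2 - t * ln (3 / 2) \<le> 1 / 2 + - L / 30" by (simp add: t_def)
    then show ?thesis unfolding exp_add [symmetric] by simp
  qed
  have e2: "exp (t * ln 2 + 1 / 2 - L) \<le> exp (1 / 2) * exp (- L / 30)"
  proof -
    have "t * ln 2 \<le> t * (25 / 36)" using L ln2_le_25_over_36 by (intro mult_left_mono) (auto simp: t_def)
    then have "t * ln 2 + 1 / 2 - L \<le> 1 / 2 + - L / 30" using L by (simp add: t_def)
    then show ?thesis unfolding exp_add [symmetric] by simp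
  qed
  have ev0: "eventually (\<lambda>N::nat. sqrt (real N) + real M + 6 \<le> \<eta> / 4 * (real N / ln (real N))) sequentially"
  proof -
    have "((\<lambda>N::nat. (sqrt (real N) + real M + 6) * ln (real N) / real N) \<longlongrightarrow> 0) sequentially" by real_asymp
    then have "eventually (\<lambda>N::nat. (sqrt (real N) + real M + 6) * ln (real N) / real N < \<eta> / 4) sequentially"
      using \<eta> by (intro order_tendstoD) auto
    then show ?thesis using eventually_ge_at_top [of 2]
    proof eventually_elim
      case (elim N)
      have "real N > 0" "ln (real N) > 0" using elim(2) by auto
      then show ?case using elim(1) by (simp add: field_simps)
    qed
  qed
  have ev1: "eventually (\<lambda>N::nat. 16 * (sqrt (real N) + 2) \<le> 20 * sqrt (real N)) sequentially" by real_asymp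
  have ev2: "eventually (\<lambda>N::nat. real (4 * M\<^sup>2) \<le> sqrt (real N)) sequentially"
  proof -
    have "filterlim (\<lambda>N::nat. sqrt (real N)) at_top sequentially" by real_asymp
    then show ?thesis unfolding filterlim_at_top by blast
  qed
  have ev3: "eventually (\<lambda>N::nat. real M * (20 * sqrt (real N)) \<le> real N powr (3/5)) sequentially"
  proof -
    have "filterlim (\<lambda>N::nat. real N powr (3/5) / (20 * sqrt (real N))) at_top sequentially" by real_asymp
    then have "eventually (\<lambda>N::nat. real M \<le> real N powr (3/5) / (20 * sqrt (real N))) sequentially"
      unfolding filterlim_at_top by blast
    then show ?thesis using eventually_ge_at_top [of 2]
      by eventually_elim (simp add: field_simps)
  qed
  have many: "eventually (\<lambda>N. real (card {p. prime p \<and> p \<le> N \<and> t < real (omega_in Q (int p - s))})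
    \<le> real N / ln (real N) * (41 * exp (L / 2 + 1 / 2 - t * ln (3 / 2)))) sequentially" for s
    unfolding L_def using Q(1) Qp(1) by (rule card_shifted_primes_with_many_factors)
  show ?thesis
    using ev0 ev1 ev2 ev3 many [of 1] many [of "-1"] Brun_Titchmarsh eventually_ge_at_top [of "2 :: nat"]
  proof eventually_elim
    case (elim N)
    define R where "R = real N / ln (real N)"
    define Y where "Y = 16 * index_bound N"
    define X where "X = \<epsilon> * sqrt (real N)"
    define Z where "Z = nat \<lfloor>X\<rfloor>"
    have N: "N \<ge> 2" by (rule elim(8))
    have lnN: "ln (real N) > 0" using N by simp
    have X0: "X > 0" using \<epsilon> N by (simp add: X_def)
    have R0: "R \<ge> 0" using lnN by (simp add: R_def)
    have Yle: "real Y \<le> 20 * sqrt (real N)" using elim(2) index_bound(3) [of N] by (simp add: Y_def)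
    have Yge: "4 * M\<^sup>2 \<le> Y"
    proof -
      have "real (4 * M\<^sup>2) \<le> real Y" using elim(3) index_bound(2) [of N] by (simp add: Y_def)
      then show ?thesis by (simp only: of_nat_le_iff)
    qed
    have YM: "real (Y * M) \<le> real N powr (3/5)"
    proof -
      have "real (Y * M) \<le> real M * (20 * sqrt (real N))"
        using mult_left_mono [OF Yle, of "real M"] by (simp add: mult.commute)
      then show ?thesis using elim(4) by linarith
    qed
    \<comment> \<open>\<open>T0\<close> takes the small primes: those up to sqrt N, those up to 5,
      and those up to \<open>M\<close>, which include all of \<open>Q\<close>. \<open>T1\<close> has
      rank at most \<open>X\<close>, \<open>T2\<close> has atypically many factors in
      \<open>Q\<close>, and \<open>T3\<close> has a divisor in the window but few such
      factors.\<close>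
    define T0 where "T0 = {..nat \<lfloor>sqrt (real N) + real M + 5\<rfloor>}"
    define T1 where "T1 = {p. prime p \<and> sqrt (real N) < real p \<and> (\<exists>d. 0 < d \<and> d \<le> Z \<and> p dvd fib d)}"
    define T2 where "T2 s = {p. prime p \<and> p \<le> N \<and> t < real (omega_in Q (int p - s))}" for s
    define T3 where "T3 s = {p. prime p \<and> p \<le> N \<and> p \<notin> Q \<and> (\<exists>d. X < real d \<and> d \<le> Y \<and> int d dvd int p - s)
      \<and> real (omega_in Q (int p - s)) \<le> t}" for s
    define B where "B = {p. prime p \<and> p \<le> N \<and> (p \<le> 5 \<or> (\<exists>d. 0 < d \<and> d \<le> Y \<and> p dvd fib d))}"
    have c0: "real (card T0) \<le> \<eta> / 4 * R"
    proof -
      have "real (card T0) = real (nat \<lfloor>sqrt (real N) + real M + 5\<rfloor>) + 1" by (simp add: T0_def)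
      also have "\<dots> \<le> sqrt (real N) + real M + 5 + 1"
      proof -
        have "0 \<le> sqrt (real N) + real M + 5" by simp
        then show ?thesis by linarith
      qed
      finally show ?thesis using elim(1) by (simp add: R_def)
    qed
    have c1: "real (card T1) \<le> \<eta> / 8 * R"
    proof -
      have "real (card T1) * ln (real N) \<le> 2 * (real Z)\<^sup>2"
        unfolding T1_def by (rule card_primes_of_small_rank(2) [OF N])
      also have "\<dots> \<le> 2 * X\<^sup>2"
        using X0 by (intro mult_left_mono power_mono) (auto simp: Z_def)
      also have "X\<^sup>2 = \<epsilon>\<^sup>2 * real N" by (simp add: X_def power_mult_distrib)
      finally have "real (card T1) * ln (real N) \<le> \<eta> / 8 * real N" using \<epsilon> by simp
      then show ?thesis using lnN by (simp add: R_def field_simps)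
    qed
    have c2: "real (card (T2 s)) \<le> R * (41 * (exp (1 / 2) * exp (- L / 30)))" if s: "s = 1 \<or> s = -1" for s
    proof -
      have "real (card (T2 s)) \<le> R * (41 * exp (L / 2 + 1 / 2 - t * ln (3 / 2)))"
        unfolding T2_def R_def using elim(5,6) s by blast
      also have "\<dots> \<le> R * (41 * (exp (1 / 2) * exp (- L / 30)))"
        using R0 e1 by (intro mult_left_mono) auto
      finally show ?thesis .
    qed
    have c3: "real (card (T3 s)) \<le> R * (4920 / \<epsilon> * (exp (1 / 2) * exp (- L / 30)))" if s: "s = 1 \<or> s = -1" for s
    proof -
      have "real (card (T3 s)) \<le> R * (246 * (real Y / X) * exp (t * ln 2 + 1 / 2 - L))"
        unfolding T3_def R_def L_def
        using Q(1) Qp s N X0 Yge YM elim(7) unfolding M_def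
        by (intro card_shifted_primes_with_divisor) auto
      also have "\<dots> \<le> R * (246 * (20 / \<epsilon>) * (exp (1 / 2) * exp (- L / 30)))"
      proof (intro mult_left_mono [OF _ R0] mult_mono)
        have "real Y / X \<le> 20 * sqrt (real N) / X" using Yle X0 by (intro divide_right_mono) auto
        also have "\<dots> = 20 / \<epsilon>" using N by (simp add: X_def)
        finally show "real Y / X \<le> 20 / \<epsilon>" .
      qed (use e2 \<epsilon> X0 in \<open>auto simp: less_imp_le\<close>)
      finally show ?thesis by simp
    qed
    have fin: "finite T0" "finite T1" "finite (T2 s)" "finite (T3 s)" for s
      using card_primes_of_small_rank(1) [OF N, of Z]
      by (auto simp: T0_def T1_def T2_def T3_def intro: finite_subset [of _ "{..N}"])
    have sub: "B \<subseteq> T0 \<union> (T1 \<union> (T2 1 \<union> (T3 1 \<union> (T2 (-1) \<union> T3 (-1)))))"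
    proof
      fix p assume p: "p \<in> B"
      have pr: "prime p" "p \<le> N" using p by (auto simp: B_def)
      show "p \<in> T0 \<union> (T1 \<union> (T2 1 \<union> (T3 1 \<union> (T2 (-1) \<union> T3 (-1)))))"
      proof (cases "real p \<le> sqrt (real N) + real M + 5")
        case True
        then have "int p \<le> \<lfloor>sqrt (real N) + real M + 5\<rfloor>" by (subst le_floor_iff) simp
        then have "p \<in> T0" unfolding T0_def by simp
        then show ?thesis by blast
      next
        case False
        have pl: "sqrt (real N) < real p" "p > 5" "p > M"
        proof -
          have "0 \<le> sqrt (real N)" "0 \<le> real M" by simp_all
          then have "sqrt (real N) < real p" "real p > 5" "real p > real M" using False by linarith+
          then show "sqrt (real N) < real p" "p > 5" "p > M" by simp_all
        qed
        have pQ: "p \<notin> Q"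
        proof
          assume "p \<in> Q"
          then have "p dvd M" unfolding M_def using Q(1) by (intro dvd_prodI)
          moreover have "M > 0" unfolding M_def using Qp(1) prime_gt_0_nat by (intro prod_pos) auto
          ultimately have "p \<le> M" by (rule dvd_imp_le)
          then show False using pl(3) by simp
        qed
        \<comment> \<open>The rank of apparition: either it is at most \<open>X\<close>, or it is
          itself a divisor of p - s in the window.\<close>
        define d where "d = (LEAST e. 0 < e \<and> p dvd fib e)"
        obtain d0 where d0: "0 < d0" "d0 \<le> Y" "p dvd fib d0" using p pl(2) unfolding B_def by auto
        have d: "0 < d" "p dvd fib d" unfolding d_def using LeastI [of "\<lambda>e. 0 < e \<and> p dvd fib e" d0] d0 by auto
        have "d \<le> d0" unfolding d_def by (rule Least_le) (use d0 in blast)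
        then have dY: "d \<le> Y" using d0 by linarith
        have least: "\<not> p dvd fib e" if "0 < e" "e < d" for e
          using not_less_Least [of e "\<lambda>e. 0 < e \<and> p dvd fib e"] that unfolding d_def by blast
        show ?thesis
        proof (cases "real d \<le> X")
          case True
          then have "d \<le> Z" unfolding Z_def by (simp add: le_nat_floor)
          then have "p \<in> T1" unfolding T1_def using pr pl d by blast
          then show ?thesis by blast
        next
          case False
          have "d dvd p - 1 \<or> d dvd p + 1"
            using fib_rank_dvd_neighbour [OF pr(1) pl(2) d least] .
          then have "int d dvd int p - 1 \<or> int d dvd int p - (-1)"
          proof
            assume "d dvd p - 1"
            then have "int d dvd int (p - 1)" by (simp only: int_dvd_int_iff)
            then show ?thesis using pl(2) by (simp add: of_nat_diff)
          next
            assume "d dvd p + 1"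
            then have "int d dvd int (p + 1)" by (simp only: int_dvd_int_iff)
            then show ?thesis by (simp add: add.commute)
          qed
          then obtain s :: int where s: "s = 1 \<or> s = -1" "int d dvd int p - s" by blast
          have "p \<in> T2 s \<or> p \<in> T3 s"
            unfolding T2_def T3_def using pr pQ s(2) dY False by (auto simp: not_less not_le)
          then show ?thesis using s(1) by blast
        qed
      qed
    qed
    have un: "real (card (U \<union> U')) \<le> real (card U) + real (card U')" for U U' :: "nat set"
      using card_Un_le [of U U'] by linarith
    have "card B \<le> card (T0 \<union> (T1 \<union> (T2 1 \<union> (T3 1 \<union> (T2 (-1) \<union> T3 (-1))))))"
      using fin by (intro card_mono sub) auto
    then have "real (card B) \<le> real (card (T0 \<union> (T1 \<union> (T2 1 \<union> (T3 1 \<union> (T2 (-1) \<union> T3 (-1)))))))" by simp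
    also have "\<dots> \<le> real (card T0) + (real (card T1) + (real (card (T2 1)) + (real (card (T3 1)) +
        (real (card (T2 (-1))) + real (card (T3 (-1)))))))"
      using un by (meson add_left_mono order_trans)
    also have "\<dots> \<le> \<eta> / 4 * R + (\<eta> / 8 * R + R * (C * exp (- L / 30)))"
    proof -
      have "R * (41 * (exp (1 / 2) * exp (- L / 30))) + (R * (4920 / \<epsilon> * (exp (1 / 2) * exp (- L / 30))) +
          (R * (41 * (exp (1 / 2) * exp (- L / 30))) + R * (4920 / \<epsilon> * (exp (1 / 2) * exp (- L / 30)))))
          = R * (C * exp (- L / 30))"
        by (simp add: C_def algebra_simps)
      then show ?thesis
        using c0 c1 c2 [OF disjI1, OF refl] c2 [OF disjI2, OF refl]
          c3 [OF disjI1, OF refl] c3 [OF disjI2, OF refl] by linarith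
    qed
    also have "\<dots> \<le> \<eta> / 4 * R + (\<eta> / 8 * R + R * (\<eta> / 4))"
      using small R0 by (intro add_left_mono mult_left_mono)
    \<comment> \<open>The shares are 1/4 + 1/8 + 1/4 < 1.\<close>
    also have "\<dots> \<le> \<eta> * R" using R0 \<eta> by simp
    finally show ?case unfolding B_def Y_def R_def .
  qed
qed

section \<open>From few exceptional primes to density one\<close>

theorem theorem3:
  shows "\<exists>\<delta> :: nat \<Rightarrow> real. \<delta> \<longlonglongrightarrow> 0 \<and>
    (\<lambda>N. real (card {p :: nat. prime p \<and> p \<le> N \<and>
        (\<forall>l :: int. \<exists>n :: nat \<Rightarrow> nat.
            (\<forall>i<16. 1 \<le> n i \<and> real (n i) \<le> real N powr (1/2 + \<delta> N)) \<and>
            [(\<Sum>i<16. int (fib (n i))) = l] (mod int p))})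
      / real (card {p :: nat. prime p \<and> p \<le> N})) \<longlonglongrightarrow> 1"
proof (intro exI conjI)
  \<comment> \<open>Chosen so that N^\<delta> = ln N, which eventually absorbs the constant 12 in
    the bound for the indices.\<close>
  define \<delta> where "\<delta> N = ln (ln (real N)) / ln (real N)" for N :: nat
  show "\<delta> \<longlonglongrightarrow> 0" unfolding \<delta>_def by real_asymp
  define good where "good N = {p :: nat. prime p \<and> p \<le> N \<and>
        (\<forall>l :: int. \<exists>n :: nat \<Rightarrow> nat.
            (\<forall>i<16. 1 \<le> n i \<and> real (n i) \<le> real N powr (1/2 + \<delta> N)) \<and>
            [(\<Sum>i<16. int (fib (n i))) = l] (mod int p))}" for N
  define P where "P N = {p :: nat. prime p \<and> p \<le> N}" for N
  define bad where "bad N = {p. prime p \<and> p \<le> N \<and>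
      (p \<le> 5 \<or> (\<exists>d. 0 < d \<and> d \<le> 16 * index_bound N \<and> p dvd fib d))}" for N
  have finP: "finite (P N)" for N unfolding P_def by (rule finite_subset [of _ "{..N}"]) auto
  have ev: "eventually (\<lambda>N::nat. 12 * (sqrt (real N) + 2) \<le> sqrt (real N) * ln (real N)) sequentially"
    by real_asymp
  have "(\<lambda>N. real (card (good N)) / real (card (P N))) \<longlonglongrightarrow> 1"
  proof (rule tendstoI)
    fix e :: real assume e: "e > 0"
    \<comment> \<open>Chebyshev gives N / ln N \<le> 2 pi(N), so a share e / 4 of N / ln N is at
      most e / 2 of all primes, strictly below \<open>e\<close>.\<close>
    then have "e / 4 > 0" by simp
    from small_rank_negligible [OF this] ev Chebyshev_lower_bound eventually_ge_at_top [of "3 :: nat"]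
    show "eventually (\<lambda>N. dist (real (card (good N)) / real (card (P N))) 1 < e) sequentially"
    proof eventually_elim
      case (elim N)
      have N1: "real N > 1" "ln (real N) > 0" using elim(4) by simp_all
      have bad: "real (card (bad N)) \<le> e / 4 * (real N / ln (real N))" using elim(1) unfolding bad_def .
      have pi: "real N / ln (real N) \<le> 2 * real (card (P N))"
        using elim(3) by (simp add: P_def field_simps)
      have Npos: "real N / ln (real N) > 0" using N1 by simp
      have P0: "real (card (P N)) > 0" using pi Npos by linarith
      have power: "real N powr (1/2 + \<delta> N) = sqrt (real N) * ln (real N)"
      proof -
        have "real N powr \<delta> N = exp (\<delta> N * ln (real N))" using N1 by (simp add: powr_def)
        also have "\<delta> N * ln (real N) = ln (ln (real N))" using N1 by (simp add: \<delta>_def)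
        also have "exp \<dots> = ln (real N)" using N1 by simp
        finally show ?thesis using N1 by (simp add: powr_add powr_half_sqrt)
      qed
      have "P N - bad N \<subseteq> good N"
      proof
        fix p assume p: "p \<in> P N - bad N"
        then have pr: "prime p" "p \<le> N" "p > 5" and
          rank: "\<And>d. 0 < d \<Longrightarrow> d \<le> 16 * index_bound N \<Longrightarrow> \<not> p dvd fib d"
          by (auto simp: P_def bad_def)
        have pk: "p < (index_bound N)\<^sup>2" using index_bound(1) [of N] pr(2) by linarith
        have "\<exists>n :: nat \<Rightarrow> nat. (\<forall>i<16. 1 \<le> n i \<and> real (n i) \<le> real N powr (1/2 + \<delta> N)) \<and>
            [(\<Sum>i<16. int (fib (n i))) = l] (mod int p)" for l
        proof -
          obtain n :: "nat \<Rightarrow> nat" where n: "\<forall>i<16. 1 \<le> n i \<and> n i \<le> 12 * index_bound N"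
              "[(\<Sum>i<16. int (fib (n i))) = l] (mod int p)"
            using every_residue_is_sum_of_16_fib [OF pr(1,3) pk rank, of l] by blast
          have "1 \<le> n i \<and> real (n i) \<le> real N powr (1/2 + \<delta> N)" if "i < 16" for i
          proof -
            have ni: "1 \<le> n i" "n i \<le> 12 * index_bound N" using n(1) that by blast+
            have "real (n i) \<le> real (12 * index_bound N)" using ni(2) by (rule of_nat_mono)
            also have "\<dots> \<le> 12 * (sqrt (real N) + 2)" using index_bound(3) [of N] by simp
            also have "\<dots> \<le> real N powr (1/2 + \<delta> N)" unfolding power by (rule elim(2))
            finally show ?thesis using ni(1) by blast
          qed
          then show ?thesis using n(2) by blast
        qed
        then show "p \<in> good N" unfolding good_def using pr by blast
      qed
      then have "P N \<subseteq> good N \<union> bad N" by blast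
      moreover have sub: "good N \<subseteq> P N" "bad N \<subseteq> P N" by (auto simp: good_def bad_def P_def)
      moreover have fins: "finite (good N)" "finite (bad N)" using sub finP finite_subset by blast+
      ultimately have "card (P N) \<le> card (good N \<union> bad N)" by (intro card_mono) auto
      also have "\<dots> \<le> card (good N) + card (bad N)" by (rule card_Un_le)
      finally have lower: "real (card (P N)) \<le> real (card (good N)) + real (card (bad N))" by linarith
      have upper: "real (card (good N)) \<le> real (card (P N))" using card_mono [OF finP sub(1)] by simp
      have "real (card (bad N)) \<le> e / 4 * (2 * real (card (P N)))"
        using bad mult_left_mono [OF pi, of "e / 4"] e by linarith
      then have "real (card (P N)) - real (card (good N)) \<le> e / 2 * real (card (P N))"
        using lower by simp
      then have "1 - real (card (good N)) / real (card (P N)) \<le> e / 2"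
        using P0 by (simp add: field_simps)
      moreover have "real (card (good N)) / real (card (P N)) \<le> 1" using upper P0 by simp
      ultimately show ?case using e unfolding dist_real_def by linarith
    qed
  qed
  then show "(\<lambda>N. real (card {p :: nat. prime p \<and> p \<le> N \<and>
        (\<forall>l :: int. \<exists>n :: nat \<Rightarrow> nat.
            (\<forall>i<16. 1 \<le> n i \<and> real (n i) \<le> real N powr (1/2 + \<delta> N)) \<and>
            [(\<Sum>i<16. int (fib (n i))) = l] (mod int p))})
      / real (card {p :: nat. prime p \<and> p \<le> N})) \<longlonglongrightarrow> 1"
    unfolding good_def P_def .
qed

end
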